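(* Let $d\ge1$, $0<h<1$ and $0<a\le1\le A<+\infty$. (1) Let $K\ge1$ be an integer, and let $\mathcal{P}_K^{(d)}=\mathcal{P}_{w_K^{(d)},h,a,A}$, where $w_K^{(d)}(j)=2^{dj}$ if $j\le K$ and $w_K^{(d)}(j)=2^{dK}$ otherwise. There are a constant $C_{K,h,a,A}>0$ depending only on $K,h,a,A$ (and $d$) and a deterministic sequence of ranks $J_n\in\mathbb{N}$ (not depending on $\pi$) such that for all integers $n\ge2$, $$\sup_{\pi\in\mathcal{P}_K^{(d)}}\mathcal{E}_\pi\big(\hat f_n^{(J_n)}\big)\le C_{K,h,a,A}\frac{\log n}{n}.$$ Moreover there is a constant $C_{0,K,h,a,A}>0$ depending only on $K,h,a,A$ (and $d$) such that for all integers $n\ge1$, $$\inf_{\hat f_n}\sup_{\pi\in\mathcal{P}_K^{(d)}}\mathcal{E}_\pi(\hat f_n)\ge C_{0,K,h,a,A}\,n^{-1}.$$ (2) Let $0<\alpha<1$, and let $\mathcal{P}_\alpha^{(d)}=\mathcal{P}_{w_\alpha^{(d)},h,a,A}$, where $w_\alpha^{(d)}(j)=2^{dj}$ if $j\le N^{(d)}(\alpha)$ and $w_\alpha^{(d)}(j)=2^{d\alpha j}$ otherwise, with $N^{(d)}(\alpha)=\inf\{N\in\mathbb{N}:2^{d\alpha N}\ge2^d-1\}$. There are a constant $C'_{\alpha,h,a,A}>0$ depending only on $\alpha,h,a,A$ (and $d$) and a deterministic sequence of ranks $J_n\in\mathbb{N}$ (not depending on $\pi$) such that for all integers $n\ge2$,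 $$\sup_{\pi\in\mathcal{P}_\alpha^{(d)}}\mathcal{E}_\pi\big(\hat f_n^{(J_n)}\big)\le C'_{\alpha,h,a,A}\Big(\frac{\log n}{n}\Big)^{1-\alpha}.$$ Moreover there is a constant $C'_{0,\alpha,h,a,A}>0$ depending only on $\alpha,h,a,A$ (and $d$) such that for all integers $n\ge1$, $$\inf_{\hat f_n}\sup_{\pi\in\mathcal{P}_\alpha^{(d)}}\mathcal{E}_\pi(\hat f_n)\ge C'_{0,\alpha,h,a,A}\,n^{-1+\alpha}.$$ In both cases $J_n$ can be taken of order $\left\lceil\log\big(an/(2^d\log n)\big)/(d\log2)\right\rceil$ up to a multiplying constant, i.e. for all sufficiently large $n$ the ratio of $J_n$ to this quantity lies between two positive constants independent of $n$. In the lower bounds the infimum is over all classifiers $\hat f_n$ based on $n$ observations.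
   Context: Notation: $\mathbb{N}=\{0,1,2,\dots\}$, $\mathbb{R}^+=[0,\infty)$, $\lambda_d$ is Lebesgue measure on $[0,1]^d$. Dyadic system. For $j\in\mathbb{N}$ let $I_d(j)=\{0,\dots,2^j-1\}^d$. Let $I_k^{(j)}=[k2^{-j},(k+1)2^{-j})$ for $0\le k\le 2^j-2$ and $I_{2^j-1}^{(j)}=[(2^j-1)2^{-j},1]$. For $\mathbf{k}=(k_1,\dots,k_d)\in I_d(j)$ let $\mathcal{I}_{\mathbf{k}}^{(j)}=I_{k_1}^{(j)}\times\dots\times I_{k_d}^{(j)}$ (a dyadic cell of frequency $j$) and $\phi_{\mathbf{k}}^{(j)}=\mathbf{1}_{\mathcal{I}_{\mathbf{k}}^{(j)}}$. Writing convention (W). An expansion $f=\sum_{j\ge0}\sum_{\mathbf{k}\in I_d(j)}a_{\mathbf{k}}^{(j)}\phi_{\mathbf{k}}^{(j)}$ ($\lambda_d$-a.e.; at each point only finitely many terms are nonzero) of a measurable function $f:[0,1]^d\to\{-1,1\}$ with $a_{\mathbf{k}}^{(j)}\in\{-1,0,1\}$ satisfies (W) if: (1) whenever $a_{\mathbf{k}}^{(j)}\ne0$, all coefficients of dyadic cells of higher frequency contained in $\mathcal{I}_{\mathbf{k}}^{(j)}$ are $0$; (2) low frequencies are preferred whenever possible: whenever $f$ is $\lambda_d$-a.e. constant on a dyadic cell, that cell or a dyadic cell containing it has a nonzero coefficient (in particular the $2^d$ subcells of frequency $j+1$ of a cell of frequency $j$ never all carry the same nonzero coefficient). Such an expansion,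 if it exists, is unique. Class $\mathcal{F}_w^{(d)}$: for $w:\mathbb{N}\to\mathbb{R}^+$, the set of functions $f:[0,1]^d\to\{-1,1\}$ admitting an expansion satisfying (W) with $\mathrm{card}\{\mathbf{k}\in I_d(j):a_{\mathbf{k}}^{(j)}\neq0\}\le w(j)$ for all $j\in\mathbb{N}$ (functions are identified when equal $\lambda_d$-a.e.). Classification. A probability measure $\pi$ on $[0,1]^d\times\{-1,1\}$ is the law of $(X,Y)$; $P^X$ is its marginal on $[0,1]^d$ and $\eta(x)=\mathbb{P}(Y=1\mid X=x)$. For a measurable $f:[0,1]^d\to\{-1,1\}$ (prediction rule), $R(f)=\mathbb{P}(f(X)\ne Y)$. The Bayes rule is $f^*=\mathrm{sign}(2\eta-1)$ and $R^*=R(f^* )=\min_fR(f)$. The data are $D_n=(X_i,Y_i)_{1\le i\le n}$, i.i.d. with law $\pi$. A classifier $\hat f_n$ is a prediction rule built (measurably) from $D_n$; $R(\hat f_n)=\mathbb{P}(\hat f_n(X)\ne Y\mid D_n)$ with $(X,Y)$ independent of $D_n$, and its excess risk is $\mathcal{E}_\pi(\hat f_n)=\mathbb{E}_\pi[R(\hat f_n)-R^*]$, the expectation being over $D_n$. Model. $\mathcal{P}_{w,h,a,A}$ is the set of all probability measures $\pi$ on $[0,1]^d\times\{-1,1\}$ such that: $P^X\ll\lambda_d$ with $a\le dP^X/d\lambda_d(x)\le A$ for all $x\in[0,1]^d$; $\mathbb{P}(|2\eta(X)-1|\ge h)=1$; and the Bayes rule $f^*$ belongs to $\mathcal{F}_w^{(d)}$.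 Estimator. For $J\in\mathbb{N}$, $\hat f_n^{(J)}=\sum_{\mathbf{k}\in I_d(J)}\hat A_{\mathbf{k}}^{(J)}\phi_{\mathbf{k}}^{(J)}$, where $\hat A_{\mathbf{k}}^{(J)}=1$ if at least one $X_i$ lies in $\mathcal{I}_{\mathbf{k}}^{(J)}$ and $\mathrm{card}\{i:X_i\in\mathcal{I}_{\mathbf{k}}^{(J)},Y_i=1\}>\mathrm{card}\{i:X_i\in\mathcal{I}_{\mathbf{k}}^{(J)},Y_i=-1\}$, and $\hat A_{\mathbf{k}}^{(J)}=-1$ otherwise. *)

theory Defs
  imports "HOL-Probability.Probability"
begin

section \<open>The unit cube and its dyadic cells\<close>

text \<open>
  The dimension is \<open>d = CARD('n)\<close>. Functions on the cube are functions on the whole space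
  whose values off the cube are irrelevant.
\<close>

definition unit_cube :: "(real ^ 'n) set" where
  "unit_cube = cbox 0 1"

definition cube_lebesgue :: "(real ^ 'n) measure" where
  "cube_lebesgue = restrict_space lborel unit_cube"

definition dyadic_index :: "nat \<Rightarrow> ('n \<Rightarrow> nat) set" where
  "dyadic_index j = {k. \<forall>i. k i < 2 ^ j}"

definition dyadic_interval :: "nat \<Rightarrow> nat \<Rightarrow> real set" where
  "dyadic_interval j k =
     (if k = 2 ^ j - 1 then {real k / 2 ^ j .. 1} else {real k / 2 ^ j ..< real (k + 1) / 2 ^ j})"

definition dyadic_cell :: "nat \<Rightarrow> ('n \<Rightarrow> nat) \<Rightarrow> (real ^ 'n) set" where
  "dyadic_cell j k = {x. \<forall>i. x $ i \<in> dyadic_interval j (k i)}"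


section \<open>Sparse dyadic expansions\<close>

definition label_space :: "real measure" where
  "label_space = count_space {-1, 1}"

definition prediction_rules :: "(real ^ 'n \<Rightarrow> real) set" where
  "prediction_rules = cube_lebesgue \<rightarrow>\<^sub>M label_space"

text \<open>
  Coefficients \<open>a j k\<close> with \<open>k \<notin> dyadic_index j\<close> play no role.
\<close>

definition dyadic_expansion ::
  "(real ^ 'n \<Rightarrow> real) \<Rightarrow> (nat \<Rightarrow> ('n \<Rightarrow> nat) \<Rightarrow> real) \<Rightarrow> bool" where
  "dyadic_expansion f a \<longleftrightarrow>
     (\<forall>j. \<forall>k\<in>dyadic_index j. a j k \<in> {-1, 0, 1}) \<and>
     (\<forall>x\<in>unit_cube. finite {(j, k). k \<in> dyadic_index j \<and> a j k * indicator (dyadic_cell j k) x \<noteq> 0}) \<and>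
     (AE x in cube_lebesgue. f x = (\<Sum>j. \<Sum>k\<in>dyadic_index j. a j k * indicator (dyadic_cell j k) x))"

definition ae_constant_on :: "(real ^ 'n \<Rightarrow> real) \<Rightarrow> (real ^ 'n) set \<Rightarrow> bool" where
  "ae_constant_on f S \<longleftrightarrow> (\<exists>c. AE x in cube_lebesgue. x \<in> S \<longrightarrow> f x = c)"

definition writing_convention ::
  "(real ^ 'n \<Rightarrow> real) \<Rightarrow> (nat \<Rightarrow> ('n \<Rightarrow> nat) \<Rightarrow> real) \<Rightarrow> bool" where
  "writing_convention f a \<longleftrightarrow>
     (\<forall>j. \<forall>k\<in>dyadic_index j. a j k \<noteq> 0 \<longrightarrow>
        (\<forall>j'>j. \<forall>k'\<in>dyadic_index j'. dyadic_cell j' k' \<subseteq> dyadic_cell j k \<longrightarrow> a j' k' = 0)) \<and>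
     (\<forall>j. \<forall>k\<in>dyadic_index j. ae_constant_on f (dyadic_cell j k) \<longrightarrow>
        (\<exists>j'. \<exists>k'\<in>dyadic_index j'. dyadic_cell j k \<subseteq> dyadic_cell j' k' \<and> a j' k' \<noteq> 0))"

definition sparse_class :: "(nat \<Rightarrow> real) \<Rightarrow> (real ^ 'n \<Rightarrow> real) set" where
  "sparse_class w =
     {f \<in> prediction_rules. \<exists>a. dyadic_expansion f a \<and> writing_convention f a \<and>
        (\<forall>j. real (card {k \<in> dyadic_index j. a j k \<noteq> 0}) \<le> w j)}"


section \<open>Classification\<close>

definition observation_space :: "((real ^ 'n) \<times> real) measure" where
  "observation_space = cube_lebesgue \<Otimes>\<^sub>M label_space"

definition marginal :: "((real ^ 'n) \<times> real) measure \<Rightarrow> (real ^ 'n) measure" where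
  "marginal \<pi> = distr \<pi> cube_lebesgue fst"

text \<open>
  \<open>P (Y = 1 | X = x)\<close>, as the Radon-Nikodym derivative of \<open>B \<mapsto> P (X \<in> B, Y = 1)\<close>
  with respect to the law of \<open>X\<close>.
\<close>

definition regression :: "((real ^ 'n) \<times> real) measure \<Rightarrow> real ^ 'n \<Rightarrow> real" where
  "regression \<pi> x =
     enn2real (RN_deriv (marginal \<pi>)
       (distr (density \<pi> (indicator (UNIV \<times> {1}))) cube_lebesgue fst) x)"

text \<open>
  The value of the sign function at 0 is immaterial under a margin condition; it is chosen
  so that the Bayes rule takes values in \<open>{-1, 1}\<close> everywhere.
\<close>

definition bayes_rule :: "((real ^ 'n) \<times> real) measure \<Rightarrow> real ^ 'n \<Rightarrow> real" where
  "bayes_rule \<pi> x = (if 2 * regression \<pi> x - 1 > 0 then 1 else -1)"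

definition risk :: "((real ^ 'n) \<times> real) measure \<Rightarrow> (real ^ 'n \<Rightarrow> real) \<Rightarrow> real" where
  "risk \<pi> f = measure \<pi> {z \<in> space \<pi>. f (fst z) \<noteq> snd z}"

definition bayes_risk :: "((real ^ 'n) \<times> real) measure \<Rightarrow> real" where
  "bayes_risk \<pi> = risk \<pi> (bayes_rule \<pi>)"

text \<open>A sample of size \<open>n\<close> is a function on \<open>{..<n}\<close>.\<close>

definition classifiers :: "nat \<Rightarrow> ((nat \<Rightarrow> (real ^ 'n) \<times> real) \<Rightarrow> real ^ 'n \<Rightarrow> real) set" where
  "classifiers n =
     {F. (\<lambda>(D, x). F D x) \<in> (\<Pi>\<^sub>M i\<in>{..<n}. observation_space) \<Otimes>\<^sub>M cube_lebesgue \<rightarrow>\<^sub>M label_space}"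

definition excess_risk ::
  "nat \<Rightarrow> ((real ^ 'n) \<times> real) measure \<Rightarrow>
   ((nat \<Rightarrow> (real ^ 'n) \<times> real) \<Rightarrow> real ^ 'n \<Rightarrow> real) \<Rightarrow> real" where
  "excess_risk n \<pi> F = (\<integral>D. (risk \<pi> (F D) - bayes_risk \<pi>) \<partial>(\<Pi>\<^sub>M i\<in>{..<n}. \<pi>))"


section \<open>The model\<close>

definition model ::
  "(nat \<Rightarrow> real) \<Rightarrow> real \<Rightarrow> real \<Rightarrow> real \<Rightarrow> ((real ^ 'n) \<times> real) measure set" where
  "model w h a A =
     {\<pi>. prob_space \<pi> \<and> sets \<pi> = sets observation_space \<and>
        (\<exists>g \<in> borel_measurable cube_lebesgue.
           marginal \<pi> = density cube_lebesgue (\<lambda>x. ennreal (g x)) \<and>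
           (\<forall>x\<in>unit_cube. a \<le> g x \<and> g x \<le> A)) \<and>
        (AE z in \<pi>. h \<le> \<bar>2 * regression \<pi> (fst z) - 1\<bar>) \<and>
        bayes_rule \<pi> \<in> sparse_class w}"

definition saturating_weight :: "nat \<Rightarrow> nat \<Rightarrow> nat \<Rightarrow> real" where
  "saturating_weight d K j = (if j \<le> K then 2 ^ (d * j) else 2 ^ (d * K))"

definition exponential_threshold :: "nat \<Rightarrow> real \<Rightarrow> nat" where
  "exponential_threshold d \<alpha> = Inf {N. 2 powr (real d * \<alpha> * real N) \<ge> 2 ^ d - 1}"

definition exponential_weight :: "nat \<Rightarrow> real \<Rightarrow> nat \<Rightarrow> real" where
  "exponential_weight d \<alpha> j =
     (if j \<le> exponential_threshold d \<alpha> then 2 ^ (d * j) else 2 powr (real d * \<alpha> * real j))"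


section \<open>The dyadic majority-vote estimator\<close>

definition majority_coeff ::
  "nat \<Rightarrow> nat \<Rightarrow> (nat \<Rightarrow> (real ^ 'n) \<times> real) \<Rightarrow> ('n \<Rightarrow> nat) \<Rightarrow> real" where
  "majority_coeff n J D k =
     (if (\<exists>i<n. fst (D i) \<in> dyadic_cell J k) \<and>
         card {i. i < n \<and> fst (D i) \<in> dyadic_cell J k \<and> snd (D i) = 1} >
         card {i. i < n \<and> fst (D i) \<in> dyadic_cell J k \<and> snd (D i) = -1}
      then 1 else -1)"

definition dyadic_estimator ::
  "nat \<Rightarrow> nat \<Rightarrow> (nat \<Rightarrow> (real ^ 'n) \<times> real) \<Rightarrow> real ^ 'n \<Rightarrow> real" where
  "dyadic_estimator n J D x =
     (\<Sum>k\<in>dyadic_index J. majority_coeff n J D k * indicator (dyadic_cell J k) x)"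

definition reference_rank :: "nat \<Rightarrow> real \<Rightarrow> nat \<Rightarrow> int" where
  "reference_rank d a n = \<lceil>ln (a * real n / (2 ^ d * ln (real n))) / (real d * ln 2)\<rceil>"

definition of_reference_order :: "nat \<Rightarrow> real \<Rightarrow> (nat \<Rightarrow> nat) \<Rightarrow> bool" where
  "of_reference_order d a J \<longleftrightarrow>
     (\<exists>c1>0. \<exists>c2>0. \<forall>\<^sub>F n in sequentially.
        c1 \<le> real (J n) / real_of_int (reference_rank d a n) \<and>
        real (J n) / real_of_int (reference_rank d a n) \<le> c2)"

end

theory Submission
  imports Defs "HOL-Real_Asymp.Real_Asymp"
begin

text \<open>
  Upper bound. At rank \<open>J\<close> the cube splits into the cells of frequency \<open>J\<close> lying inside a cell with a
  nonzero coefficient, on each of which the Bayes rule is a.e. constant, and a remainder covered by the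
  cells with nonzero coefficients of frequency above \<open>J\<close>, whose volume is the tail of a geometric series.
  On a cell of the first kind with mass \<open>p\<close>, a Chernoff bound makes the majority vote wrong with
  probability at most \<open>exp (- n p h\<^sup>2 / 2)\<close>. Taking \<open>2 ^ (d J)\<close> of order \<open>n / ln n\<close> balances the two.

  Lower bound. With a uniform design, let the Bayes rule be 1 except for arbitrary signs on the cells of
  frequency \<open>J\<close> inside one fixed cell of frequency \<open>m\<close>. When no observation falls in a given small cell,
  the data carry no information on its sign, so averaging over all signs the excess risk is at
  least \<open>h / 2\<close> times the volume of the cell of frequency \<open>m\<close> times the probability of missing a cell.
  With \<open>2 ^ (d J)\<close> of order \<open>n\<close> that probability is bounded below, and the sparsity constraint
  permits \<open>m = J\<close> in the saturating case and \<open>m\<close> about \<open>(1 - \<alpha>) J\<close> in the exponential one.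
\<close>

section \<open>Dyadic cells\<close>

text \<open>Both weights satisfy \<open>w j \<le> c * 2 ^ (d * j) * \<rho> ^ j\<close> with
  \<open>\<rho> = 2 powr (- (d * \<beta>))\<close>, where \<beta> is 1 in the saturating case and 1
  - \<alpha> in the exponential one, so a single argument gives both upper bounds. The logarithm is
  the price of making exp (- n p h^2 / 2) of size 1 / n when p is only known to be at least a / 2^(d
  J). The lower bound meets no such factor, since it only uses whether a cell is empty.

  The delicate point of the lower bound is sparsity: an expansion obeying the writing convention
  must be exhibited, and the number of its cells must fit the weight at every frequency, not only at
  J. Its cells are the maximal ones on which the rule is a.e. constant. Gathering the free signs in
  one corner cell keeps their number small: every such cell of positive frequency is a child of a
  cell meeting that corner, so at frequencies below m there are only siblings of a single chain of
  ancestors.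

  The regression function is a Radon-Nikodym derivative, hence the Bayes rule is known only up to
  null sets, and the statements about its values are a.e. statements.\<close>

text \<open>The minimum moves the face \<open>x $ i = 1\<close>, where the floor is 2^j, into the
  last interval, which is closed. Belonging to a cell becomes an equation on positions, so
  disjointness and nesting of cells reduce to arithmetic.\<close>

definition dyadic_pos :: "nat \<Rightarrow> real ^ 'n \<Rightarrow> 'n \<Rightarrow> nat" where
  "dyadic_pos j x i = min (nat \<lfloor>2 ^ j * x $ i\<rfloor>) (2 ^ j - 1)"

lemma mem_unit_cube: "x \<in> unit_cube \<longleftrightarrow> (\<forall>i. 0 \<le> x $ i \<and> x $ i \<le> 1)"
  by (auto simp: unit_cube_def mem_box_cart)

lemma mem_dyadic_interval_iff:
  assumes "0 \<le> t" "t \<le> 1" "k < 2 ^ j"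
  shows "t \<in> dyadic_interval j k \<longleftrightarrow> k = min (nat \<lfloor>2 ^ j * t\<rfloor>) (2 ^ j - 1)"
proof -
  define q where "q = 2 ^ j * t"
  have q: "0 \<le> q" "q \<le> 2 ^ j" using assms by (auto simp: q_def mult_left_le)
  have t1: "real k / 2 ^ j \<le> t \<longleftrightarrow> real k \<le> q" and t2: "t < real (k + 1) / 2 ^ j \<longleftrightarrow> q < real k + 1"
    by (auto simp: q_def field_simps)
  show ?thesis
  proof (cases "k = 2 ^ j - 1")
    case True
    have "real k \<le> q \<longleftrightarrow> k \<le> nat \<lfloor>q\<rfloor>"
      using q by (simp add: le_nat_iff le_floor_iff)
    then show ?thesis using True t1 assms unfolding dyadic_interval_def q_def[symmetric] by auto
  next
    case False
    have "real k \<le> q \<and> q < real k + 1 \<longleftrightarrow> nat \<lfloor>q\<rfloor> = k"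
      using q by linarith
    moreover have "k < 2 ^ j - 1" using False assms by linarith
    then have "nat \<lfloor>q\<rfloor> = k \<longleftrightarrow> k = min (nat \<lfloor>q\<rfloor>) (2 ^ j - 1)" by (auto simp: min_def)
    moreover have "t \<in> dyadic_interval j k \<longleftrightarrow> real k \<le> q \<and> q < real k + 1"
      using False t1 t2 unfolding dyadic_interval_def by auto
    ultimately show ?thesis
      unfolding q_def[symmetric] by blast
  qed
qed

lemma dyadic_interval_bounds:
  assumes "k < 2 ^ j" "t \<in> dyadic_interval j k"
  shows "real k / 2 ^ j \<le> t" "t \<le> real (k + 1) / 2 ^ j" "0 \<le> t" "t \<le> 1"
proof -
  have *: "real (k + 1) / 2 ^ j \<le> 1"
    using assms(1) by (simp add: divide_simps) (metis Suc_leI of_nat_Suc of_nat_le_iff of_nat_numeral of_nat_power add.commute)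
  show 1: "real k / 2 ^ j \<le> t" using assms by (auto simp: dyadic_interval_def split: if_splits)
  show "0 \<le> t" using 1 by (meson divide_nonneg_nonneg of_nat_0_le_iff order_trans zero_le_numeral zero_le_power)
  show "t \<le> real (k + 1) / 2 ^ j"
    using assms by (auto simp: dyadic_interval_def of_nat_diff split: if_splits)
  then show "t \<le> 1" using * by linarith
qed

lemma dyadic_cell_subset_unit_cube: "k \<in> dyadic_index j \<Longrightarrow> dyadic_cell j k \<subseteq> unit_cube"
  unfolding dyadic_cell_def dyadic_index_def mem_unit_cube subset_iff mem_Collect_eq
  using dyadic_interval_bounds by blast

lemma dyadic_pos_in_index [simp]: "dyadic_pos j x \<in> dyadic_index j"
  by (auto simp: dyadic_pos_def dyadic_index_def min_def le_less_trans[of _ "2^j-1" "2^j"])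

lemma mem_dyadic_cell_iff:
  assumes "k \<in> dyadic_index j"
  shows "x \<in> dyadic_cell j k \<longleftrightarrow> x \<in> unit_cube \<and> dyadic_pos j x = k"
proof (cases "x \<in> unit_cube")
  case True
  then show ?thesis
    using assms unfolding dyadic_cell_def dyadic_index_def mem_unit_cube
    by (auto simp: mem_dyadic_interval_iff fun_eq_iff dyadic_pos_def)
qed (use dyadic_cell_subset_unit_cube[OF assms] in auto)

lemma floor_div_power:
  fixes q :: real
  assumes "0 \<le> q"
  shows "nat \<lfloor>q\<rfloor> div 2 ^ r = nat \<lfloor>q / 2 ^ r\<rfloor>"
proof -
  have "\<lfloor>q / real_of_int (2 ^ r)\<rfloor> = \<lfloor>q\<rfloor> div 2 ^ r"
    using floor_divide_real_eq_div[of "2 ^ r" q] by simp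
  then show ?thesis using assms by (simp add: nat_div_distrib nat_power_eq)
qed

text \<open>Taking the floor commutes with division by a power of two, and the clamping survives
  because (2^(j+r) - 1) div 2^r is 2^j - 1 and \<open>div\<close> is monotone, hence compatible with
  \<open>min\<close>.\<close>

lemma dyadic_pos_div:
  assumes x: "x \<in> unit_cube" and "j \<le> j'"
  shows "dyadic_pos j x i = dyadic_pos j' x i div 2 ^ (j' - j)"
proof -
  define r where "r = j' - j"
  have j': "j' = j + r" using assms r_def by simp
  have "(2 ^ (j + r) - 1) div 2 ^ r = (2 ^ j - 1 :: nat)"
  proof -
    have "(2 ^ (j + r) - 1 :: nat) = (2 ^ j - 1) * 2 ^ r + (2 ^ r - 1)"
      by (simp add: power_add algebra_simps)
    also have "\<dots> div 2 ^ r = (2 ^ j - 1 :: nat)" by (subst div_mult_self3) auto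
    finally show ?thesis .
  qed
  moreover have "nat \<lfloor>2 ^ (j + r) * x $ i\<rfloor> div 2 ^ r = nat \<lfloor>2 ^ j * x $ i\<rfloor>"
    using x by (subst floor_div_power) (auto simp: mem_unit_cube power_add)
  moreover have "min a b div c = min (a div c) (b div c)" for a b c :: nat
    by (metis div_le_mono min.absorb2 min.orderE nle_le)
  ultimately show ?thesis by (simp add: dyadic_pos_def j')
qed

lemma finite_dyadic_index [simp]: "finite (dyadic_index j :: ('n::finite \<Rightarrow> nat) set)"
  and card_dyadic_index: "card (dyadic_index j :: ('n::finite \<Rightarrow> nat) set) = 2 ^ (CARD('n) * j)"
proof -
  have *: "(dyadic_index j :: ('n \<Rightarrow> nat) set) = (\<Pi>\<^sub>E i\<in>UNIV. {..<2 ^ j})"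
    by (auto simp: dyadic_index_def PiE_def extensional_def)
  show "finite (dyadic_index j :: ('n::finite \<Rightarrow> nat) set)" unfolding * by (rule finite_PiE) auto
  show "card (dyadic_index j :: ('n::finite \<Rightarrow> nat) set) = 2 ^ (CARD('n) * j)"
    unfolding * by (simp add: card_PiE power_mult[symmetric] mult.commute)
qed

lemma dyadic_cell_nonempty:
  assumes "k \<in> dyadic_index j"
  shows "(\<chi> i. real (k i) / 2 ^ j) \<in> dyadic_cell j k"
  using assms unfolding dyadic_cell_def dyadic_index_def
  by (auto simp: dyadic_interval_def divide_simps of_nat_diff)

text \<open>Inclusion yields a common point, the lower corner of the small cell, and the positions
  of one point at two frequencies are related by division.\<close>

lemma dyadic_cell_subset_iff:
  assumes "j \<le> j'" "k \<in> dyadic_index j" "k' \<in> dyadic_index j'"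
  shows "dyadic_cell j' k' \<subseteq> dyadic_cell j k \<longleftrightarrow> k = (\<lambda>i. k' i div 2 ^ (j' - j))"
proof
  assume "dyadic_cell j' k' \<subseteq> dyadic_cell j k"
  then obtain x where "x \<in> dyadic_cell j' k'" "x \<in> dyadic_cell j k"
    using dyadic_cell_nonempty assms by blast
  then show "k = (\<lambda>i. k' i div 2 ^ (j' - j))"
    using assms by (auto simp: mem_dyadic_cell_iff dyadic_pos_div[OF _ assms(1)])
next
  assume "k = (\<lambda>i. k' i div 2 ^ (j' - j))"
  then show "dyadic_cell j' k' \<subseteq> dyadic_cell j k"
    using assms by (auto simp: mem_dyadic_cell_iff fun_eq_iff dyadic_pos_div[OF _ assms(1)])
qed

lemma dyadic_cell_pos_mono:
  assumes "x \<in> unit_cube" "j \<le> j'"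
  shows "dyadic_cell j' (dyadic_pos j' x) \<subseteq> dyadic_cell j (dyadic_pos j x)"
  using assms by (subst dyadic_cell_subset_iff) (auto simp: dyadic_pos_div)

lemma dyadic_cell_pos_mem: "x \<in> unit_cube \<Longrightarrow> x \<in> dyadic_cell j (dyadic_pos j x)"
  by (simp add: mem_dyadic_cell_iff)

section \<open>Lebesgue measure on the cube and volume of the cells\<close>

lemma unit_cube_sets [measurable, simp]: "unit_cube \<in> sets borel"
  by (simp add: unit_cube_def)

lemma space_cube_lebesgue [simp]: "space cube_lebesgue = unit_cube"
  by (simp add: cube_lebesgue_def space_restrict_space)

lemma sets_cube_lebesgue: "S \<in> sets cube_lebesgue \<longleftrightarrow> S \<subseteq> unit_cube \<and> S \<in> sets borel"
  by (simp add: cube_lebesgue_def sets_restrict_space_iff)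

lemma emeasure_cube_lebesgue:
  "S \<subseteq> unit_cube \<Longrightarrow> emeasure cube_lebesgue S = emeasure lborel S"
  by (simp add: cube_lebesgue_def emeasure_restrict_space)

lemma cbox_0_1_ne: "cbox 0 1 \<noteq> ({} :: (real ^ 'n) set)"
proof -
  have "0 \<in> (cbox 0 1 :: (real ^ 'n) set)" by (simp add: mem_box_cart)
  then show ?thesis by blast
qed

lemma prob_space_cube_lebesgue: "prob_space (cube_lebesgue :: (real ^ 'n) measure)"
proof
  have "measure lborel (cbox 0 1 :: (real ^ 'n) set) = 1"
    using content_cbox_cart[OF cbox_0_1_ne] by simp
  then have "emeasure lborel (unit_cube :: (real ^ 'n) set) = 1"
    using emeasure_lborel_cbox_finite[of "0 :: real ^ 'n" 1]
    by (subst emeasure_eq_ennreal_measure) (auto simp: unit_cube_def)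
  then show "emeasure cube_lebesgue (space cube_lebesgue :: (real ^ 'n) set) = 1"
    by (simp add: emeasure_cube_lebesgue)
qed

lemma dyadic_interval_borel [measurable]: "dyadic_interval j k \<in> sets borel"
  by (simp add: dyadic_interval_def)

lemma dyadic_cell_borel [measurable]: "dyadic_cell j (k :: 'n::finite \<Rightarrow> nat) \<in> sets borel"
proof -
  have "dyadic_cell j k = (\<Inter>i. (\<lambda>x. x $ i) -` dyadic_interval j (k i) \<inter> space borel)"
    by (auto simp: dyadic_cell_def)
  moreover have "(\<lambda>x. x $ i) -` dyadic_interval j (k i) \<inter> space borel \<in> sets borel" for i :: 'n
    by (rule measurable_sets[OF borel_measurable_continuous_onI]) (auto intro!: continuous_intros)
  ultimately show ?thesis by auto
qed

lemma dyadic_cell_sets_cube [measurable]: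
  "k \<in> dyadic_index j \<Longrightarrow> dyadic_cell j k \<in> sets cube_lebesgue"
  by (simp add: sets_cube_lebesgue dyadic_cell_subset_unit_cube)

text \<open>Which faces belong to the cell is immaterial: it lies between an open and a closed box
  of the same volume.\<close>

lemma measure_dyadic_cell:
  fixes k :: "'n::finite \<Rightarrow> nat"
  assumes "k \<in> dyadic_index j"
  shows "measure cube_lebesgue (dyadic_cell j k) = 1 / 2 ^ (CARD('n) * j)"
proof -
  interpret prob_space "cube_lebesgue :: (real ^ 'n) measure" by (rule prob_space_cube_lebesgue)
  let ?a = "\<chi> i. real (k i) / 2 ^ j :: real ^ 'n"
  let ?b = "\<chi> i. real (k i + 1) / 2 ^ j :: real ^ 'n"
  have kl: "k i < 2 ^ j" for i using assms by (simp add: dyadic_index_def)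
  have int: "{real m / 2 ^ j <..< real (m + 1) / 2 ^ j} \<subseteq> dyadic_interval j m" if "m < 2 ^ j" for m
    by (auto simp: dyadic_interval_def of_nat_diff)
  have "x \<in> dyadic_cell j k" if "x \<in> box ?a ?b" for x
    unfolding dyadic_cell_def mem_Collect_eq
  proof
    fix i
    have "x $ i \<in> {real (k i) / 2 ^ j <..< real (k i + 1) / 2 ^ j}"
      using that by (simp add: mem_box_cart)
    then show "x $ i \<in> dyadic_interval j (k i)" using int[OF kl] by blast
  qed
  moreover have "x \<in> cbox ?a ?b" if "x \<in> dyadic_cell j k" for x
    using that dyadic_interval_bounds(1,2)[OF kl] by (simp add: mem_box_cart dyadic_cell_def)
  ultimately have sub: "box ?a ?b \<subseteq> dyadic_cell j k" "dyadic_cell j k \<subseteq> cbox ?a ?b" by auto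
  have le: "?a \<bullet> b \<le> ?b \<bullet> b" if "b \<in> Basis" for b
    using that by (auto simp: Basis_vec_def inner_axis divide_right_mono)
  have ne: "cbox ?a ?b \<noteq> {}" using sub dyadic_cell_nonempty[OF assms] by blast
  have "measure lborel (cbox ?a ?b) = (\<Prod>i::'n\<in>UNIV. 1 / 2 ^ j)"
    using content_cbox_cart[OF ne] by (simp add: diff_divide_distrib[symmetric])
  also have "\<dots> = 1 / 2 ^ (CARD('n) * j)"
    by (simp add: power_one_over[symmetric] power_mult[symmetric] mult.commute)
  finally have c: "measure lborel (cbox ?a ?b) = 1 / 2 ^ (CARD('n) * j)" .
  have e: "emeasure lborel (box ?a ?b) = emeasure lborel (cbox ?a ?b)"
    using le by (simp add: emeasure_lborel_box_eq emeasure_lborel_cbox_eq)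
  have "emeasure lborel (dyadic_cell j k) = emeasure lborel (cbox ?a ?b)"
    using emeasure_mono[OF sub(1), of lborel] emeasure_mono[OF sub(2), of lborel] e
    by (simp add: antisym)
  then show ?thesis using c
    by (simp add: measure_def emeasure_cube_lebesgue dyadic_cell_subset_unit_cube assms)
qed

lemma emeasure_dyadic_cell:
  fixes k :: "'n::finite \<Rightarrow> nat"
  assumes "k \<in> dyadic_index j"
  shows "emeasure cube_lebesgue (dyadic_cell j k) = ennreal (1 / 2 ^ (CARD('n) * j))"
proof -
  interpret prob_space "cube_lebesgue :: (real ^ 'n) measure" by (rule prob_space_cube_lebesgue)
  show ?thesis by (simp add: emeasure_eq_measure measure_dyadic_cell assms)
qed

text \<open>A cell has positive volume, so a.e. statements on it share a point. Serves to confront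
  two a.e. descriptions of a rule on the same cell.\<close>

lemma AE_dyadic_cell_False:
  assumes "AE x in cube_lebesgue. x \<in> dyadic_cell j k \<longrightarrow> False" "k \<in> dyadic_index j"
  shows False
proof -
  have "AE x in cube_lebesgue. x \<notin> dyadic_cell j k" using assms(1) by simp
  then have "emeasure cube_lebesgue (dyadic_cell j k) = 0"
    using assms(2) by (subst (asm) AE_iff_measurable[of "dyadic_cell j k"]) 
      (auto dest: dyadic_cell_subset_unit_cube)
  then show False using assms(2) by (simp add: emeasure_dyadic_cell)
qed

section \<open>Labels and prediction rules\<close>

lemma space_label_space [simp]: "space label_space = {-1, 1}"
  and sets_label_space [simp]: "sets label_space = Pow {-1, 1}"
  by (auto simp: label_space_def)

lemma prediction_rules_range: "f \<in> prediction_rules \<Longrightarrow> x \<in> unit_cube \<Longrightarrow> f x = -1 \<or> f x = 1"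
  unfolding prediction_rules_def using measurable_space[of f cube_lebesgue label_space x] by auto

lemma label_space_measurable_iff:
  "f \<in> M \<rightarrow>\<^sub>M label_space \<longleftrightarrow> f \<in> borel_measurable M \<and> (\<forall>x\<in>space M. f x \<in> {-1, 1})"
proof
  assume f: "f \<in> M \<rightarrow>\<^sub>M label_space"
  have "(\<lambda>y. y) \<in> label_space \<rightarrow>\<^sub>M borel" by (simp add: label_space_def)
  then show "f \<in> borel_measurable M \<and> (\<forall>x\<in>space M. f x \<in> {-1, 1})"
    using measurable_compose[OF f] measurable_space[OF f] by auto
next
  assume f: "f \<in> borel_measurable M \<and> (\<forall>x\<in>space M. f x \<in> {-1, 1})"
  show "f \<in> M \<rightarrow>\<^sub>M label_space"
    unfolding label_space_def
    by (subst measurable_count_space_eq2) (use f in \<open>auto intro!: measurable_sets\<close>)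
qed

lemma sum_dyadic_index_indicator:
  fixes c :: "('n::finite \<Rightarrow> nat) \<Rightarrow> real"
  assumes "x \<in> unit_cube"
  shows "(\<Sum>k\<in>dyadic_index j. c k * indicator (dyadic_cell j k) x) = c (dyadic_pos j x)"
proof -
  have "(\<Sum>k\<in>dyadic_index j. c k * indicator (dyadic_cell j k) x)
      = (\<Sum>k\<in>dyadic_index j. if k = dyadic_pos j x then c k else 0)"
    using assms by (intro sum.cong) (auto simp: mem_dyadic_cell_iff indicator_def)
  then show ?thesis by simp
qed

section \<open>Sparse expansions\<close>

text \<open>Index of the cell of frequency \<open>j\<close> that contains cell \<open>k\<close> of
  frequency \<open>j'\<close>, for \<open>j \<le> j'\<close>; the coarser frequency comes
  first.\<close>

definition dyadic_ancestor :: "nat \<Rightarrow> nat \<Rightarrow> ('n \<Rightarrow> nat) \<Rightarrow> 'n \<Rightarrow> nat" where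
  "dyadic_ancestor j j' k i = k i div 2 ^ (j' - j)"

lemma dyadic_ancestor_in_index:
  assumes "k \<in> dyadic_index j'" "j \<le> j'"
  shows "dyadic_ancestor j j' k \<in> dyadic_index j"
proof -
  have "k i < 2 ^ j * 2 ^ (j' - j)" for i
    using assms by (simp add: dyadic_index_def power_add[symmetric])
  then show ?thesis by (simp add: dyadic_index_def dyadic_ancestor_def less_mult_imp_div_less)
qed

lemma dyadic_ancestor_pos:
  "x \<in> unit_cube \<Longrightarrow> j \<le> j' \<Longrightarrow> dyadic_ancestor j j' (dyadic_pos j' x) = dyadic_pos j x"
  by (auto simp: dyadic_ancestor_def fun_eq_iff dyadic_pos_div)

lemma dyadic_ancestor_trans:
  assumes "j'' \<le> j'" "j' \<le> j"
  shows "dyadic_ancestor j'' j' (dyadic_ancestor j' j k) = dyadic_ancestor j'' j k"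
proof -
  have "(2::nat) ^ (j - j'') = 2 ^ (j - j') * 2 ^ (j' - j'')"
    using assms by (simp add: power_add[symmetric])
  then show ?thesis by (simp add: dyadic_ancestor_def fun_eq_iff div_mult2_eq)
qed

lemma dyadic_ancestor_refl [simp]: "dyadic_ancestor j j k = k"
  by (simp add: dyadic_ancestor_def fun_eq_iff)

lemma dyadic_cell_subset_ancestor:
  assumes "j \<le> j'" "k' \<in> dyadic_index j'"
  shows "dyadic_cell j' k' \<subseteq> dyadic_cell j (dyadic_ancestor j j' k')"
  using dyadic_cell_subset_iff[OF assms(1) dyadic_ancestor_in_index[OF assms(2,1)] assms(2)]
  by (simp add: dyadic_ancestor_def fun_eq_iff)

text \<open>These cells form the support of the expansion in \<open>sparse_classI\<close>: a
  coefficient needs a.e. constancy on its cell, and the preference for low frequencies forbids a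
  larger constant cell around it.\<close>

definition maximal_constant :: "(real ^ 'n \<Rightarrow> real) \<Rightarrow> nat \<Rightarrow> ('n \<Rightarrow> nat) \<Rightarrow> bool" where
  "maximal_constant f j k \<longleftrightarrow> ae_constant_on f (dyadic_cell j k) \<and>
     (\<forall>j'<j. \<not> ae_constant_on f (dyadic_cell j' (dyadic_ancestor j' j k)))"

lemma maximal_constant_pos_unique:
  assumes "x \<in> unit_cube" "maximal_constant f j (dyadic_pos j x)" "maximal_constant f j' (dyadic_pos j' x)"
  shows "j = j'"
proof (rule ccontr)
  have *: False if "j < j'" "maximal_constant f j (dyadic_pos j x)" "maximal_constant f j' (dyadic_pos j' x)" for j j'
    using that assms(1) dyadic_ancestor_pos[OF assms(1), of j j'] by (auto simp: maximal_constant_def)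
  assume "j \<noteq> j'"
  then show False using *[of j j'] *[of j' j] assms by linarith
qed

lemma ex_maximal_constant:
  assumes "ae_constant_on f (dyadic_cell j k)" 
  obtains j' where "j' \<le> j" "maximal_constant f j' (dyadic_ancestor j' j k)"
proof -
  define P where "P = (\<lambda>j'. j' \<le> j \<and> ae_constant_on f (dyadic_cell j' (dyadic_ancestor j' j k)))"
  have "P j" using assms by (simp add: P_def)
  then have 1: "P (LEAST j'. P j')" by (rule LeastI)
  define l where "l = (LEAST j'. P j')"
  have l: "l \<le> j" "ae_constant_on f (dyadic_cell l (dyadic_ancestor l j k))"
    using 1 by (simp_all add: P_def l_def)
  have "\<not> ae_constant_on f (dyadic_cell j'' (dyadic_ancestor j'' l (dyadic_ancestor l j k)))" if "j'' < l" for j''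
    using not_less_Least[of j'' P] that l by (simp add: l_def[symmetric] dyadic_ancestor_trans) (simp add: P_def)
  then have "maximal_constant f l (dyadic_ancestor l j k)" using l by (simp add: maximal_constant_def)
  then show ?thesis using l that by blast
qed

text \<open>The coefficient of a maximal constant cell is the value of \<open>f\<close> there, all
  others vanish. Constancy at frequency \<open>J\<close> places every point of the cube in such a
  cell, and uniqueness of that cell leaves one term of the series at each point. Membership in the
  class is thereby reduced to counting.\<close>

theorem sparse_classI:
  assumes f: "f \<in> prediction_rules"
    and J: "\<And>k. k \<in> dyadic_index J \<Longrightarrow> ae_constant_on f (dyadic_cell J k)"
    and card: "\<And>j. real (card {k \<in> dyadic_index j. maximal_constant f j k}) \<le> w j"
  shows "f \<in> sparse_class w"
proof -
  define val where "val j k = (SOME c. AE x in cube_lebesgue. x \<in> dyadic_cell j k \<longrightarrow> f x = c)" for j k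
  define a where "a j k = (if maximal_constant f j k then val j k else 0)" for j k
  have val: "AE x in cube_lebesgue. x \<in> dyadic_cell j k \<longrightarrow> f x = val j k"
    if "ae_constant_on f (dyadic_cell j k)" for j k
    using that unfolding ae_constant_on_def val_def by (rule someI_ex)
  \<comment> \<open>The value is an arbitrary choice until positive volume provides a point where it
    equals \<open>f\<close>. It is therefore nonzero, and the support of \<open>a\<close> is exactly
    the set of maximal constant cells.\<close>
  have val1: "val j k = -1 \<or> val j k = 1"
    if "ae_constant_on f (dyadic_cell j k)" "k \<in> dyadic_index j" for j k
  proof (rule ccontr)
    assume *: "\<not> (val j k = -1 \<or> val j k = 1)"
    have "AE x in cube_lebesgue. x \<in> dyadic_cell j k \<longrightarrow> False"
      using val[OF that(1)] AE_space
    proof eventually_elim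
      case (elim x)
      then show ?case using * prediction_rules_range[OF f, of x] by auto
    qed
    then show False using that(2) by (rule AE_dyadic_cell_False)
  qed
  have a_nz: "a j k \<noteq> 0 \<longleftrightarrow> maximal_constant f j k" if "k \<in> dyadic_index j" for j k
    using val1[of j k] that by (auto simp: a_def maximal_constant_def)
  have ex: "\<exists>j. maximal_constant f j (dyadic_pos j x)" if "x \<in> unit_cube" for x
    using ex_maximal_constant[OF J[of "dyadic_pos J x"]] dyadic_ancestor_pos[OF that] by (metis dyadic_pos_in_index)
  have "dyadic_expansion f a"
    unfolding dyadic_expansion_def
  proof (intro conjI allI ballI)
    fix j and k :: "'a \<Rightarrow> nat" assume "k \<in> dyadic_index j"
    then show "a j k \<in> {-1, 0, 1}" using val1[of j k] by (auto simp: a_def maximal_constant_def)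
  next
    fix x :: "real ^ 'a" assume x: "x \<in> unit_cube"
    obtain j0 where j0: "maximal_constant f j0 (dyadic_pos j0 x)" using ex[OF x] by blast
    have "{(j, k). k \<in> dyadic_index j \<and> a j k * indicator (dyadic_cell j k) x \<noteq> 0} \<subseteq> {(j0, dyadic_pos j0 x)}"
      using maximal_constant_pos_unique[OF x _ j0]
      by (auto simp: a_nz mem_dyadic_cell_iff indicator_def split: if_splits)
    then show "finite {(j, k). k \<in> dyadic_index j \<and> a j k * indicator (dyadic_cell j k) x \<noteq> 0}"
      by (rule finite_subset) simp
  next
    \<comment> \<open>There are countably many cells, so one null set serves all of them.\<close>
    have "AE x in cube_lebesgue. \<forall>j. \<forall>k\<in>dyadic_index j. ae_constant_on f (dyadic_cell j k) \<longrightarrow> x \<in> dyadic_cell j k \<longrightarrow> f x = val j k"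
      by (intro AE_all_countable[THEN iffD2] AE_finite_allI allI AE_impI val) auto
    then show "AE x in cube_lebesgue. f x = (\<Sum>j. \<Sum>k\<in>dyadic_index j. a j k * indicator (dyadic_cell j k) x)"
      using AE_space
    proof eventually_elim
      case (elim x)
      then have x: "x \<in> unit_cube" by simp
      obtain j0 where j0: "maximal_constant f j0 (dyadic_pos j0 x)" using ex[OF x] by blast
      have "(\<Sum>j. a j (dyadic_pos j x)) = (\<Sum>j\<in>{j0}. a j (dyadic_pos j x))"
        by (rule suminf_finite) (use maximal_constant_pos_unique[OF x _ j0] in \<open>auto simp: a_def\<close>)
      moreover have "f x = val j0 (dyadic_pos j0 x)"
        using elim(1)[rule_format, of "dyadic_pos j0 x" j0] j0 dyadic_cell_pos_mem[OF x]
        by (simp add: maximal_constant_def)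
      ultimately show ?case
        using j0 by (simp add: sum_dyadic_index_indicator[OF x]) (simp add: a_def)
    qed
  qed
  moreover have "writing_convention f a"
    unfolding writing_convention_def
  proof (intro conjI allI ballI impI)
    fix j j' :: nat and k k' :: "'a \<Rightarrow> nat"
    assume k: "k \<in> dyadic_index j" and a: "a j k \<noteq> 0" and j: "j < j'"
      and k': "k' \<in> dyadic_index j'" and sub: "dyadic_cell j' k' \<subseteq> dyadic_cell j k"
    have "k = dyadic_ancestor j j' k'"
      using sub dyadic_cell_subset_iff[of j j' k k'] j k k' by (auto simp: dyadic_ancestor_def)
    then show "a j' k' = 0" using a k j by (auto simp: a_nz a_def maximal_constant_def)
  next
    fix j and k :: "'a \<Rightarrow> nat" assume k: "k \<in> dyadic_index j" and c: "ae_constant_on f (dyadic_cell j k)"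
    obtain j' where j': "j' \<le> j" "maximal_constant f j' (dyadic_ancestor j' j k)"
      using ex_maximal_constant[OF c] .
    have "dyadic_ancestor j' j k \<in> dyadic_index j'" by (rule dyadic_ancestor_in_index[OF k j'(1)])
    moreover have "a j' (dyadic_ancestor j' j k) \<noteq> 0" using j'(2) calculation by (simp add: a_nz)
    ultimately show "\<exists>j'. \<exists>k'\<in>dyadic_index j'. dyadic_cell j k \<subseteq> dyadic_cell j' k' \<and> a j' k' \<noteq> 0"
      using dyadic_cell_subset_ancestor[OF j'(1) k] by blast
  qed
  moreover have "{k \<in> dyadic_index j. a j k \<noteq> 0} = {k \<in> dyadic_index j. maximal_constant f j k}" for j
    using a_nz by auto
  ultimately show ?thesis using f card unfolding sparse_class_def by auto
qed

lemma expansion_pos_unique: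
  assumes W: "writing_convention f a" and x: "x \<in> unit_cube"
    and nz: "a j (dyadic_pos j x) \<noteq> 0" "a j' (dyadic_pos j' x) \<noteq> 0"
  shows "j = j'"
proof (rule ccontr)
  have *: "a j' (dyadic_pos j' x) = 0" if "a j (dyadic_pos j x) \<noteq> 0" "j < j'" for j j'
    using W that dyadic_cell_pos_mono[OF x, of j j']
    unfolding writing_convention_def by (metis dyadic_pos_in_index less_imp_le)
  assume "j \<noteq> j'"
  then show False using *[of j j'] *[of j' j] nz by linarith
qed

text \<open>The first half of the convention leaves at most one nonzero coefficient on the cells
  containing \<open>x\<close>, and \<open>f x \<noteq> 0\<close> excludes that there is none. The
  series then reduces to that coefficient.\<close>

lemma expansion_AE:
  assumes f: "f \<in> prediction_rules" and E: "dyadic_expansion f a" and W: "writing_convention f a"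
  shows "AE x in cube_lebesgue. \<exists>j. a j (dyadic_pos j x) \<noteq> 0 \<and> f x = a j (dyadic_pos j x)"
proof -
  have "AE x in cube_lebesgue. f x = (\<Sum>j. \<Sum>k\<in>dyadic_index j. a j k * indicator (dyadic_cell j k) x)"
    using E by (simp add: dyadic_expansion_def)
  then show ?thesis using AE_space
  proof eventually_elim
    case (elim x)
    then have x: "x \<in> unit_cube" by simp
    have fx: "f x = (\<Sum>j. a j (dyadic_pos j x))" using elim(1) by (simp only: sum_dyadic_index_indicator[OF x])
    have "\<exists>j. a j (dyadic_pos j x) \<noteq> 0"
    proof (rule ccontr)
      assume "\<nexists>j. a j (dyadic_pos j x) \<noteq> 0"
      then have "f x = 0" using fx by simp
      then show False using prediction_rules_range[OF f x] by auto
    qed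
    then obtain j0 where j0: "a j0 (dyadic_pos j0 x) \<noteq> 0" by blast
    have "(\<Sum>j. a j (dyadic_pos j x)) = (\<Sum>j\<in>{j0}. a j (dyadic_pos j x))"
      by (rule suminf_finite) (use expansion_pos_unique[OF W x j0] in auto)
    then show ?case using j0 fx by auto
  qed
qed

section \<open>Approximation of sparse rules at a fixed rank\<close>

text \<open>At frequency \<open>j\<close> at most \<open>w j\<close> cells of volume 2^(-d j) carry
  a coefficient, so their union has volume at most c \<rho>^j. Outside \<open>G\<close> almost every
  point has its coefficient at a frequency above \<open>J\<close>, which leaves the geometric tail
  starting at \<open>Suc J\<close>.\<close>

lemma sparse_class_approximation:
  fixes f :: "real ^ 'n::finite \<Rightarrow> real"
  assumes f: "f \<in> sparse_class w"
    and w: "\<And>j. w j \<le> c * 2 ^ (CARD('n) * j) * \<rho> ^ j" and \<rho>: "0 \<le> \<rho>" "\<rho> < 1"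
  obtains G s where "G \<subseteq> dyadic_index J" 
    "\<And>k. k \<in> G \<Longrightarrow> s k = 1 \<or> s k = (-1::real)"
    "\<And>k. k \<in> G \<Longrightarrow> AE x in cube_lebesgue. x \<in> dyadic_cell J k \<longrightarrow> f x = s k"
    "measure cube_lebesgue {x \<in> unit_cube. dyadic_pos J x \<notin> G} \<le> c * \<rho> ^ Suc J / (1 - \<rho>)"
proof -
  interpret prob_space "cube_lebesgue :: (real ^ 'n) measure" by (rule prob_space_cube_lebesgue)
  from f obtain a where f': "f \<in> prediction_rules" and E: "dyadic_expansion f a" and W: "writing_convention f a"
    and card: "\<And>j. real (card {k \<in> dyadic_index j. a j k \<noteq> 0}) \<le> w j"
    by (auto simp: sparse_class_def)
  note AE = expansion_AE[OF f' E W]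
  define Q where "Q k j \<longleftrightarrow> j \<le> J \<and> a j (dyadic_ancestor j J k) \<noteq> 0" for k j
  define G where "G = {k \<in> dyadic_index J. \<exists>j. Q k j}"
  \<comment> \<open>The choice of \<open>j\<close> does not matter: two nonzero ancestors would be
    nested, against the convention.\<close>
  define s where "s k = (let j = SOME j. Q k j in a j (dyadic_ancestor j J k))" for k
  have Q: "Q k (SOME j. Q k j)" if "k \<in> G" for k using that by (auto simp: G_def intro: someI)
  show ?thesis
  proof (rule that)
    show "G \<subseteq> dyadic_index J" by (auto simp: G_def)
  next
    fix k assume k: "k \<in> G"
    define j where "j = (SOME j. Q k j)"
    have j: "j \<le> J" "a j (dyadic_ancestor j J k) \<noteq> 0" using Q[OF k] by (auto simp: Q_def j_def)
    have s: "s k = a j (dyadic_ancestor j J k)" by (simp add: s_def j_def Let_def)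
    have kJ: "k \<in> dyadic_index J" using k by (simp add: G_def)
    have "dyadic_ancestor j J k \<in> dyadic_index j" using kJ j by (intro dyadic_ancestor_in_index)
    then have "a j (dyadic_ancestor j J k) \<in> {-1, 0, 1}" using E by (auto simp: dyadic_expansion_def)
    then show "s k = 1 \<or> s k = -1" using j s by auto
    show "AE x in cube_lebesgue. x \<in> dyadic_cell J k \<longrightarrow> f x = s k"
      using AE AE_space
    proof eventually_elim
      case (elim x)
      then have x: "x \<in> unit_cube" by simp
      show ?case
      proof
        assume "x \<in> dyadic_cell J k"
        then have anc: "dyadic_ancestor j J k = dyadic_pos j x"
          using kJ x j(1) dyadic_ancestor_pos[OF x j(1)] mem_dyadic_cell_iff[OF kJ, of x] by simp
        obtain i where i: "a i (dyadic_pos i x) \<noteq> 0" "f x = a i (dyadic_pos i x)"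
          using elim(1) by blast
        have "i = j" using expansion_pos_unique[OF W x i(1), of j] j(2) anc by simp
        then show "f x = s k" using i(2) s anc by simp
      qed
    qed
  next
    define T where "T j = (\<Union>k\<in>{k \<in> dyadic_index j. a j k \<noteq> 0}. dyadic_cell j k)" for j
    have T[measurable]: "T j \<in> sets cube_lebesgue" for j
      unfolding T_def by (intro sets.finite_UN) auto
    have mT: "measure cube_lebesgue (T j) \<le> c * \<rho> ^ j" for j
    proof -
      have "measure cube_lebesgue (T j) \<le> (\<Sum>k\<in>{k \<in> dyadic_index j. a j k \<noteq> 0}. measure cube_lebesgue (dyadic_cell j k))"
        unfolding T_def by (intro finite_measure_subadditive_finite) auto
      also have "\<dots> = real (card {k \<in> dyadic_index j. a j k \<noteq> 0}) / 2 ^ (CARD('n) * j)"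
        by (simp add: measure_dyadic_cell)
      also have "\<dots> \<le> c * 2 ^ (CARD('n) * j) * \<rho> ^ j / 2 ^ (CARD('n) * j)"
        using card[of j] w[of j] by (intro divide_right_mono) auto
      finally show ?thesis by simp
    qed
    have sm: "(\<lambda>i. c * \<rho> ^ Suc J * \<rho> ^ i) sums (c * \<rho> ^ Suc J * (1 / (1 - \<rho>)))"
      using \<rho> by (intro sums_mult geometric_sums) simp
    have mT': "measure cube_lebesgue (T (Suc J + i)) \<le> c * \<rho> ^ Suc J * \<rho> ^ i" for i
      using mT[of "Suc J + i"] by (simp only: power_add mult.assoc)
    have sT: "summable (\<lambda>i. measure cube_lebesgue (T (Suc J + i)))"
      using sums_summable[OF sm] by (rule summable_comparison_test') (use mT' in auto)
    have "AE x in cube_lebesgue. x \<in> {x \<in> unit_cube. dyadic_pos J x \<notin> G} \<longrightarrow> x \<in> (\<Union>i. T (Suc J + i))"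
      using AE AE_space
    proof eventually_elim
      case (elim x)
      then have x: "x \<in> unit_cube" by simp
      show ?case
      proof
        assume "x \<in> {x \<in> unit_cube. dyadic_pos J x \<notin> G}"
        then have nG: "dyadic_pos J x \<notin> G" by simp
        obtain j where j: "a j (dyadic_pos j x) \<noteq> 0" using elim(1) by blast
        have "\<not> j \<le> J"
        proof
          assume "j \<le> J"
          then have "Q (dyadic_pos J x) j" using j x by (simp add: Q_def dyadic_ancestor_pos)
          then show False using nG by (auto simp only: G_def dyadic_pos_in_index)
        qed
        then obtain i where i: "j = Suc J + i" using less_iff_Suc_add[of J j] by auto
        have "x \<in> T j" using j x by (auto simp: T_def mem_dyadic_cell_iff)
        then show "x \<in> (\<Union>i. T (Suc J + i))" using i by auto
      qed
    qed
    then have "measure cube_lebesgue {x \<in> unit_cube. dyadic_pos J x \<notin> G} \<le> measure cube_lebesgue (\<Union>i. T (Suc J + i))"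
      by (rule finite_measure_mono_AE) auto
    also have "\<dots> \<le> (\<Sum>i. measure cube_lebesgue (T (Suc J + i)))"
      by (intro finite_measure_subadditive_countably sT) auto
    also have "\<dots> \<le> (\<Sum>i. c * \<rho> ^ Suc J * \<rho> ^ i)"
      by (intro suminf_le mT' sT sums_summable[OF sm])
    also have "\<dots> = c * \<rho> ^ Suc J / (1 - \<rho>)" using sums_unique[OF sm] by simp
    finally show "measure cube_lebesgue {x \<in> unit_cube. dyadic_pos J x \<notin> G} \<le> c * \<rho> ^ Suc J / (1 - \<rho>)" .
  qed
qed

section \<open>Laws in the model\<close>

lemma model_prob_space: "\<pi> \<in> model w h a A \<Longrightarrow> prob_space \<pi>"
  by (simp add: model_def)

lemma measurable_fst_obs:
  assumes "sets \<pi> = sets observation_space"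
  shows "fst \<in> \<pi> \<rightarrow>\<^sub>M cube_lebesgue"
  unfolding measurable_cong_sets[OF assms refl] observation_space_def by simp

lemma measurable_snd_obs:
  assumes "sets \<pi> = sets observation_space"
  shows "snd \<in> \<pi> \<rightarrow>\<^sub>M label_space"
  unfolding measurable_cong_sets[OF assms refl] observation_space_def by simp

lemma space_obs:
  assumes "sets \<pi> = sets observation_space"
  shows "space \<pi> = unit_cube \<times> {-1, 1}"
  using sets_eq_imp_space_eq[OF assms] by (simp add: observation_space_def space_pair_measure)

lemma sets_cylinder_obs:
  assumes "sets \<pi> = sets observation_space" "S \<in> sets cube_lebesgue"
  shows "{z \<in> space \<pi>. fst z \<in> S} \<in> sets \<pi>" "{z \<in> space \<pi>. fst z \<in> S \<and> snd z = y} \<in> sets \<pi>"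
proof -
  have f: "fst -` S \<inter> space \<pi> \<in> sets \<pi>"
    by (rule measurable_sets[OF measurable_fst_obs[OF assms(1)] assms(2)])
  have s: "snd -` ({y} \<inter> {-1, 1}) \<inter> space \<pi> \<in> sets \<pi>"
    by (rule measurable_sets[OF measurable_snd_obs[OF assms(1)]]) simp
  show "{z \<in> space \<pi>. fst z \<in> S} \<in> sets \<pi>"
    using f by (simp add: vimage_def Int_def conj_commute)
  have "{z \<in> space \<pi>. fst z \<in> S \<and> snd z = y}
      = (fst -` S \<inter> space \<pi>) \<inter> (snd -` ({y} \<inter> {-1, 1}) \<inter> space \<pi>)"
    by (auto simp: space_obs[OF assms(1)])
  then show "{z \<in> space \<pi>. fst z \<in> S \<and> snd z = y} \<in> sets \<pi>" using f s by simp
qed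

lemma marginal_bounds:
  assumes \<pi>: "\<pi> \<in> model w h a A" and S: "S \<in> sets cube_lebesgue" and a: "0 \<le> a" "0 \<le> A"
  shows "a * measure cube_lebesgue S \<le> measure \<pi> {z \<in> space \<pi>. fst z \<in> S}"
    and "measure \<pi> {z \<in> space \<pi>. fst z \<in> S} \<le> A * measure cube_lebesgue S"
proof -
  interpret L: prob_space "cube_lebesgue :: (real ^ 'a) measure" by (rule prob_space_cube_lebesgue)
  interpret prob_space \<pi> by (rule model_prob_space[OF \<pi>])
  from \<pi> obtain g where g: "g \<in> borel_measurable cube_lebesgue"
    and m: "marginal \<pi> = density cube_lebesgue (\<lambda>x. ennreal (g x))"
    and b: "\<And>x. x \<in> unit_cube \<Longrightarrow> a \<le> g x \<and> g x \<le> A" and sets: "sets \<pi> = sets observation_space"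
    by (auto simp: model_def)
  have "emeasure \<pi> {z \<in> space \<pi>. fst z \<in> S} = emeasure (marginal \<pi>) S"
    unfolding marginal_def
    by (subst emeasure_distr[OF measurable_fst_obs[OF sets] S]) (simp add: vimage_def Int_def conj_commute)
  also have "\<dots> = (\<integral>\<^sup>+x. ennreal (g x) * indicator S x \<partial>cube_lebesgue)"
    unfolding m using g S by (subst emeasure_density) auto
  finally have e: "ennreal (measure \<pi> {z \<in> space \<pi>. fst z \<in> S}) = (\<integral>\<^sup>+x. ennreal (g x) * indicator S x \<partial>cube_lebesgue)"
    by (simp add: emeasure_eq_measure)
  have cI: "(\<integral>\<^sup>+x. ennreal c * indicator S x \<partial>cube_lebesgue) = ennreal (c * measure cube_lebesgue S)" if "0 \<le> c" for c
    using S that by (subst nn_integral_cmult_indicator) (auto simp: L.emeasure_eq_measure ennreal_mult')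
  have "ennreal (a * measure cube_lebesgue S) \<le> ennreal (measure \<pi> {z \<in> space \<pi>. fst z \<in> S})"
    unfolding e cI[OF a(1), symmetric]
    by (intro nn_integral_mono mult_right_mono ennreal_leI) (use b in auto)
  then show "a * measure cube_lebesgue S \<le> measure \<pi> {z \<in> space \<pi>. fst z \<in> S}" by simp
  have "ennreal (measure \<pi> {z \<in> space \<pi>. fst z \<in> S}) \<le> ennreal (A * measure cube_lebesgue S)"
    unfolding e cI[OF a(2), symmetric]
    by (intro nn_integral_mono mult_right_mono ennreal_leI) (use b in auto)
  then show "measure \<pi> {z \<in> space \<pi>. fst z \<in> S} \<le> A * measure cube_lebesgue S"
    using a by (simp add: ennreal_le_iff)
qed

text \<open>Absolute continuity of the design carries null sets of the cube to null sets of the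
  law.\<close>

lemma model_AE:
  assumes \<pi>: "\<pi> \<in> model w h a A" and P: "AE x in cube_lebesgue. P x"
  shows "AE x in marginal \<pi>. P x" "AE z in \<pi>. P (fst z)"
proof -
  from \<pi> obtain g where g: "g \<in> borel_measurable cube_lebesgue"
    and m: "marginal \<pi> = density cube_lebesgue (\<lambda>x. ennreal (g x))"
    and sets: "sets \<pi> = sets observation_space"
    by (auto simp: model_def)
  have "(\<lambda>x. ennreal (g x)) \<in> borel_measurable cube_lebesgue" using g by simp
  then show 1: "AE x in marginal \<pi>. P x" unfolding m using P by (subst AE_density) (auto elim!: eventually_mono)
  show "AE z in \<pi>. P (fst z)"
    using AE_distrD[OF measurable_fst_obs[OF sets] 1[unfolded marginal_def]] .
qed

context
  fixes \<pi> :: "((real ^ 'n) \<times> real) measure"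
  assumes prob: "prob_space \<pi>" and sets: "sets \<pi> = sets observation_space"
begin

interpretation prob_space \<pi> by (rule prob)

private abbreviation "N \<equiv> distr (density \<pi> (indicator (UNIV \<times> {1}))) cube_lebesgue fst"

lemma label_indicator_measurable: "(indicator (UNIV \<times> {1}) :: _ \<Rightarrow> ennreal) \<in> borel_measurable \<pi>"
proof -
  have "{z \<in> space \<pi>. z \<in> UNIV \<times> {1}} = {z \<in> space \<pi>. fst z \<in> unit_cube \<and> snd z = 1}"
    by (auto simp: space_obs[OF sets])
  also have "\<dots> \<in> sets \<pi>" by (rule sets_cylinder_obs[OF sets]) (simp add: sets_cube_lebesgue)
  finally show ?thesis
    by (subst borel_measurable_indicator_iff) (simp add: Int_def conj_commute)
qed

lemma emeasure_positive_part:
  assumes S: "S \<in> sets cube_lebesgue"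
  shows "emeasure N S = emeasure \<pi> {z \<in> space \<pi>. fst z \<in> S \<and> snd z = 1}"
proof -
  have f: "fst -` S \<inter> space \<pi> \<in> sets \<pi>"
    by (rule measurable_sets[OF measurable_fst_obs[OF sets] S])
  have "emeasure N S = emeasure (density \<pi> (indicator (UNIV \<times> {1}))) (fst -` S \<inter> space \<pi>)"
    using measurable_fst_obs[OF sets] by (subst emeasure_distr[OF _ S]) auto
  also have "\<dots> = (\<integral>\<^sup>+z. indicator (UNIV \<times> {1}) z * indicator (fst -` S \<inter> space \<pi>) z \<partial>\<pi>)"
    by (rule emeasure_density[OF label_indicator_measurable f])
  also have "\<dots> = (\<integral>\<^sup>+z. indicator {z \<in> space \<pi>. fst z \<in> S \<and> snd z = 1} z \<partial>\<pi>)"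
    by (intro nn_integral_cong) (auto simp: indicator_def)
  also have "\<dots> = emeasure \<pi> {z \<in> space \<pi>. fst z \<in> S \<and> snd z = 1}"
    using sets_cylinder_obs(2)[OF sets S] by simp
  finally show ?thesis .
qed

lemma emeasure_marginal:
  assumes S: "S \<in> sets cube_lebesgue"
  shows "emeasure (marginal \<pi>) S = emeasure \<pi> {z \<in> space \<pi>. fst z \<in> S}"
  unfolding marginal_def
  by (subst emeasure_distr[OF measurable_fst_obs[OF sets] S]) (simp add: vimage_def Int_def conj_commute)

lemma sets_marginal: "sets (marginal \<pi>) = sets cube_lebesgue" by (simp add: marginal_def)

lemma prob_space_marginal: "prob_space (marginal \<pi>)"
  unfolding marginal_def by (rule prob_space_distr[OF measurable_fst_obs[OF sets]])

lemma regression_measurable [measurable]: "regression \<pi> \<in> borel_measurable cube_lebesgue"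
proof -
  have "RN_deriv (marginal \<pi>) N \<in> borel_measurable cube_lebesgue"
    using borel_measurable_RN_deriv[of "marginal \<pi>" N] by (simp cong: measurable_cong_sets add: sets_marginal)
  then show ?thesis unfolding regression_def by simp
qed

text \<open>Keeping only the label 1 lowers mass, so the positive part of the law is absolutely
  continuous with respect to the marginal. It is finite, hence its derivative is a.e. finite and
  \<open>enn2real\<close> loses nothing.\<close>

lemma emeasure_positive_regression:
  assumes S: "S \<in> sets cube_lebesgue"
  shows "emeasure \<pi> {z \<in> space \<pi>. fst z \<in> S \<and> snd z = 1}
       = (\<integral>\<^sup>+x. ennreal (regression \<pi> x) * indicator S x \<partial>marginal \<pi>)"
proof -
  interpret M: prob_space "marginal \<pi>" by (rule prob_space_marginal)
  have ac: "absolutely_continuous (marginal \<pi>) N"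
    unfolding absolutely_continuous_def
  proof
    fix T assume T: "T \<in> null_sets (marginal \<pi>)"
    then have T': "T \<in> sets cube_lebesgue" by (auto simp: null_sets_def sets_marginal)
    have "emeasure N T \<le> emeasure \<pi> {z \<in> space \<pi>. fst z \<in> T}"
      unfolding emeasure_positive_part[OF T'] by (rule emeasure_mono) (use sets_cylinder_obs[OF sets T'] in auto)
    also have "\<dots> = 0" using T emeasure_marginal[OF T'] by auto
    finally show "T \<in> null_sets N" using T' by auto
  qed
  have sN: "sets N = sets (marginal \<pi>)" by (simp add: sets_marginal)
  have fin: "finite_measure N"
    by (rule finite_measureI) (simp add: emeasure_positive_part[of unit_cube] sets_cube_lebesgue)
  have "AE x in marginal \<pi>. RN_deriv (marginal \<pi>) N x \<noteq> \<infinity>"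
    by (rule M.RN_deriv_finite[OF finite_measure.sigma_finite_measure[OF fin] ac sN])
  then have eq: "AE x in marginal \<pi>. RN_deriv (marginal \<pi>) N x = ennreal (regression \<pi> x)"
    unfolding regression_def by eventually_elim (simp add: top.not_eq_extremum)
  have "emeasure N S = emeasure (density (marginal \<pi>) (RN_deriv (marginal \<pi>) N)) S"
    using M.density_RN_deriv[OF ac sN] by simp
  also have "\<dots> = (\<integral>\<^sup>+x. RN_deriv (marginal \<pi>) N x * indicator S x \<partial>marginal \<pi>)"
    using S by (subst emeasure_density) (auto simp: sets_marginal)
  also have "\<dots> = (\<integral>\<^sup>+x. ennreal (regression \<pi> x) * indicator S x \<partial>marginal \<pi>)"
    by (rule nn_integral_cong_AE) (use eq in \<open>auto elim: eventually_mono\<close>)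
  finally show ?thesis by (simp add: emeasure_positive_part[OF S])
qed

end

text \<open>Turns the margin condition into a bias of the votes in \<open>S\<close>. Where the Bayes
  rule is 1 the regression function is at least (1 + h) / 2, where it is -1 at most (1 - h) / 2;
  integrate over \<open>S\<close>, and in the second case pass to the complementary label.\<close>

lemma bayes_label_probability:
  assumes \<pi>: "\<pi> \<in> model w h a A" and h: "0 < h" "h < 1" and S: "S \<in> sets cube_lebesgue"
    and s: "s = 1 \<or> s = -1" and AE: "AE x in cube_lebesgue. x \<in> S \<longrightarrow> bayes_rule \<pi> x = s"
  shows "(1 + h) / 2 * measure \<pi> {z \<in> space \<pi>. fst z \<in> S}
    \<le> measure \<pi> {z \<in> space \<pi>. fst z \<in> S \<and> snd z = s}"
proof -
  have prob: "prob_space \<pi>" and sets: "sets \<pi> = sets observation_space"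
    and margin: "AE z in \<pi>. h \<le> \<bar>2 * regression \<pi> (fst z) - 1\<bar>"
    using \<pi> by (auto simp: model_def)
  interpret prob_space \<pi> by fact
  interpret M: prob_space "marginal \<pi>" by (rule prob_space_marginal[OF prob sets])
  note m = regression_measurable[OF prob sets]
  have S': "S \<in> sets (marginal \<pi>)" using S by (simp add: sets_marginal[OF prob sets])
  have margin': "AE x in marginal \<pi>. h \<le> \<bar>2 * regression \<pi> x - 1\<bar>"
    unfolding marginal_def
  proof (subst AE_distr_iff[OF measurable_fst_obs[OF sets]])
    note m[measurable]
    show "{x \<in> space cube_lebesgue. h \<le> \<bar>2 * regression \<pi> x - 1\<bar>} \<in> sets cube_lebesgue"
      by measurable
  qed (rule margin)
  define p where "p = measure \<pi> {z \<in> space \<pi>. fst z \<in> S}"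
  define q where "q = measure \<pi> {z \<in> space \<pi>. fst z \<in> S \<and> snd z = 1}"
  have q: "ennreal q = (\<integral>\<^sup>+x. ennreal (regression \<pi> x) * indicator S x \<partial>marginal \<pi>)"
    unfolding q_def using emeasure_positive_regression[OF prob sets S] by (simp add: emeasure_eq_measure)
  have p: "(\<integral>\<^sup>+x. ennreal c * indicator S x \<partial>marginal \<pi>) = ennreal (c * p)" if "0 \<le> c" for c
    using S' that emeasure_marginal[OF prob sets S]
    by (subst nn_integral_cmult_indicator) (auto simp: emeasure_eq_measure p_def ennreal_mult')
  have p0: "0 \<le> p" by (simp add: p_def)
  show ?thesis
  proof (cases "s = 1")
    case True
    have "ennreal ((1 + h) / 2 * p) = (\<integral>\<^sup>+x. ennreal ((1 + h) / 2) * indicator S x \<partial>marginal \<pi>)"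
      using h by (subst p) auto
    also have "\<dots> \<le> ennreal q" unfolding q
    proof (rule nn_integral_mono_AE)
      show "AE x in marginal \<pi>. ennreal ((1 + h) / 2) * indicator S x \<le> ennreal (regression \<pi> x) * indicator S x"
        using margin' model_AE(1)[OF \<pi> AE]
      proof eventually_elim
        case (elim x)
        have "(1 + h) / 2 \<le> regression \<pi> x" if "x \<in> S"
          using elim that True by (auto simp: bayes_rule_def split: if_splits)
        then show ?case by (cases "x \<in> S") (auto intro: ennreal_leI)
      qed
    qed
    finally have "(1 + h) / 2 * p \<le> q" by (simp add: q_def)
    then show ?thesis by (simp add: p_def q_def True)
  next
    case False
    then have s: "s = -1" using s by simp
    have "ennreal q \<le> (\<integral>\<^sup>+x. ennreal ((1 - h) / 2) * indicator S x \<partial>marginal \<pi>)" unfolding q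
    proof (rule nn_integral_mono_AE)
      show "AE x in marginal \<pi>. ennreal (regression \<pi> x) * indicator S x \<le> ennreal ((1 - h) / 2) * indicator S x"
        using margin' model_AE(1)[OF \<pi> AE]
      proof eventually_elim
        case (elim x)
        have "regression \<pi> x \<le> (1 - h) / 2" if "x \<in> S"
          using elim that s by (auto simp: bayes_rule_def split: if_splits)
        then show ?case by (cases "x \<in> S") (auto intro: ennreal_leI)
      qed
    qed
    also have "\<dots> = ennreal ((1 - h) / 2 * p)" using h by (subst p) auto
    finally have "q \<le> (1 - h) / 2 * p" using h p0 by (simp add: ennreal_le_iff)
    moreover have "measure \<pi> {z \<in> space \<pi>. fst z \<in> S \<and> snd z = -1} = p - q"
    proof -
      have "{z \<in> space \<pi>. fst z \<in> S \<and> snd z = -1}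
        = {z \<in> space \<pi>. fst z \<in> S} - {z \<in> space \<pi>. fst z \<in> S \<and> snd z = 1}"
        by (auto simp: space_obs[OF sets])
      then show ?thesis unfolding p_def q_def
        using sets_cylinder_obs[OF sets S]
        by (simp only:) (rule finite_measure_Diff, auto)
    qed
    ultimately show ?thesis by (simp add: p_def[symmetric] s field_simps)
  qed
qed

section \<open>Excess risk of the majority vote\<close>

text \<open>
  The product of the weights over the sample is the exponential moment in the Chernoff bound; at
  \<open>t = 1 + h\<close> a single weight has mean at most \<open>1 - p h\<^sup>2 / 2\<close>.
\<close>

definition vote_weight :: "real \<Rightarrow> 'a set \<Rightarrow> real \<Rightarrow> 'a \<times> real \<Rightarrow> real" where
  "vote_weight t S s z = (if fst z \<in> S then if snd z = s then 1 / t else t else 1)"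

text \<open>The product is \<open>t\<close> to the power of wrong votes minus right votes in
  \<open>S\<close>.\<close>

lemma prod_vote_weight_ge_1:
  fixes n :: nat
  assumes t: "1 \<le> t"
    and le: "card {i. i < n \<and> fst (D i) \<in> S \<and> snd (D i) = s} \<le> card {i. i < n \<and> fst (D i) \<in> S \<and> snd (D i) \<noteq> s}"
  shows "1 \<le> (\<Prod>i<n. vote_weight t S s (D i))"
proof -
  let ?P = "{i. i < n \<and> fst (D i) \<in> S \<and> snd (D i) = s}"
  let ?N = "{i. i < n \<and> fst (D i) \<in> S \<and> snd (D i) \<noteq> s}"
  have pr: "(\<Prod>i<n. if Q i then c else 1) = c ^ card {i. i < n \<and> Q i}" for Q and c :: real
  proof -
    have "(\<Prod>i<n. if Q i then c else 1) = (\<Prod>i\<in>{i\<in>{..<n}. Q i}. c)"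
      by (rule prod.inter_filter[symmetric]) simp
    then show ?thesis by simp
  qed
  have "(\<Prod>i<n. vote_weight t S s (D i))
      = (\<Prod>i<n. (if fst (D i) \<in> S \<and> snd (D i) = s then 1 / t else 1) * (if fst (D i) \<in> S \<and> snd (D i) \<noteq> s then t else 1))"
    by (rule prod.cong) (auto simp: vote_weight_def)
  also have "\<dots> = (1 / t) ^ card ?P * t ^ card ?N"
    by (simp add: prod.distrib pr)
  finally have *: "(\<Prod>i<n. vote_weight t S s (D i)) = t ^ card ?N / t ^ card ?P"
    by (simp add: power_one_over)
  have "t ^ card ?P \<le> t ^ card ?N" using t le by (rule power_increasing[rotated])
  then show ?thesis using t unfolding * by (simp add: le_divide_eq)
qed

lemma integral_vote_weight:
  assumes \<pi>: "\<pi> \<in> model w h a A" and h: "0 < h" "h < 1" and S: "S \<in> sets cube_lebesgue"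
    and s: "s = 1 \<or> s = -1" and AE: "AE x in cube_lebesgue. x \<in> S \<longrightarrow> bayes_rule \<pi> x = s"
  shows "integrable \<pi> (vote_weight (1 + h) S s)"
    and "(\<integral>z. vote_weight (1 + h) S s z \<partial>\<pi>) \<le> 1 - measure \<pi> {z \<in> space \<pi>. fst z \<in> S} * (h\<^sup>2 / 2)"
proof -
  have sets: "sets \<pi> = sets observation_space" using \<pi> by (simp add: model_def)
  interpret prob_space \<pi> by (rule model_prob_space[OF \<pi>])
  define U V where "U = {z \<in> space \<pi>. fst z \<in> S}" and "V = {z \<in> space \<pi>. fst z \<in> S \<and> snd z = s}"
  have [measurable]: "U \<in> sets \<pi>" "V \<in> sets \<pi>"
    unfolding U_def V_def by (intro sets_cylinder_obs[OF sets S])+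
  define g where "g z = 1 + h * indicator U z + (1 / (1 + h) - (1 + h)) * indicator V z" for z
  have g: "vote_weight (1 + h) S s z = g z" if "z \<in> space \<pi>" for z
    using that by (auto simp: vote_weight_def g_def U_def V_def)
  have iUV: "integrable \<pi> (indicator U :: _ \<Rightarrow> real)" "integrable \<pi> (indicator V :: _ \<Rightarrow> real)"
    by (simp_all add: less_top[symmetric])
  then have "integrable \<pi> g" unfolding g_def by simp
  then show "integrable \<pi> (vote_weight (1 + h) S s)"
    by (subst Bochner_Integration.integrable_cong[OF refl g]) auto
  define p q where "p = measure \<pi> U" and "q = measure \<pi> V"
  have "(\<integral>z. vote_weight (1 + h) S s z \<partial>\<pi>) = (\<integral>z. g z \<partial>\<pi>)"
    by (rule Bochner_Integration.integral_cong) (simp_all add: g)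
  also have "\<dots> = 1 + h * p + (1 / (1 + h) - (1 + h)) * q"
    unfolding g_def p_def q_def using iUV by (simp add: prob_space)
  \<comment> \<open>The factor 1 / (1 + h) - (1 + h) is negative, so a lower bound on
    \<open>q\<close> suffices. The choice t = 1 + h cancels against the factor 1 + h of that lower
    bound and leaves 1 - (1 + h)^2.\<close>
  also have "\<dots> \<le> 1 + h * p + (1 / (1 + h) - (1 + h)) * ((1 + h) / 2 * p)"
  proof -
    have "(1 + h) / 2 * p \<le> q" unfolding p_def q_def U_def V_def
      by (rule bayes_label_probability[OF \<pi> h S s AE])
    moreover have "1 / (1 + h) - (1 + h) \<le> 0" using h by (simp add: divide_le_eq) (simp add: algebra_simps)
    ultimately show ?thesis by (intro add_left_mono mult_left_mono_neg)
  qed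
  also have "\<dots> = 1 - p * (h\<^sup>2 / 2)"
  proof -
    have "(1 / (1 + h) - (1 + h)) * ((1 + h) / 2 * p) = (1 - (1 + h)\<^sup>2) / 2 * p"
      using h by (simp add: field_simps power2_eq_square)
    then show ?thesis by (simp add: field_simps power2_eq_square)
  qed
  finally show "(\<integral>z. vote_weight (1 + h) S s z \<partial>\<pi>) \<le> 1 - measure \<pi> {z \<in> space \<pi>. fst z \<in> S} * (h\<^sup>2 / 2)"
    by (simp add: p_def U_def)
qed

text \<open>Independence makes the mean of the product the n-th power of one mean; then 1 - y \<le>
  exp (- y).\<close>

lemma integral_prod_vote_weight:
  fixes n :: nat
  assumes \<pi>: "\<pi> \<in> model w h a A" and h: "0 < h" "h < 1" and S: "S \<in> sets cube_lebesgue"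
    and s: "s = 1 \<or> s = -1" and AE: "AE x in cube_lebesgue. x \<in> S \<longrightarrow> bayes_rule \<pi> x = s"
  shows "integrable (\<Pi>\<^sub>M i\<in>{..<n}. \<pi>) (\<lambda>D. \<Prod>i<n. vote_weight (1 + h) S s (D i))"
    and "(\<integral>D. (\<Prod>i<n. vote_weight (1 + h) S s (D i)) \<partial>(\<Pi>\<^sub>M i\<in>{..<n}. \<pi>))
       \<le> exp (- (real n * measure \<pi> {z \<in> space \<pi>. fst z \<in> S} * (h\<^sup>2 / 2)))"
proof -
  interpret prob_space \<pi> by (rule model_prob_space[OF \<pi>])
  interpret P: product_sigma_finite "\<lambda>i :: nat. \<pi>" by standard
  note v = integral_vote_weight[OF assms]
  show "integrable (\<Pi>\<^sub>M i\<in>{..<n}. \<pi>) (\<lambda>D. \<Prod>i<n. vote_weight (1 + h) S s (D i))"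
    by (rule P.product_integrable_prod) (use v in auto)
  have "(\<integral>D. (\<Prod>i<n. vote_weight (1 + h) S s (D i)) \<partial>(\<Pi>\<^sub>M i\<in>{..<n}. \<pi>))
      = (\<Prod>i<n. \<integral>z. vote_weight (1 + h) S s z \<partial>\<pi>)"
    by (rule P.product_integral_prod) (use v in auto)
  also have "\<dots> = (\<integral>z. vote_weight (1 + h) S s z \<partial>\<pi>) ^ n" by simp
  also have "\<dots> \<le> exp (- (measure \<pi> {z \<in> space \<pi>. fst z \<in> S} * (h\<^sup>2 / 2))) ^ n"
  proof (rule power_mono)
    show "(\<integral>z. vote_weight (1 + h) S s z \<partial>\<pi>) \<le> exp (- (measure \<pi> {z \<in> space \<pi>. fst z \<in> S} * (h\<^sup>2 / 2)))"
      using v(2) exp_ge_add_one_self[of "- (measure \<pi> {z \<in> space \<pi>. fst z \<in> S} * (h\<^sup>2 / 2))"] by linarith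
    show "0 \<le> (\<integral>z. vote_weight (1 + h) S s z \<partial>\<pi>)"
      using h by (intro Bochner_Integration.integral_nonneg) (auto simp: vote_weight_def)
  qed
  also have "\<dots> = exp (- (real n * measure \<pi> {z \<in> space \<pi>. fst z \<in> S} * (h\<^sup>2 / 2)))"
    by (simp add: exp_of_nat_mult[symmetric])
  finally show "(\<integral>D. (\<Prod>i<n. vote_weight (1 + h) S s (D i)) \<partial>(\<Pi>\<^sub>M i\<in>{..<n}. \<pi>))
       \<le> exp (- (real n * measure \<pi> {z \<in> space \<pi>. fst z \<in> S} * (h\<^sup>2 / 2)))" .
qed

text \<open>A wrong vote requires at least as many wrong labels as right ones in the cell. Ties,
  resolved as -1, and empty cells, where the product is 1, are covered by the weak inequality
  between the counts.\<close>

lemma majority_error_le_prod_vote_weight: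
  assumes D: "\<And>i. i < n \<Longrightarrow> snd (D i) = 1 \<or> snd (D i) = -1" and t: "1 \<le> t"
    and s: "s = 1 \<or> s = -1"
  shows "(if majority_coeff n J D k \<noteq> s then 1 else 0) \<le> (\<Prod>i<n. vote_weight t (dyadic_cell J k) s (D i))"
proof (cases "majority_coeff n J D k = s")
  case True
  then show ?thesis using t by (auto intro!: prod_nonneg simp: vote_weight_def)
next
  case False
  have 1: "{i. i < n \<and> fst (D i) \<in> dyadic_cell J k \<and> snd (D i) \<noteq> 1}
      = {i. i < n \<and> fst (D i) \<in> dyadic_cell J k \<and> snd (D i) = -1}"
    and 2: "{i. i < n \<and> fst (D i) \<in> dyadic_cell J k \<and> snd (D i) \<noteq> -1}
      = {i. i < n \<and> fst (D i) \<in> dyadic_cell J k \<and> snd (D i) = 1}"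
    using D by force+
  have "card {i. i < n \<and> fst (D i) \<in> dyadic_cell J k \<and> snd (D i) = s}
      \<le> card {i. i < n \<and> fst (D i) \<in> dyadic_cell J k \<and> snd (D i) \<noteq> s}"
  proof (cases "\<exists>i<n. fst (D i) \<in> dyadic_cell J k")
    case True
    then show ?thesis
      using False s 1 2 by (auto simp: majority_coeff_def not_less split: if_splits)
  next
    case none: False
    then have "{i. i < n \<and> fst (D i) \<in> dyadic_cell J k \<and> snd (D i) = s} = {}" by auto
    then show ?thesis by (simp only: card.empty)
  qed
  then have "1 \<le> (\<Prod>i<n. vote_weight t (dyadic_cell J k) s (D i))"
    by (rule prod_vote_weight_ge_1[OF t])
  then show ?thesis using False by simp
qed

text \<open>For a fixed sample the estimator errs only where the Bayes rule errs, on a cell of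
  \<open>G\<close> with a wrong vote, or outside \<open>G\<close>. A wrong vote is charged at the
  full mass of its cell.\<close>

lemma estimator_risk_le:
  fixes \<pi> :: "((real ^ 'n::finite) \<times> real) measure"
  assumes \<pi>: "\<pi> \<in> model w h a A" and G: "G \<subseteq> dyadic_index J"
    and bayes: "\<And>k. k \<in> G \<Longrightarrow> AE x in cube_lebesgue. x \<in> dyadic_cell J k \<longrightarrow> bayes_rule \<pi> x = s k"
  shows "risk \<pi> (dyadic_estimator n J D) - bayes_risk \<pi> \<le>
    (\<Sum>k\<in>G. measure \<pi> {z \<in> space \<pi>. fst z \<in> dyadic_cell J k} * (if majority_coeff n J D k \<noteq> s k then 1 else 0))
    + measure \<pi> {z \<in> space \<pi>. fst z \<in> {x \<in> unit_cube. dyadic_pos J x \<notin> G}}"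
proof -
  have sets: "sets \<pi> = sets observation_space" and b: "bayes_rule \<pi> \<in> prediction_rules"
    using \<pi> by (auto simp: model_def sparse_class_def)
  interpret prob_space \<pi> by (rule model_prob_space[OF \<pi>])
  have finG: "finite G" using G finite_dyadic_index finite_subset by blast
  define B where "B = {x \<in> unit_cube. dyadic_pos J x \<notin> G}"
  define H where "H = {k \<in> G. majority_coeff n J D k \<noteq> s k}"
  define C where "C k = {z \<in> space \<pi>. fst z \<in> dyadic_cell J k}" for k
  have C[measurable]: "C k \<in> sets \<pi>" if "k \<in> H" for k
    unfolding C_def using that G by (intro sets_cylinder_obs[OF sets]) (auto simp: H_def)
  have "B = unit_cube - (\<Union>k\<in>G. dyadic_cell J k)"
    using G by (auto simp: B_def mem_dyadic_cell_iff)
  moreover have "(\<Union>k\<in>G. dyadic_cell J k) \<in> sets cube_lebesgue"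
    using G finG by (intro sets.finite_UN) auto
  ultimately have Bc: "B \<in> sets cube_lebesgue" by (simp add: sets_cube_lebesgue)
  have Bs: "{z \<in> space \<pi>. fst z \<in> B} \<in> sets \<pi>" by (rule sets_cylinder_obs[OF sets Bc])
  have R: "{z \<in> space \<pi>. bayes_rule \<pi> (fst z) \<noteq> snd z} \<in> sets \<pi>"
  proof -
    have [measurable]: "(\<lambda>z. bayes_rule \<pi> (fst z)) \<in> borel_measurable \<pi>" "(\<lambda>z. snd z) \<in> borel_measurable \<pi>"
      using measurable_compose[OF measurable_fst_obs[OF sets] b[unfolded prediction_rules_def]]
        measurable_snd_obs[OF sets] by (auto simp: label_space_measurable_iff)
    show ?thesis by measurable
  qed
  have UN: "(\<Union>k\<in>H. C k) \<in> sets \<pi>" using finG C by (intro sets.finite_UN) (auto simp: H_def)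
  have "AE z in \<pi>. \<forall>k\<in>G. fst z \<in> dyadic_cell J k \<longrightarrow> bayes_rule \<pi> (fst z) = s k"
    by (intro AE_finite_allI finG model_AE(2)[OF \<pi>] bayes)
  then have "AE z in \<pi>. z \<in> {z \<in> space \<pi>. dyadic_estimator n J D (fst z) \<noteq> snd z}
     \<longrightarrow> z \<in> {z \<in> space \<pi>. bayes_rule \<pi> (fst z) \<noteq> snd z} \<union> ((\<Union>k\<in>H. C k) \<union> {z \<in> space \<pi>. fst z \<in> B})"
    using AE_space
  proof eventually_elim
    case (elim z)
    then have x: "fst z \<in> unit_cube" by (auto simp: space_obs[OF sets])
    define k where "k = dyadic_pos J (fst z)"
    have e: "dyadic_estimator n J D (fst z) = majority_coeff n J D k"
      unfolding dyadic_estimator_def k_def by (rule sum_dyadic_index_indicator[OF x])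
    show ?case
    proof (cases "k \<in> G")
      case True
      then have "bayes_rule \<pi> (fst z) = s k"
        using elim(1) dyadic_cell_pos_mem[OF x] by (auto simp: k_def)
      then show ?thesis using elim(2) e True dyadic_cell_pos_mem[OF x, of J]
        by (auto simp: H_def C_def k_def)
    next
      case False
      then show ?thesis using x elim(2) by (auto simp: B_def k_def)
    qed
  qed
  then have "risk \<pi> (dyadic_estimator n J D)
    \<le> measure \<pi> ({z \<in> space \<pi>. bayes_rule \<pi> (fst z) \<noteq> snd z} \<union> ((\<Union>k\<in>H. C k) \<union> {z \<in> space \<pi>. fst z \<in> B}))"
    unfolding risk_def by (rule finite_measure_mono_AE) (use R UN Bs in auto)
  also have "\<dots> \<le> bayes_risk \<pi> + measure \<pi> ((\<Union>k\<in>H. C k) \<union> {z \<in> space \<pi>. fst z \<in> B})"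
    unfolding bayes_risk_def risk_def by (rule measure_Un_le) (use R UN Bs in auto)
  also have "measure \<pi> ((\<Union>k\<in>H. C k) \<union> {z \<in> space \<pi>. fst z \<in> B})
      \<le> measure \<pi> (\<Union>k\<in>H. C k) + measure \<pi> {z \<in> space \<pi>. fst z \<in> B}"
    by (rule measure_Un_le) (use UN Bs in auto)
  also have "measure \<pi> (\<Union>k\<in>H. C k) \<le> (\<Sum>k\<in>H. measure \<pi> (C k))"
    using finG by (intro finite_measure_subadditive_finite) (auto simp: H_def intro!: C)
  also have "\<dots> = (\<Sum>k\<in>G. measure \<pi> (C k) * (if majority_coeff n J D k \<noteq> s k then 1 else 0))"
    unfolding H_def using finG by (subst sum.inter_filter) (auto intro!: sum.cong)
  finally show ?thesis by (simp add: C_def B_def algebra_simps)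
qed

text \<open>Handles the sample sizes for which n / ln n is too small for the rank to be informative.
  The constant majorant is integrable, so \<open>F\<close> may be arbitrary.\<close>

lemma excess_risk_le_1:
  assumes \<pi>: "prob_space \<pi>"
  shows "excess_risk n \<pi> F \<le> 1"
proof -
  interpret prob_space \<pi> by fact
  interpret P: prob_space "\<Pi>\<^sub>M i\<in>{..<n}. \<pi>" by (intro prob_space_PiM prob_space_axioms)
  have "risk \<pi> f - bayes_risk \<pi> \<le> 1" for f
    unfolding risk_def bayes_risk_def
    using prob_le_1[of "{z \<in> space \<pi>. f (fst z) \<noteq> snd z}"] measure_nonneg[of \<pi> "{z \<in> space \<pi>. bayes_rule \<pi> (fst z) \<noteq> snd z}"]
    by linarith
  then have "excess_risk n \<pi> F \<le> (\<integral>D. 1 \<partial>(\<Pi>\<^sub>M i\<in>{..<n}. \<pi>))"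
    unfolding excess_risk_def by (intro integral_mono') auto
  then show ?thesis by (simp add: P.prob_space)
qed

text \<open>No factor 2^(d J) arises from summing over cells: wrong votes are weighted by the masses
  of disjoint cells, which add up to at most 1. The common lower bound a / 2^(d J) on these masses
  governs the exponential, and \<open>A\<close> converts the volume of the remainder into
  mass.\<close>

lemma estimator_excess_risk_le:
  fixes \<pi> :: "((real ^ 'n::finite) \<times> real) measure"
  assumes \<pi>: "\<pi> \<in> model w h a A" and h: "0 < h" "h < 1" and aA: "0 \<le> a" "0 \<le> A"
    and w: "\<And>j. w j \<le> c * 2 ^ (CARD('n) * j) * \<rho> ^ j" and \<rho>: "0 \<le> \<rho>" "\<rho> < 1"
  shows "excess_risk n \<pi> (dyadic_estimator n J)
    \<le> exp (- (real n * (a / 2 ^ (CARD('n) * J)) * (h\<^sup>2 / 2))) + A * (c * \<rho> ^ Suc J / (1 - \<rho>))"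
proof -
  have sets: "sets \<pi> = sets observation_space" and b: "bayes_rule \<pi> \<in> sparse_class w"
    using \<pi> by (auto simp: model_def)
  interpret prob_space \<pi> by (rule model_prob_space[OF \<pi>])
  interpret P: prob_space "\<Pi>\<^sub>M i\<in>{..<n}. \<pi>" by (intro prob_space_PiM prob_space_axioms)
  obtain G s where G: "G \<subseteq> dyadic_index J" 
    and s: "\<And>k. k \<in> G \<Longrightarrow> s k = 1 \<or> s k = (-1::real)"
    and AE: "\<And>k. k \<in> G \<Longrightarrow> AE x in cube_lebesgue. x \<in> dyadic_cell J k \<longrightarrow> bayes_rule \<pi> x = s k"
    and B: "measure cube_lebesgue {x \<in> unit_cube. dyadic_pos J x \<notin> G} \<le> c * \<rho> ^ Suc J / (1 - \<rho>)"
    by (rule sparse_class_approximation[OF b w \<rho>, where J = J]) (rule that)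
  have finG: "finite G" using G finite_dyadic_index finite_subset by blast
  define p where "p k = measure \<pi> {z \<in> space \<pi>. fst z \<in> dyadic_cell J k}" for k
  define b where "b = measure \<pi> {z \<in> space \<pi>. fst z \<in> {x \<in> unit_cube. dyadic_pos J x \<notin> G}}"
  define V where "V k D = (\<Prod>i<n. vote_weight (1 + h) (dyadic_cell J k) (s k) (D i))" for k D
  define e where "e = exp (- (real n * (a / 2 ^ (CARD('n) * J)) * (h\<^sup>2 / 2)))"
  have V0: "0 \<le> V k D" for k D unfolding V_def using h by (auto intro!: prod_nonneg simp: vote_weight_def)
  have cell: "dyadic_cell J k \<in> sets cube_lebesgue" if "k \<in> G" for k using that G by auto
  have VI: "integrable (\<Pi>\<^sub>M i\<in>{..<n}. \<pi>) (V k)" and Ve: "(\<integral>D. V k D \<partial>(\<Pi>\<^sub>M i\<in>{..<n}. \<pi>)) \<le> e" if k: "k \<in> G" for k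
  proof -
    note v = integral_prod_vote_weight[OF \<pi> h cell[OF k] s[OF k] AE[OF k], of n]
    show "integrable (\<Pi>\<^sub>M i\<in>{..<n}. \<pi>) (V k)" using v(1) by (simp add: V_def[abs_def])
    have "a / 2 ^ (CARD('n) * J) \<le> p k"
      using marginal_bounds(1)[OF \<pi> cell[OF k] aA] k G by (auto simp: p_def measure_dyadic_cell)
    then have "real n * (a / 2 ^ (CARD('n) * J)) * (h\<^sup>2 / 2) \<le> real n * p k * (h\<^sup>2 / 2)"
      by (intro mult_right_mono mult_left_mono) auto
    then show "(\<integral>D. V k D \<partial>(\<Pi>\<^sub>M i\<in>{..<n}. \<pi>)) \<le> e"
      using v(2) unfolding V_def e_def p_def by (smt (verit) exp_le_cancel_iff)
  qed
  \<comment> \<open>The majorant is integrable, so the estimator need not be shown measurable: a non-integrable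
    function has integral 0.\<close>
  have "excess_risk n \<pi> (dyadic_estimator n J) \<le> (\<integral>D. (\<Sum>k\<in>G. p k * V k D) + b \<partial>(\<Pi>\<^sub>M i\<in>{..<n}. \<pi>))"
    unfolding excess_risk_def
  proof (rule integral_mono')
    show "integrable (\<Pi>\<^sub>M i\<in>{..<n}. \<pi>) (\<lambda>D. (\<Sum>k\<in>G. p k * V k D) + b)"
      using VI by (intro Bochner_Integration.integrable_add Bochner_Integration.integrable_sum integrable_mult_right) auto
    show "0 \<le> (\<Sum>k\<in>G. p k * V k D) + b" for D
      using V0 by (auto intro!: add_nonneg_nonneg sum_nonneg simp: p_def b_def)
    fix D assume "D \<in> space (\<Pi>\<^sub>M i\<in>{..<n}. \<pi>)"
    then have D: "snd (D i) = 1 \<or> snd (D i) = -1" if "i < n" for i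
      using that by (auto simp: space_PiM space_obs[OF sets] PiE_def Pi_def)
    have "(\<Sum>k\<in>G. p k * (if majority_coeff n J D k \<noteq> s k then 1 else 0)) \<le> (\<Sum>k\<in>G. p k * V k D)"
      unfolding V_def using h s
      by (intro sum_mono mult_left_mono majority_error_le_prod_vote_weight D) (auto simp: p_def)
    then show "risk \<pi> (dyadic_estimator n J D) - bayes_risk \<pi> \<le> (\<Sum>k\<in>G. p k * V k D) + b"
      using estimator_risk_le[OF \<pi> G AE, of n D] by (simp add: p_def b_def)
  qed
  also have "\<dots> = (\<Sum>k\<in>G. p k * (\<integral>D. V k D \<partial>(\<Pi>\<^sub>M i\<in>{..<n}. \<pi>))) + b"
    using VI by (simp add: P.prob_space)
  also have "\<dots> \<le> (\<Sum>k\<in>G. p k * e) + b"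
    using Ve by (intro add_right_mono sum_mono mult_left_mono) (auto simp: p_def)
  also have "(\<Sum>k\<in>G. p k * e) \<le> e"
  proof -
    have "disjoint_family_on (\<lambda>k. {z \<in> space \<pi>. fst z \<in> dyadic_cell J k}) G"
      using G by (auto simp: disjoint_family_on_def mem_dyadic_cell_iff subset_iff)
    then have "(\<Sum>k\<in>G. p k) = measure \<pi> (\<Union>k\<in>G. {z \<in> space \<pi>. fst z \<in> dyadic_cell J k})"
      unfolding p_def using finG sets_cylinder_obs(1)[OF sets cell]
      by (intro finite_measure_finite_Union[symmetric]) auto
    also have "\<dots> \<le> 1" by (rule prob_le_1)
    finally have "(\<Sum>k\<in>G. p k) * e \<le> 1 * e" by (rule mult_right_mono) (simp add: e_def)
    then show ?thesis by (simp add: sum_distrib_right)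
  qed
  also have "b \<le> A * (c * \<rho> ^ Suc J / (1 - \<rho>))"
  proof -
    have "{x \<in> unit_cube. dyadic_pos J x \<notin> G} = unit_cube - (\<Union>k\<in>G. dyadic_cell J k)"
      using G by (auto simp: mem_dyadic_cell_iff)
    moreover have "(\<Union>k\<in>G. dyadic_cell J k) \<in> sets cube_lebesgue"
      using cell finG by (intro sets.finite_UN) auto
    ultimately have "{x \<in> unit_cube. dyadic_pos J x \<notin> G} \<in> sets cube_lebesgue"
      by (simp add: sets_cube_lebesgue)
    then have "b \<le> A * measure cube_lebesgue {x \<in> unit_cube. dyadic_pos J x \<notin> G}"
      unfolding b_def by (rule marginal_bounds(2)[OF \<pi> _ aA])
    also have "\<dots> \<le> A * (c * \<rho> ^ Suc J / (1 - \<rho>))" by (rule mult_left_mono[OF B aA(2)])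
    finally show ?thesis .
  qed
  finally show ?thesis by (simp add: e_def)
qed

section \<open>Choice of the rank and the upper bound\<close>

text \<open>The largest rank J with 2^(d J) at most \<kappa> n / ln n when this ratio is at least 1;
  \<open>nat\<close> gives rank 0 otherwise.\<close>

definition sample_rank :: "nat \<Rightarrow> real \<Rightarrow> nat \<Rightarrow> nat" where
  "sample_rank d \<kappa> n = nat \<lfloor>log 2 (\<kappa> * real n / ln (real n)) / real d\<rfloor>"

text \<open>Up to rounding both ranks are u(n) plus a constant, and u(n) tends to infinity, so their
  ratio tends to 1; the factors \<kappa> and a / 2^d only enter the constants.\<close>

lemma of_reference_order_sample_rank:
  assumes d: "0 < d" and \<kappa>: "0 < \<kappa>" and a: "0 < a"
  shows "of_reference_order d a (sample_rank d \<kappa>)"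
proof -
  define c1 where "c1 = log 2 \<kappa> / real d"
  define c2 where "c2 = log 2 (a / 2 ^ d) / real d"
  define u where "u n = log 2 (real n / ln (real n)) / real d" for n :: nat
  \<comment> \<open>Exceeds c2 - 2 c1 + 3 and c1 - 2 c2, which is what the bounds 1/2 and 2 on the
    ratio need after rounding; it also makes both ranks positive.\<close>
  define M where "M = 2 * \<bar>c1\<bar> + 2 * \<bar>c2\<bar> + 10"
  have "filterlim (\<lambda>n::nat. log 2 (real n / ln (real n)) * (1 / real d)) at_top sequentially"
    by (rule filterlim_at_top_mult_tendsto_pos[OF tendsto_const]) (use d in \<open>simp, real_asymp\<close>)
  then have "filterlim u at_top sequentially" by (simp add: u_def[abs_def])
  then have ev: "\<forall>\<^sub>F n in sequentially. M \<le> u n" by (simp add: filterlim_at_top)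
  have "\<forall>\<^sub>F n in sequentially. 1/2 \<le> real (sample_rank d \<kappa> n) / real_of_int (reference_rank d a n) \<and>
        real (sample_rank d \<kappa> n) / real_of_int (reference_rank d a n) \<le> 2"
    using ev eventually_ge_at_top[of "2::nat"]
  proof eventually_elim
    case (elim n)
    have ln: "0 < ln (real n)" using elim by simp
    have n0: "0 < real n" using elim by simp
    have "log 2 (\<kappa> * real n / ln (real n)) = log 2 (\<kappa> * (real n / ln (real n)))" by simp
    also have "\<dots> = log 2 \<kappa> + log 2 (real n / ln (real n))"
      using \<kappa> ln n0 by (intro log_mult_pos) auto
    finally have J: "sample_rank d \<kappa> n = nat \<lfloor>c1 + u n\<rfloor>"
      by (simp add: sample_rank_def c1_def u_def add_divide_distrib)
    have "ln (a * real n / (2 ^ d * ln (real n))) / (real d * ln 2) = log 2 ((a / 2 ^ d) * (real n / ln (real n))) / real d"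
      by (simp add: log_def mult.commute)
    also have "log 2 ((a / 2 ^ d) * (real n / ln (real n))) = log 2 (a / 2 ^ d) + log 2 (real n / ln (real n))"
      using a ln n0 by (intro log_mult_pos) auto
    finally have R: "reference_rank d a n = \<lceil>c2 + u n\<rceil>"
      by (simp add: reference_rank_def c2_def u_def add_divide_distrib)
    have b1: "real (sample_rank d \<kappa> n) \<le> c1 + u n" "c1 + u n - 1 \<le> real (sample_rank d \<kappa> n)"
      unfolding J using elim unfolding M_def by linarith+
    have b2: "real_of_int (reference_rank d a n) \<le> c2 + u n + 1" "c2 + u n \<le> real_of_int (reference_rank d a n)"
      unfolding R by linarith+
    have "0 < real_of_int (reference_rank d a n)" using b2 elim unfolding M_def by linarith
    moreover have "real_of_int (reference_rank d a n) \<le> 2 * real (sample_rank d \<kappa> n)"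
      using b1 b2 elim unfolding M_def by linarith
    moreover have "real (sample_rank d \<kappa> n) \<le> 2 * real_of_int (reference_rank d a n)"
      using b1 b2 elim unfolding M_def by linarith
    ultimately show ?case by (simp add: field_simps)
  qed
  moreover have "(0::real) < 1/2" "(0::real) < 2" by auto
  ultimately show ?thesis unfolding of_reference_order_def by blast
qed

theorem estimator_upper_bound:
  fixes h a A \<beta> c :: real
  assumes h: "0 < h" "h < 1" and a: "0 < a" and A: "0 \<le> A" and \<beta>: "0 < \<beta>" "\<beta> \<le> 1" and c: "0 \<le> c"
    and w: "\<And>j. w j \<le> c * 2 ^ (CARD('n) * j) * (2 powr (- (real CARD('n) * \<beta>))) ^ j"
  shows "\<exists>C>0. \<exists>J. of_reference_order CARD('n) a J \<and>
     (\<forall>n\<ge>2. \<forall>\<pi>\<in>(model w h a A :: ((real ^ 'n::finite) \<times> real) measure set).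
        excess_risk n \<pi> (dyadic_estimator n (J n)) \<le> C * (ln (real n) / real n) powr \<beta>)"
proof -
  define d where "d = CARD('n)"
  have d: "0 < d" by (simp add: d_def)
  \<comment> \<open>Chosen so that 2^(d J) \<le> \<kappa> n / ln n makes the exponent n (a / 2^(d
    J)) h^2 / 2 at least ln n.\<close>
  define \<kappa> where "\<kappa> = h\<^sup>2 / 2 * a"
  have \<kappa>: "0 < \<kappa>" using h a by (simp add: \<kappa>_def)
  define \<rho> where "\<rho> = 2 powr (- (real d * \<beta>))"
  have \<rho>: "0 < \<rho>" "\<rho> < 1" using d \<beta> by (auto simp: \<rho>_def intro!: powr_less_one)
  define J where "J = sample_rank d \<kappa>"
  define C1 where "C1 = A * (c / (1 - \<rho>))"
  have C1: "0 \<le> C1" using A c \<rho> by (simp add: C1_def)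
  \<comment> \<open>1 / ln 2 pays for 1 / n \<le> (ln n / n) / ln 2, valid for n \<ge> 2;
    \<open>C1\<close> is the constant of the remainder, and the added 1 covers the trivial bound
    when x < 1.\<close>
  define C where "C = 1 / ln 2 + (C1 + 1) / \<kappa> powr \<beta>"
  have C: "0 < C" using \<kappa> C1 by (simp add: C_def add_pos_pos)
  have "excess_risk n \<pi> (dyadic_estimator n (J n)) \<le> C * (ln (real n) / real n) powr \<beta>"
    if n: "2 \<le> n" and \<pi>: "\<pi> \<in> (model w h a A :: ((real ^ 'n) \<times> real) measure set)" for n \<pi>
  proof -
    define r where "r = ln (real n) / real n"
    define x where "x = \<kappa> * real n / ln (real n)"
    have n0: "0 < real n" using n by simp
    have ln2: "ln 2 \<le> ln (real n)" using n by (subst ln_le_cancel_iff) auto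
    then have lnpos: "0 < ln (real n)" using ln_gt_zero[of "2::real"] by linarith
    have r0: "0 < r" using lnpos n0 by (simp add: r_def)
    have r1: "r \<le> 1" using ln_le_minus_one[of "real n"] n0 by (simp add: r_def)
    have rp: "0 < r powr \<beta>" using r0 by simp
    have x: "0 < x" "x = \<kappa> / r" using \<kappa> lnpos n0 by (simp_all add: x_def r_def)
    have xr: "1 / x powr \<beta> = r powr \<beta> / \<kappa> powr \<beta>" using x r0 \<kappa> by (simp add: powr_divide)
    show ?thesis
    \<comment> \<open>If x < 1, no rank satisfies 2^(d J) \<le> x, but then x^(-\<beta>) = (r /
      \<kappa>)^\<beta> is at least 1 and the trivial bound is enough.\<close>
    proof (cases "x < 1")
      case True
      have "excess_risk n \<pi> (dyadic_estimator n (J n)) \<le> 1"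
        by (rule excess_risk_le_1[OF model_prob_space[OF \<pi>]])
      also have "1 \<le> 1 / x powr \<beta>"       proof -
        have "x powr \<beta> \<le> 1 powr \<beta>" using True x(1) \<beta> by (intro powr_mono2) auto
        then show ?thesis using x(1) by (simp add: le_divide_eq)
      qed
      also have "\<dots> = (1 / \<kappa> powr \<beta>) * r powr \<beta>" using xr by simp
      also have "\<dots> \<le> C * r powr \<beta>"
      proof (rule mult_right_mono)
        have "0 \<le> 1 / ln (2::real)" "0 \<le> C1 / \<kappa> powr \<beta>" using C1 by auto
        then show "1 / \<kappa> powr \<beta> \<le> C" unfolding C_def add_divide_distrib by linarith
      qed (use rp in simp)
      finally show ?thesis by (simp add: r_def)
    next
      case False
      then have "0 \<le> log 2 x" by simp
      define L where "L = log 2 x / real d"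
      have L0: "0 \<le> L" using \<open>0 \<le> log 2 x\<close> by (simp add: L_def)
      have Jn: "J n = nat \<lfloor>L\<rfloor>" by (simp add: J_def sample_rank_def L_def x_def)
      have J1: "real (J n) \<le> L" "L \<le> real (Suc (J n))" unfolding Jn using L0 by linarith+
      have J2: "real d * real (J n) \<le> log 2 x" "log 2 x \<le> real d * real (Suc (J n))"
        using J1 d by (simp_all add: L_def field_simps)
      have p: "2 ^ (d * J n) \<le> x"
      proof -
        have "(2::real) ^ (d * J n) = 2 powr (real d * real (J n))"
          by (simp add: powr_realpow[symmetric])
        also have "\<dots> \<le> 2 powr (log 2 x)" using J2 by simp
        finally show ?thesis using x by simp
      qed
      have 1: "exp (- (real n * (a / 2 ^ (CARD('n) * J n)) * (h\<^sup>2 / 2))) \<le> (1 / ln 2) * r powr \<beta>"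
      proof -
        have "ln (real n) = \<kappa> * real n / x" using x(1) \<kappa> lnpos n0 by (simp add: x_def)
        also have "\<dots> \<le> \<kappa> * real n / 2 ^ (d * J n)"
          using p \<kappa> n0 by (intro divide_left_mono) (auto intro: mult_pos_pos x(1))
        also have "\<dots> = real n * (a / 2 ^ (CARD('n) * J n)) * (h\<^sup>2 / 2)"
          by (simp add: \<kappa>_def d_def mult_ac)
        finally have "exp (- (real n * (a / 2 ^ (CARD('n) * J n)) * (h\<^sup>2 / 2))) \<le> exp (- ln (real n))"
          by simp
        also have "\<dots> = 1 / real n" using n0 by (simp add: exp_minus inverse_eq_divide)
        also have "\<dots> \<le> (1 / ln 2) * r" using ln2 n0 by (simp add: r_def field_simps)
        also have "\<dots> \<le> (1 / ln 2) * r powr \<beta>"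
          using powr_mono'[of \<beta> 1 r] r0 r1 \<beta> by (intro mult_left_mono) auto
        finally show ?thesis .
      qed
      \<comment> \<open>The tail starts at frequency J + 1, and rounding down gives log2 x \<le> d
        (J + 1), so the rounding costs no constant here.\<close>
      have 2: "\<rho> ^ Suc (J n) \<le> r powr \<beta> / \<kappa> powr \<beta>"
      proof -
        have "\<rho> ^ Suc (J n) = \<rho> powr real (Suc (J n))" using \<rho> by (subst powr_realpow) auto
        also have "\<dots> = 2 powr (- (\<beta> * (real d * real (Suc (J n)))))"
          by (simp add: \<rho>_def powr_powr mult_ac)
        also have "\<dots> \<le> 2 powr (- (\<beta> * log 2 x))" using J2(2) \<beta> by (intro powr_mono) auto
        also have "\<dots> = (2 powr (log 2 x)) powr (- \<beta>)" by (simp add: powr_powr mult.commute)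
        also have "\<dots> = 1 / x powr \<beta>" using x by (simp add: powr_minus_divide)
        finally show ?thesis using xr by simp
      qed
      have "excess_risk n \<pi> (dyadic_estimator n (J n)) \<le>
         exp (- (real n * (a / 2 ^ (CARD('n) * J n)) * (h\<^sup>2 / 2))) + A * (c * \<rho> ^ Suc (J n) / (1 - \<rho>))"
        by (rule estimator_excess_risk_le[OF \<pi> h _ A]) (use a w \<rho> in \<open>auto simp: \<rho>_def d_def\<close>)
      also have "A * (c * \<rho> ^ Suc (J n) / (1 - \<rho>)) = C1 * \<rho> ^ Suc (J n)" by (simp add: C1_def)
      also have "C1 * \<rho> ^ Suc (J n) \<le> C1 * (r powr \<beta> / \<kappa> powr \<beta>)" by (rule mult_left_mono[OF 2 C1])
      also have "\<dots> \<le> (C1 + 1) / \<kappa> powr \<beta> * r powr \<beta>"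
        using rp \<kappa> by (simp add: divide_right_mono)
      finally show ?thesis using 1 by (simp add: C_def r_def distrib_right)
    qed
  qed
  then show ?thesis
    using C of_reference_order_sample_rank[OF d \<kappa> a] unfolding J_def d_def by blast
qed

section \<open>Uniform designs with sign patterns\<close>

text \<open>\<open>\<sigma>\<close> lists the cells with sign -1, so flipping the sign of one cell
  is inserting or removing its index, and averaging over signs is a sum over a power set.\<close>

definition sign_pattern :: "nat \<Rightarrow> ('n::finite \<Rightarrow> nat) set \<Rightarrow> real ^ 'n \<Rightarrow> real" where
  "sign_pattern J \<sigma> x = (if dyadic_pos J x \<in> \<sigma> then -1 else 1)"

lemma sign_pattern_measurable [measurable]: "sign_pattern J \<sigma> \<in> borel_measurable cube_lebesgue"
proof -
  have "{x \<in> unit_cube. dyadic_pos J x \<in> \<sigma>} = (\<Union>k\<in>\<sigma> \<inter> dyadic_index J. dyadic_cell J k)"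
    by (auto simp: mem_dyadic_cell_iff)
  also have "\<dots> \<in> sets cube_lebesgue" by (intro sets.finite_UN) auto
  finally show ?thesis unfolding sign_pattern_def by (intro measurable_If) simp_all
qed

text \<open>
  The cells of frequency \<open>j\<close> that meet the corner cell of frequency \<open>m\<close> are those with index in
  \<open>dyadic_index (j - m)\<close>: truncated subtraction leaves only the index 0 when \<open>j \<le> m\<close>.
\<close>

lemma dyadic_pos_coarse:
  assumes x: "x \<in> unit_cube" and j: "j \<le> J" and pos: "dyadic_pos J x \<in> dyadic_index (J - m)"
  shows "dyadic_pos j x \<in> dyadic_index (j - m)"
proof -
  have "dyadic_pos J x i < 2 ^ (j - m) * 2 ^ (J - j)" for i
  proof -
    have "dyadic_pos J x i < 2 ^ (J - m)" using pos by (simp add: dyadic_index_def)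
    also have "\<dots> \<le> 2 ^ ((j - m) + (J - j))" using j by (intro power_increasing) auto
    finally show ?thesis by (simp add: power_add)
  qed
  then show ?thesis
    by (simp add: dyadic_index_def dyadic_pos_div[OF x j] less_mult_imp_div_less)
qed

lemma dyadic_index_0: "dyadic_index 0 = {\<lambda>_. 0}"
  by (auto simp: dyadic_index_def)

text \<open>\<open>b\<close> stands for the Bayes rule of a law with pattern
  \<open>\<sigma>\<close>, which is determined only a.e.\<close>

context
  fixes b :: "real ^ 'n::finite \<Rightarrow> real" and J m :: nat and \<sigma> :: "('n \<Rightarrow> nat) set"
  assumes b: "AE x in cube_lebesgue. b x = sign_pattern J \<sigma> x"
    and \<sigma>: "\<sigma> \<subseteq> dyadic_index (J - m)" and mJ: "m \<le> J"
begin

lemma pattern_constant_fine: 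
  assumes "k \<in> dyadic_index j" "J \<le> j"
  shows "ae_constant_on b (dyadic_cell j k)"
proof -
  have "AE x in cube_lebesgue. x \<in> dyadic_cell j k \<longrightarrow> b x = (if dyadic_ancestor J j k \<in> \<sigma> then -1 else 1)"
    using b
  proof eventually_elim
    case (elim x)
    show ?case
    proof
      assume "x \<in> dyadic_cell j k"
      then have "dyadic_pos J x = dyadic_ancestor J j k"
        using assms by (auto simp: mem_dyadic_cell_iff dyadic_ancestor_pos)
      then show "b x = (if dyadic_ancestor J j k \<in> \<sigma> then -1 else 1)"
        using elim by (simp add: sign_pattern_def)
    qed
  qed
  then show ?thesis unfolding ae_constant_on_def by blast
qed

lemma pattern_positive_outside:
  assumes j: "j \<le> J"
  shows "AE x in cube_lebesgue. dyadic_pos j x \<notin> dyadic_index (j - m) \<longrightarrow> b x = 1"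
  using b AE_space
proof eventually_elim
  case (elim x)
  then have x: "x \<in> unit_cube" by simp
  show ?case using elim(1) dyadic_pos_coarse[OF x j] \<sigma> by (auto simp: sign_pattern_def)
qed

lemma pattern_constant_outside:
  assumes "j \<le> J" "k \<in> dyadic_index j" "k \<notin> dyadic_index (j - m)"
  shows "ae_constant_on b (dyadic_cell j k)"
proof -
  have "AE x in cube_lebesgue. x \<in> dyadic_cell j k \<longrightarrow> b x = 1"
    using pattern_positive_outside[OF assms(1)] by eventually_elim (use assms in \<open>auto simp: mem_dyadic_cell_iff\<close>)
  then show ?thesis unfolding ae_constant_on_def by blast
qed

text \<open>Maximality makes the parent non-constant, and a non-constant cell has frequency below
  \<open>J\<close> and meets the corner. For \<open>j < m\<close> the only such parent is the corner
  cell of frequency \<open>j\<close>, whose children have coordinates 0 or 1; otherwise the parent,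
  and with it the child, lies in the corner cell of frequency \<open>m\<close>.\<close>

lemma maximal_constant_parent:
  assumes "maximal_constant b (Suc j) k" "k \<in> dyadic_index (Suc j)"
  shows "j < J" and "k \<in> dyadic_index (if j < m then 1 else Suc j - m)"
proof -
  let ?p = "dyadic_ancestor j (Suc j) k"
  have p: "?p \<in> dyadic_index j" using assms(2) by (intro dyadic_ancestor_in_index) auto
  have nc: "\<not> ae_constant_on b (dyadic_cell j ?p)" using assms(1) by (simp add: maximal_constant_def)
  then show j: "j < J" using pattern_constant_fine[OF p] by force
  then have "?p \<in> dyadic_index (j - m)" using nc pattern_constant_outside[OF _ p] by force
  then have *: "k i div 2 < 2 ^ (j - m)" for i by (simp add: dyadic_index_def dyadic_ancestor_def)
  show "k \<in> dyadic_index (if j < m then 1 else Suc j - m)"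
  proof (cases "j < m")
    case True
    then have "k i < 2" for i using *[of i] by simp
    then show ?thesis using True by (simp add: dyadic_index_def)
  next
    case False
    have "k i < 2 * 2 ^ (j - m)" for i using *[of i] by linarith
    then show ?thesis using False by (simp add: dyadic_index_def Suc_diff_le)
  qed
qed

text \<open>
  Saves one cell per level below \<open>m\<close>: the threshold in the exponential weight only guarantees room
  for \<open>2 ^ d - 1\<close> of the \<open>2 ^ d\<close> subcells.
\<close>

lemma not_maximal_constant_corner:
  assumes "Suc j < m"
  shows "\<not> maximal_constant b (Suc j) (\<lambda>_. 0)"
proof
  assume max: "maximal_constant b (Suc j) (\<lambda>_. 0)"
  then obtain c where c: "AE x in cube_lebesgue. x \<in> dyadic_cell (Suc j) (\<lambda>_. 0) \<longrightarrow> b x = c"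
    by (auto simp: maximal_constant_def ae_constant_on_def)
  \<comment> \<open>A neighbour of the corner at frequency \<open>m\<close>, still inside the corner
    cell of frequency \<open>Suc j\<close> because \<open>Suc j < m\<close>. There \<open>b\<close>
    is 1, so 1 is the only possible constant.\<close>
  define k :: "'n \<Rightarrow> nat" where "k = (\<lambda>_. 1)"
  have k: "k \<in> dyadic_index m"
    using assms by (cases m) (auto simp: dyadic_index_def k_def intro: less_le_trans[OF _ mult_le_mono2[of 1]])
  have k0: "k \<noteq> (\<lambda>_. 0)" by (simp add: k_def fun_eq_iff)
  have "(2::nat) ^ (m - Suc j) > 1" using assms by (intro one_less_power) auto
  then have anc: "dyadic_ancestor (Suc j) m k = (\<lambda>_. 0)"
    by (simp add: dyadic_ancestor_def fun_eq_iff k_def)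
  have sub: "dyadic_cell m k \<subseteq> dyadic_cell (Suc j) (\<lambda>_. 0)"
    using dyadic_cell_subset_ancestor[of "Suc j" m k] assms k anc by simp
  have c1: "c = 1"
  proof (rule ccontr)
    assume "c \<noteq> 1"
    have "AE x in cube_lebesgue. x \<in> dyadic_cell m k \<longrightarrow> False"
      using c pattern_positive_outside[OF mJ]
    proof eventually_elim
      case (elim x)
      show ?case
      proof
        assume x: "x \<in> dyadic_cell m k"
        then have "b x = 1" using elim(2) k0 mem_dyadic_cell_iff[OF k, of x] by (simp add: dyadic_index_0)
        moreover have "b x = c" using elim(1) x sub by blast
        ultimately show False using \<open>c \<noteq> 1\<close> by simp
      qed
    qed
    then show False using k by (rule AE_dyadic_cell_False)
  qed
  have SJ: "Suc j \<le> J" using assms mJ by simp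
  have z: "(\<lambda>_. 0) \<in> dyadic_index (Suc j)" by (simp add: dyadic_index_def)
  \<comment> \<open>With value 1 in the corner and 1 elsewhere, \<open>b\<close> is 1 a.e. on the
    cube, so the parent is constant too and maximality fails.\<close>
  have "AE x in cube_lebesgue. b x = 1"
    using c pattern_positive_outside[OF SJ] AE_space
  proof eventually_elim
    case (elim x)
    then have x: "x \<in> unit_cube" by simp
    show ?case
    proof (cases "dyadic_pos (Suc j) x = (\<lambda>_. 0)")
      case True
      then show ?thesis using elim(1) c1 x mem_dyadic_cell_iff[OF z, of x] by simp
    next
      case False
      then show ?thesis using elim(2) assms by (simp add: dyadic_index_0)
    qed
  qed
  then have "ae_constant_on b S" for S unfolding ae_constant_on_def
    by (intro exI[of _ 1]) (auto elim: eventually_mono)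
  then show False using max by (auto simp: maximal_constant_def)
qed

text \<open>The hypotheses on \<open>w\<close> mirror the possible counts: at most 1 at frequency 0,
  the siblings of the corner cell below \<open>m\<close>, all 2^d children at \<open>m\<close>,
  where the corner cell itself may be constant, then the cells in the corner up to \<open>J\<close>,
  and none beyond.\<close>

lemma pattern_sparse:
  assumes bp: "b \<in> prediction_rules" and w0: "1 \<le> w 0" "\<And>j. 0 \<le> w j"
    and w1: "\<And>j. 1 \<le> j \<Longrightarrow> j < m \<Longrightarrow> 2 ^ CARD('n) - 1 \<le> w j"
    and w2: "1 \<le> m \<Longrightarrow> 2 ^ CARD('n) \<le> w m"
    and w3: "\<And>j. m < j \<Longrightarrow> j \<le> J \<Longrightarrow> 2 ^ (CARD('n) * (j - m)) \<le> w j"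
  shows "b \<in> sparse_class w"
proof (rule sparse_classI[OF bp])
  show "ae_constant_on b (dyadic_cell J k)" if "k \<in> dyadic_index J" for k
    by (rule pattern_constant_fine[OF that]) simp
  fix i
  let ?S = "{k \<in> dyadic_index i. maximal_constant b i k}"
  show "real (card ?S) \<le> w i"
  proof (cases i)
    case 0
    have "card ?S \<le> card (dyadic_index 0 :: ('n \<Rightarrow> nat) set)"
      by (rule card_mono) (auto simp: 0)
    then show ?thesis using w0 by (simp add: 0 dyadic_index_0)
  next
    case (Suc j)
    consider (gt) "J \<le> j" | (lt) "Suc j < m" | (eq) "Suc j = m" | (mid) "m \<le> j" "j < J" by linarith
    then show ?thesis
    proof cases
      case gt
      then have "?S = {}" using maximal_constant_parent(1) by (force simp: Suc)
      then show ?thesis using w0 by (simp only: card.empty of_nat_0)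
    next
      case lt
      have "?S \<subseteq> dyadic_index 1 - {\<lambda>_. 0}"
        using maximal_constant_parent(2)[of j] not_maximal_constant_corner[OF lt] lt by (auto simp: Suc)
      then have "card ?S \<le> card (dyadic_index 1 - {\<lambda>_. 0} :: ('n \<Rightarrow> nat) set)" by (intro card_mono) auto
      also have "\<dots> = 2 ^ CARD('n) - 1"
        by (subst card_Diff_singleton) (auto simp: dyadic_index_def card_dyadic_index[of 1, unfolded dyadic_index_def, simplified])
      finally have "real (card ?S) \<le> 2 ^ CARD('n) - 1"
        by (metis (no_types, lifting) of_nat_le_iff of_nat_diff of_nat_1 of_nat_power of_nat_numeral one_le_power one_le_numeral)
      then show ?thesis using w1[of "Suc j"] lt by (simp add: Suc)
    next
      case eq
      have "?S \<subseteq> dyadic_index 1"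
        using maximal_constant_parent(2)[of j] eq by (auto simp: Suc)
      then have "card ?S \<le> card (dyadic_index 1 :: ('n \<Rightarrow> nat) set)" by (intro card_mono) auto
      then have "real (card ?S) \<le> real (2 ^ CARD('n))" by (simp only: card_dyadic_index mult_1_right of_nat_le_iff)
      also have "\<dots> \<le> w i" using w2 eq by (simp add: Suc)
      finally show ?thesis .
    next
      case mid
      have "?S \<subseteq> dyadic_index (Suc j - m)"
        using maximal_constant_parent(2)[of j] mid by (auto simp: Suc)
      then have "card ?S \<le> card (dyadic_index (Suc j - m) :: ('n \<Rightarrow> nat) set)" by (intro card_mono) auto
      then have "real (card ?S) \<le> real (2 ^ (CARD('n) * (Suc j - m)))" by (simp only: card_dyadic_index of_nat_le_iff)
      also have "\<dots> \<le> w i" using w3[of "Suc j"] mid by (simp add: Suc)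
      finally show ?thesis .
    qed
  qed
qed

end

section \<open>Laws with a given sign pattern\<close>

lemma nn_integral_observation_space:
  assumes F: "F \<in> borel_measurable observation_space"
  shows "(\<integral>\<^sup>+z. F z \<partial>observation_space) = (\<integral>\<^sup>+x. F (x, -1) + F (x, 1) \<partial>cube_lebesgue)"
proof -
  interpret L: sigma_finite_measure label_space
    unfolding label_space_def by (rule sigma_finite_measure_count_space_finite) simp
  have "(\<integral>\<^sup>+z. F z \<partial>observation_space) = (\<integral>\<^sup>+x. (\<integral>\<^sup>+y. F (x, y) \<partial>label_space) \<partial>cube_lebesgue)"
    using F unfolding observation_space_def by (rule L.nn_integral_fst[symmetric])
  also have "\<dots> = (\<integral>\<^sup>+x. F (x, -1) + F (x, 1) \<partial>cube_lebesgue)"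
    unfolding label_space_def by (simp add: nn_integral_count_space_finite)
  finally show ?thesis .
qed

text \<open>Density with respect to Lebesgue measure times counting measure: the design is uniform
  and the label agrees with the pattern with probability (1 + h) / 2, which meets the margin with
  equality.\<close>

definition pattern_density :: "real \<Rightarrow> nat \<Rightarrow> ('n::finite \<Rightarrow> nat) set \<Rightarrow> (real ^ 'n) \<times> real \<Rightarrow> real" where
  "pattern_density h J \<sigma> z = (1 + h * snd z * sign_pattern J \<sigma> (fst z)) / 2"

definition pattern_measure :: "real \<Rightarrow> nat \<Rightarrow> ('n::finite \<Rightarrow> nat) set \<Rightarrow> ((real ^ 'n) \<times> real) measure" where
  "pattern_measure h J \<sigma> = density observation_space (\<lambda>z. ennreal (pattern_density h J \<sigma> z))"

lemma sets_pattern_measure: "sets (pattern_measure h J \<sigma>) = sets observation_space"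
  by (simp add: pattern_measure_def)

lemma pattern_density_measurable [measurable]:
  "pattern_density h J \<sigma> \<in> borel_measurable observation_space"
proof -
  have [measurable]: "(\<lambda>z. snd z) \<in> borel_measurable observation_space"
    "fst \<in> observation_space \<rightarrow>\<^sub>M cube_lebesgue"
    using measurable_snd_obs[OF refl] measurable_fst_obs[OF refl] by (auto simp: label_space_measurable_iff)
  show ?thesis unfolding pattern_density_def by measurable
qed

lemma nn_integral_pattern_measure:
  assumes F: "F \<in> borel_measurable observation_space"
  shows "(\<integral>\<^sup>+z. F z \<partial>pattern_measure h J \<sigma>) =
    (\<integral>\<^sup>+x. ennreal ((1 - h * sign_pattern J \<sigma> x) / 2) * F (x, -1)
         + ennreal ((1 + h * sign_pattern J \<sigma> x) / 2) * F (x, 1) \<partial>cube_lebesgue)"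
proof -
  have "(\<integral>\<^sup>+z. F z \<partial>pattern_measure h J \<sigma>) = (\<integral>\<^sup>+z. ennreal (pattern_density h J \<sigma> z) * F z \<partial>observation_space)"
    unfolding pattern_measure_def using F by (intro nn_integral_density) auto
  also have "\<dots> = (\<integral>\<^sup>+x. ennreal (pattern_density h J \<sigma> (x, -1)) * F (x, -1)
      + ennreal (pattern_density h J \<sigma> (x, 1)) * F (x, 1) \<partial>cube_lebesgue)"
    using F by (intro nn_integral_observation_space) auto
  finally show ?thesis by (simp add: pattern_density_def)
qed

context
  fixes h :: real and J :: nat and \<sigma> :: "('n::finite \<Rightarrow> nat) set"
  assumes h: "0 < h" "h < 1"
begin

private abbreviation "\<pi> \<equiv> pattern_measure h J \<sigma>"
private abbreviation "f \<equiv> sign_pattern J \<sigma>"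

lemma sign_pattern_cases: "f x = -1 \<or> f x = 1"
  by (simp add: sign_pattern_def)

lemma emeasure_pattern_cylinder:
  assumes S: "S \<in> sets cube_lebesgue"
  shows "emeasure \<pi> {z \<in> space \<pi>. fst z \<in> S} = emeasure cube_lebesgue S"
proof -
  have m: "{z \<in> space \<pi>. fst z \<in> S} \<in> sets \<pi>" by (rule sets_cylinder_obs[OF sets_pattern_measure S])
  have "emeasure \<pi> {z \<in> space \<pi>. fst z \<in> S} = (\<integral>\<^sup>+z. indicator {z \<in> space \<pi>. fst z \<in> S} z \<partial>\<pi>)"
    using m by simp
  also have "\<dots> = (\<integral>\<^sup>+x. ennreal ((1 - h * f x) / 2) * indicator {z \<in> space \<pi>. fst z \<in> S} (x, -1)
         + ennreal ((1 + h * f x) / 2) * indicator {z \<in> space \<pi>. fst z \<in> S} (x, 1) \<partial>cube_lebesgue)"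
    using m by (intro nn_integral_pattern_measure) (simp add: sets_pattern_measure)
  also have "\<dots> = (\<integral>\<^sup>+x. indicator S x \<partial>cube_lebesgue)"
  proof (rule nn_integral_cong)
    fix x :: "real ^ 'n" assume "x \<in> space cube_lebesgue"
    moreover have "ennreal ((1 - h * f x) / 2) + ennreal ((1 + h * f x) / 2) = 1"
      using h sign_pattern_cases[of x] by (subst ennreal_plus[symmetric]) (auto simp: field_simps)
    ultimately show "ennreal ((1 - h * f x) / 2) * indicator {z \<in> space \<pi>. fst z \<in> S} (x, -1)
         + ennreal ((1 + h * f x) / 2) * indicator {z \<in> space \<pi>. fst z \<in> S} (x, 1) = indicator S x"
      by (auto simp: indicator_def space_obs[OF sets_pattern_measure])
  qed
  also have "\<dots> = emeasure cube_lebesgue S" using S by simp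
  finally show ?thesis .
qed

lemma prob_space_pattern_measure: "prob_space \<pi>"
proof
  interpret L: prob_space "cube_lebesgue :: (real ^ 'n) measure" by (rule prob_space_cube_lebesgue)
  have "{z \<in> space \<pi>. fst z \<in> unit_cube} = space \<pi>" by (auto simp: space_obs[OF sets_pattern_measure])
  then show "emeasure \<pi> (space \<pi>) = 1"
    using emeasure_pattern_cylinder[of unit_cube] L.emeasure_space_1 by (simp add: sets_cube_lebesgue)
qed

lemma marginal_pattern_measure: "marginal \<pi> = cube_lebesgue"
proof (rule measure_eqI)
  show "sets (marginal \<pi>) = sets cube_lebesgue" by (simp add: marginal_def)
  fix S assume "S \<in> sets (marginal \<pi>)"
  then have "S \<in> sets cube_lebesgue" by (simp add: marginal_def)
  then show "emeasure (marginal \<pi>) S = emeasure cube_lebesgue S"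
    using emeasure_marginal[OF prob_space_pattern_measure sets_pattern_measure] emeasure_pattern_cylinder by simp
qed

text \<open>The positive part of the law has density (1 + h f) / 2 with respect to the uniform
  design, and Radon-Nikodym derivatives are a.e. unique.\<close>

lemma regression_pattern_measure:
  "AE x in cube_lebesgue. regression \<pi> x = (1 + h * f x) / 2"
proof -
  interpret L: prob_space "cube_lebesgue :: (real ^ 'n) measure" by (rule prob_space_cube_lebesgue)
  let ?N = "distr (density \<pi> (indicator (UNIV \<times> {1}))) cube_lebesgue fst"
  have "density cube_lebesgue (\<lambda>x. ennreal ((1 + h * f x) / 2)) = ?N"
  proof (rule measure_eqI)
    show "sets (density cube_lebesgue (\<lambda>x. ennreal ((1 + h * f x) / 2))) = sets ?N" by simp
    fix S assume "S \<in> sets (density cube_lebesgue (\<lambda>x. ennreal ((1 + h * f x) / 2)))"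
    then have S: "S \<in> sets cube_lebesgue" by simp
    let ?T = "{z \<in> space \<pi>. fst z \<in> S \<and> snd z = 1}"
    have m: "?T \<in> sets \<pi>" by (rule sets_cylinder_obs[OF sets_pattern_measure S])
    have "emeasure ?N S = emeasure \<pi> ?T"
      by (rule emeasure_positive_part[OF prob_space_pattern_measure sets_pattern_measure S])
    also have "\<dots> = (\<integral>\<^sup>+z. indicator ?T z \<partial>\<pi>)" using m by simp
    also have "\<dots> = (\<integral>\<^sup>+x. ennreal ((1 - h * f x) / 2) * indicator ?T (x, -1)
         + ennreal ((1 + h * f x) / 2) * indicator ?T (x, 1) \<partial>cube_lebesgue)"
      using m by (intro nn_integral_pattern_measure) (simp add: sets_pattern_measure)
    also have "\<dots> = (\<integral>\<^sup>+x. ennreal ((1 + h * f x) / 2) * indicator S x \<partial>cube_lebesgue)"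
      by (intro nn_integral_cong) (auto simp: indicator_def space_obs[OF sets_pattern_measure])
    also have "\<dots> = emeasure (density cube_lebesgue (\<lambda>x. ennreal ((1 + h * f x) / 2))) S"
      using S by (subst emeasure_density) auto
    finally show "emeasure (density cube_lebesgue (\<lambda>x. ennreal ((1 + h * f x) / 2))) S = emeasure ?N S"
      by simp
  qed
  then have "AE x in cube_lebesgue. ennreal ((1 + h * f x) / 2) = RN_deriv cube_lebesgue ?N x"
    by (intro L.RN_deriv_unique) simp_all
  then show ?thesis
  proof eventually_elim
    case (elim x)
    have "0 \<le> (1 + h * f x) / 2" using h sign_pattern_cases[of x] by auto
    then show ?case unfolding regression_def marginal_pattern_measure using elim[symmetric] by simp
  qed
qed

lemma bayes_pattern_measure: "AE x in cube_lebesgue. bayes_rule \<pi> x = f x"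
  using regression_pattern_measure
proof eventually_elim
  case (elim x)
  then show ?case using sign_pattern_cases[of x] h by (auto simp: bayes_rule_def)
qed

lemma bayes_pattern_prediction_rule: "bayes_rule \<pi> \<in> prediction_rules"
proof -
  note regression_measurable[OF prob_space_pattern_measure sets_pattern_measure, measurable]
  have "bayes_rule \<pi> \<in> borel_measurable cube_lebesgue" unfolding bayes_rule_def by measurable
  then show ?thesis
    unfolding prediction_rules_def label_space_measurable_iff by (auto simp: bayes_rule_def)
qed

text \<open>Given the design point, the error probability is (1 - h) / 2 where \<open>g\<close>
  agrees with the pattern and (1 + h) / 2 where it does not. The excess risk is thus exactly h times
  a volume.\<close>

lemma risk_pattern_measure:
  assumes g: "g \<in> prediction_rules"
  shows "risk \<pi> g = (1 - h) / 2 + h * measure cube_lebesgue {x \<in> unit_cube. g x \<noteq> f x}"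
proof -
  interpret L: prob_space "cube_lebesgue :: (real ^ 'n) measure" by (rule prob_space_cube_lebesgue)
  interpret prob_space \<pi> by (rule prob_space_pattern_measure)
  have gm[measurable]: "g \<in> borel_measurable cube_lebesgue"
    using g by (simp add: prediction_rules_def label_space_measurable_iff)
  have [measurable]: "fst \<in> \<pi> \<rightarrow>\<^sub>M cube_lebesgue" "(\<lambda>z. snd z) \<in> borel_measurable \<pi>"
    using measurable_fst_obs[OF sets_pattern_measure[of h J \<sigma>]] measurable_snd_obs[OF sets_pattern_measure[of h J \<sigma>]]
    by (auto simp: label_space_measurable_iff)
  let ?T = "{z \<in> space \<pi>. g (fst z) \<noteq> snd z}"
  let ?U = "{x \<in> space cube_lebesgue. g x \<noteq> f x}"
  have m: "?T \<in> sets \<pi>" by measurable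
  have U: "?U \<in> sets cube_lebesgue" by measurable
  have "ennreal (risk \<pi> g) = emeasure \<pi> ?T" by (simp add: risk_def emeasure_eq_measure)
  also have "\<dots> = (\<integral>\<^sup>+z. indicator ?T z \<partial>\<pi>)" using m by simp
  also have "\<dots> = (\<integral>\<^sup>+x. ennreal ((1 - h * f x) / 2) * indicator ?T (x, -1)
       + ennreal ((1 + h * f x) / 2) * indicator ?T (x, 1) \<partial>cube_lebesgue)"
    using m by (intro nn_integral_pattern_measure) (simp add: sets_pattern_measure)
  also have "\<dots> = (\<integral>\<^sup>+x. ennreal ((1 - h) / 2) + ennreal h * indicator ?U x \<partial>cube_lebesgue)"
  proof (rule nn_integral_cong)
    fix x :: "real ^ 'n" assume x: "x \<in> space cube_lebesgue"
    have e: "ennreal ((1 - h) / 2) + ennreal h = ennreal ((1 + h) / 2)"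
      using h by (subst ennreal_plus[symmetric]) (auto simp: field_simps)
    show "ennreal ((1 - h * f x) / 2) * indicator ?T (x, -1)
       + ennreal ((1 + h * f x) / 2) * indicator ?T (x, 1) = ennreal ((1 - h) / 2) + ennreal h * indicator ?U x"
      using x e sign_pattern_cases[of x] prediction_rules_range[OF g, of x]
      by (auto simp: indicator_def space_obs[OF sets_pattern_measure])
  qed
  also have "\<dots> = ennreal ((1 - h) / 2) + ennreal h * emeasure cube_lebesgue ?U"
    using U L.emeasure_space_1 by (subst nn_integral_add) (auto simp: nn_integral_cmult_indicator)
  also have "\<dots> = ennreal ((1 - h) / 2 + h * measure cube_lebesgue ?U)"
    using h by (simp add: L.emeasure_eq_measure ennreal_mult' ennreal_plus)
  finally have "risk \<pi> g = (1 - h) / 2 + h * measure cube_lebesgue ?U"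
    using h by (subst (asm) ennreal_inj) (auto simp: risk_def)
  then show ?thesis by simp
qed

lemma bayes_risk_pattern_measure: "bayes_risk \<pi> = (1 - h) / 2"
proof -
  interpret L: prob_space "cube_lebesgue :: (real ^ 'n) measure" by (rule prob_space_cube_lebesgue)
  have "AE x in cube_lebesgue. \<not> bayes_rule \<pi> x \<noteq> f x"
    using bayes_pattern_measure by eventually_elim simp
  then have "measure cube_lebesgue {x \<in> unit_cube. bayes_rule \<pi> x \<noteq> f x} = 0"
    using L.prob_eq_0_AE by fastforce
  then show ?thesis by (simp add: bayes_risk_def risk_pattern_measure[OF bayes_pattern_prediction_rule])
qed

lemma pattern_measure_in_model:
  assumes a: "a \<le> 1" "1 \<le> A" and b: "bayes_rule \<pi> \<in> sparse_class w"
  shows "\<pi> \<in> model w h a A"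
proof -
  have "AE x in cube_lebesgue. h \<le> \<bar>2 * regression \<pi> x - 1\<bar>"
    using regression_pattern_measure
  proof eventually_elim
    case (elim x)
    then show ?case using sign_pattern_cases[of x] h by auto
  qed
  then have "AE x in distr \<pi> cube_lebesgue fst. h \<le> \<bar>2 * regression \<pi> x - 1\<bar>"
    by (simp only: marginal_pattern_measure[unfolded marginal_def])
  then have "AE z in \<pi>. h \<le> \<bar>2 * regression \<pi> (fst z) - 1\<bar>"
    by (rule AE_distrD[OF measurable_fst_obs[OF sets_pattern_measure]])
  moreover have "marginal \<pi> = density cube_lebesgue (\<lambda>x. ennreal 1)"
    by (simp add: marginal_pattern_measure density_1)
  ultimately show ?thesis
    unfolding model_def using prob_space_pattern_measure sets_pattern_measure a b
    by (intro CollectI conjI bexI[of _ "\<lambda>_. 1"]) auto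
qed

end

section \<open>Lower bound for arbitrary classifiers\<close>

text \<open>Needed to attach the event of missing a cell to the law of one observation: weighting a
  sample by a product of weights amounts to taking the product of the weighted laws, whose mass need
  not be 1.\<close>

lemma PiM_density:
  fixes u :: "'a \<Rightarrow> ennreal"
  assumes "finite I" and M: "sigma_finite_measure M" and u: "u \<in> borel_measurable M"
    and uM: "sigma_finite_measure (density M u)"
  shows "density (\<Pi>\<^sub>M i\<in>I. M) (\<lambda>D. \<Prod>i\<in>I. u (D i)) = (\<Pi>\<^sub>M i\<in>I. density M u)"
proof -
  interpret P: product_sigma_finite "\<lambda>i. M" using M by (simp add: product_sigma_finite_def)
  interpret Q: product_sigma_finite "\<lambda>i. density M u" using uM by (simp add: product_sigma_finite_def)
  show ?thesis
  proof (rule Q.PiM_eqI)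
    show "sets (density (\<Pi>\<^sub>M i\<in>I. M) (\<lambda>D. \<Prod>i\<in>I. u (D i))) = sets (\<Pi>\<^sub>M i\<in>I. density M u)"
      by (simp cong: sets_PiM_cong)
    fix A assume "\<And>i. i \<in> I \<Longrightarrow> A i \<in> sets (density M u)"
    then have A: "A i \<in> sets M" if "i \<in> I" for i using that by simp
    have AP: "Pi\<^sub>E I A \<in> sets (\<Pi>\<^sub>M i\<in>I. M)" using \<open>finite I\<close> A by (rule sets_PiM_I_finite)
    have um: "(\<lambda>D. \<Prod>i\<in>I. u (D i)) \<in> borel_measurable (\<Pi>\<^sub>M i\<in>I. M)"
      using u by measurable
    have "emeasure (density (\<Pi>\<^sub>M i\<in>I. M) (\<lambda>D. \<Prod>i\<in>I. u (D i))) (Pi\<^sub>E I A)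
      = (\<integral>\<^sup>+D. (\<Prod>i\<in>I. u (D i)) * indicator (Pi\<^sub>E I A) D \<partial>(\<Pi>\<^sub>M i\<in>I. M))"
      by (rule emeasure_density[OF um AP])
    also have "\<dots> = (\<integral>\<^sup>+D. (\<Prod>i\<in>I. u (D i) * indicator (A i) (D i)) \<partial>(\<Pi>\<^sub>M i\<in>I. M))"
    proof (rule nn_integral_cong)
      fix D assume "D \<in> space (\<Pi>\<^sub>M i\<in>I. M)"
      then have "D \<in> extensional I" by (simp add: space_PiM PiE_def)
      then have "(indicator (Pi\<^sub>E I A) D :: ennreal) = (\<Prod>i\<in>I. indicator (A i) (D i))"
        using \<open>finite I\<close> by (auto simp: indicator_def PiE_def Pi_def prod_zero_iff)
      then show "(\<Prod>i\<in>I. u (D i)) * indicator (Pi\<^sub>E I A) D = (\<Prod>i\<in>I. u (D i) * indicator (A i) (D i))"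
        by (simp add: prod.distrib)
    qed
    also have "\<dots> = (\<Prod>i\<in>I. \<integral>\<^sup>+x. u x * indicator (A i) x \<partial>M)"
      by (rule P.product_nn_integral_prod[OF \<open>finite I\<close>, of "\<lambda>i x. u x * indicator (A i) x"]) (use u A in auto)
    also have "\<dots> = (\<Prod>i\<in>I. emeasure (density M u) (A i))"
      by (intro prod.cong refl emeasure_density[symmetric] u A)
    finally show "emeasure (density (\<Pi>\<^sub>M i\<in>I. M) (\<lambda>D. \<Prod>i\<in>I. u (D i))) (Pi\<^sub>E I A) = (\<Prod>i\<in>I. emeasure (density M u) (A i))" .
  qed fact
qed

text \<open>Its product over a sample is the indicator that no observation falls in the
  cell.\<close>

definition outside_cell :: "nat \<Rightarrow> ('n::finite \<Rightarrow> nat) \<Rightarrow> (real ^ 'n) \<times> real \<Rightarrow> real" where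
  "outside_cell J k z = indicator (- dyadic_cell J k) (fst z)"

lemma outside_cell_measurable [measurable]:
  assumes "k \<in> dyadic_index J"
  shows "outside_cell J k \<in> borel_measurable observation_space"
proof -
  have "outside_cell J k = (\<lambda>z. 1 - indicator (dyadic_cell J k) (fst z))"
    by (auto simp: outside_cell_def fun_eq_iff indicator_def)
  moreover have "(\<lambda>z. 1 - indicator (dyadic_cell J k) (fst z) :: real) \<in> borel_measurable observation_space"
    using measurable_fst_obs[OF refl] assms by measurable
  ultimately show ?thesis by simp
qed

lemma integral_outside_cell:
  fixes k :: "'n::finite \<Rightarrow> nat"
  assumes h: "0 < h" "h < 1" and k: "k \<in> dyadic_index J"
  shows "integrable (pattern_measure h J \<sigma>) (outside_cell J k)"
    and "(\<integral>z. outside_cell J k z \<partial>pattern_measure h J \<sigma>) = 1 - 1 / 2 ^ (CARD('n) * J)"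
proof -
  let ?\<pi> = "pattern_measure h J \<sigma>"
  interpret prob_space ?\<pi> by (rule prob_space_pattern_measure[OF h])
  let ?S = "{z \<in> space ?\<pi>. fst z \<in> dyadic_cell J k}"
  have S: "?S \<in> sets ?\<pi>" using k by (intro sets_cylinder_obs[OF sets_pattern_measure]) auto
  have iS: "integrable ?\<pi> (indicator ?S :: _ \<Rightarrow> real)" using S by (simp add: less_top[symmetric])
  have eq: "outside_cell J k z = 1 - indicator ?S z" if "z \<in> space ?\<pi>" for z
    using that by (auto simp: outside_cell_def indicator_def)
  have "integrable ?\<pi> (\<lambda>z. 1 - indicator ?S z :: real)" using iS by simp
  then show "integrable ?\<pi> (outside_cell J k)"
    by (subst Bochner_Integration.integrable_cong[OF refl eq]) auto
  have "measure ?\<pi> ?S = 1 / 2 ^ (CARD('n) * J)"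
    using emeasure_pattern_cylinder[OF h, of "dyadic_cell J k" J \<sigma>] k
    by (simp add: emeasure_dyadic_cell emeasure_eq_measure)
  moreover have "(\<integral>z. outside_cell J k z \<partial>?\<pi>) = (\<integral>z. 1 - indicator ?S z \<partial>?\<pi>)"
    by (rule Bochner_Integration.integral_cong) (simp_all add: eq)
  ultimately show "(\<integral>z. outside_cell J k z \<partial>?\<pi>) = 1 - 1 / 2 ^ (CARD('n) * J)"
    using iS S by (simp add: prob_space)
qed

definition sample_measure :: "nat \<Rightarrow> real \<Rightarrow> nat \<Rightarrow> ('n::finite \<Rightarrow> nat) set \<Rightarrow> (nat \<Rightarrow> (real ^ 'n) \<times> real) measure" where
  "sample_measure n h J \<sigma> = (\<Pi>\<^sub>M i\<in>{..<n}. pattern_measure h J \<sigma>)"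

lemma sets_sample_measure: "sets (sample_measure n h J \<sigma>) = sets (\<Pi>\<^sub>M i\<in>{..<n}. observation_space)"
  unfolding sample_measure_def by (intro sets_PiM_cong refl sets_pattern_measure)

lemma prob_space_sample_measure:
  "0 < h \<Longrightarrow> h < 1 \<Longrightarrow> prob_space (sample_measure n h J \<sigma>)"
  unfolding sample_measure_def by (intro prob_space_PiM prob_space_pattern_measure)

lemma outside_sample_measurable:
  assumes "k \<in> dyadic_index J"
  shows "(\<lambda>D. \<Prod>i<n. outside_cell J k (D i)) \<in> borel_measurable (sample_measure n h J \<sigma>)"
proof -
  note outside_cell_measurable[OF assms, measurable]
  have "(\<lambda>D. \<Prod>i<n. outside_cell J k (D i)) \<in> borel_measurable (\<Pi>\<^sub>M i\<in>{..<n}. observation_space)"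
    by measurable
  then show ?thesis by (simp cong: measurable_cong_sets[OF sets_sample_measure refl])
qed

text \<open>Two patterns that differ at most on cell \<open>k\<close> have the same density away
  from it. On the event of missing that cell the samples therefore have the same law, and a
  statistic the same integral.\<close>

lemma integral_outside_sample_cong:
  assumes h: "0 < h" "h < 1" and k: "k \<in> dyadic_index J" and \<sigma>: "\<sigma> - {k} = \<sigma>' - {k}"
    and \<Phi>: "\<Phi> \<in> borel_measurable (\<Pi>\<^sub>M i\<in>{..<n}. observation_space)"
  shows "(\<integral>D. (\<Prod>i<n. outside_cell J k (D i)) * \<Phi> D \<partial>sample_measure n h J \<sigma>)
       = (\<integral>D. (\<Prod>i<n. outside_cell J k (D i)) * \<Phi> D \<partial>sample_measure n h J \<sigma>')"
proof -
  \<comment> \<open>Law of one observation killed inside the cell: a sub-probability in which the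
    sign on \<open>k\<close> is no longer visible.\<close>
  define \<nu> where "\<nu> \<sigma> = density (pattern_measure h J \<sigma>) (\<lambda>z. ennreal (outside_cell J k z))" for \<sigma>
  note um = outside_cell_measurable[OF k]
  have um': "(\<lambda>z. ennreal (outside_cell J k z)) \<in> borel_measurable (pattern_measure h J \<sigma>)" for \<sigma>
    using um by (simp cong: measurable_cong_sets[OF sets_pattern_measure refl])
  have \<nu>eq: "\<nu> \<sigma> = \<nu> \<sigma>'"
  proof -
    have "\<nu> \<tau> = density observation_space (\<lambda>z. ennreal (pattern_density h J \<tau> z) * ennreal (outside_cell J k z))" for \<tau>
      unfolding \<nu>_def pattern_measure_def using um by (subst density_density_eq) auto
    moreover have "ennreal (pattern_density h J \<sigma> z) * ennreal (outside_cell J k z)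
        = ennreal (pattern_density h J \<sigma>' z) * ennreal (outside_cell J k z)" if z: "z \<in> space observation_space" for z
    proof (cases "fst z \<in> dyadic_cell J k")
      case False
      have "fst z \<in> unit_cube" using z by (auto simp: space_obs[OF refl])
      then have "dyadic_pos J (fst z) \<noteq> k" using False k by (auto simp: mem_dyadic_cell_iff)
      then have "sign_pattern J \<sigma> (fst z) = sign_pattern J \<sigma>' (fst z)"
        using \<sigma> by (auto simp: sign_pattern_def)
      then show ?thesis by (simp add: pattern_density_def)
    qed (simp add: outside_cell_def)
    moreover have "(\<lambda>z. ennreal (pattern_density h J \<tau> z) * ennreal (outside_cell J k z)) \<in> borel_measurable observation_space" for \<tau>
    proof -
      note um[measurable]
      show ?thesis by measurable
    qed
    ultimately show ?thesis by (simp only:) (rule density_cong, auto)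
  qed
  have "(\<integral>D. (\<Prod>i<n. outside_cell J k (D i)) * \<Phi> D \<partial>sample_measure n h J \<tau>) = (\<integral>D. \<Phi> D \<partial>(\<Pi>\<^sub>M i\<in>{..<n}. \<nu> \<tau>))" for \<tau>
  proof -
    interpret prob_space "pattern_measure h J \<tau>" by (rule prob_space_pattern_measure[OF h])
    have "emeasure (\<nu> \<tau>) (space (\<nu> \<tau>)) = (\<integral>\<^sup>+z. ennreal (outside_cell J k z) * indicator (space (pattern_measure h J \<tau>)) z \<partial>pattern_measure h J \<tau>)"
      unfolding \<nu>_def using um' by (subst emeasure_density) auto
    also have "\<dots> \<le> (\<integral>\<^sup>+z. 1 \<partial>pattern_measure h J \<tau>)"
      by (intro nn_integral_mono) (auto simp: outside_cell_def indicator_def)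
    also have "\<dots> = 1" by (simp add: emeasure_space_1)
    finally have "finite_measure (\<nu> \<tau>)" by (intro finite_measureI) (auto simp: top_unique)
    then have sf: "sigma_finite_measure (\<nu> \<tau>)" by (rule finite_measure.sigma_finite_measure)
    have "(\<Pi>\<^sub>M i\<in>{..<n}. \<nu> \<tau>) = density (sample_measure n h J \<tau>) (\<lambda>D. \<Prod>i<n. ennreal (outside_cell J k (D i)))"
      unfolding sample_measure_def \<nu>_def
      by (rule PiM_density[symmetric]) (use sf um' sigma_finite_measure_axioms in \<open>auto simp: \<nu>_def\<close>)
    also have "(\<lambda>D. \<Prod>i<n. ennreal (outside_cell J k (D i))) = (\<lambda>D. ennreal (\<Prod>i<n. outside_cell J k (D i)))"
      by (rule ext, rule prod_ennreal) (simp add: outside_cell_def)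
    finally have eq: "(\<Pi>\<^sub>M i\<in>{..<n}. \<nu> \<tau>) = density (sample_measure n h J \<tau>) (\<lambda>D. ennreal (\<Prod>i<n. outside_cell J k (D i)))" .
    have \<Phi>': "\<Phi> \<in> borel_measurable (sample_measure n h J \<tau>)"
      using \<Phi> by (simp cong: measurable_cong_sets[OF sets_sample_measure refl])
    show ?thesis unfolding eq
      by (subst integral_density[OF \<Phi>' outside_sample_measurable[OF k]])
        (auto intro!: prod_nonneg simp: outside_cell_def)
  qed
  then show ?thesis by (simp add: \<nu>eq)
qed

text \<open>The joint measurability required of a classifier enters here: the disagreement set is a
  section of a measurable set, and the measure of a section depends measurably on the
  sample.\<close>

lemma classifier_cell_measurable:
  assumes F: "F \<in> classifiers n" and S: "S \<in> sets cube_lebesgue" and g: "g \<in> borel_measurable cube_lebesgue"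
  shows "(\<lambda>D. measure cube_lebesgue {x \<in> S. F D x \<noteq> g x}) \<in> borel_measurable (\<Pi>\<^sub>M i\<in>{..<n}. observation_space)"
proof -
  interpret L: prob_space "cube_lebesgue :: (real ^ 'a) measure" by (rule prob_space_cube_lebesgue)
  let ?P = "(\<Pi>\<^sub>M i\<in>{..<n}. observation_space) :: (nat \<Rightarrow> (real ^ 'a) \<times> real) measure"
  note S[measurable] g[measurable]
  have [measurable]: "(\<lambda>z. F (fst z) (snd z)) \<in> borel_measurable (?P \<Otimes>\<^sub>M cube_lebesgue)"
    using F by (simp add: classifiers_def label_space_measurable_iff case_prod_beta')
  have "{z \<in> space (?P \<Otimes>\<^sub>M cube_lebesgue). snd z \<in> S \<and> F (fst z) (snd z) \<noteq> g (snd z)} \<in> sets (?P \<Otimes>\<^sub>M cube_lebesgue)"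
    (is "?Q \<in> _") by measurable
  from L.measurable_emeasure_Pair[OF this]
  have "(\<lambda>D. enn2real (emeasure cube_lebesgue (Pair D -` ?Q))) \<in> borel_measurable ?P" by measurable
  also have "(\<lambda>D. enn2real (emeasure cube_lebesgue (Pair D -` ?Q))) \<in> borel_measurable ?P
    \<longleftrightarrow> ?thesis"
  proof (rule measurable_cong)
    fix D assume "D \<in> space ?P"
    then have "Pair D -` ?Q = {x \<in> S. F D x \<noteq> g x}"
      using sets.sets_into_space[OF S] by (auto simp: space_pair_measure)
    then show "enn2real (emeasure cube_lebesgue (Pair D -` ?Q)) = measure cube_lebesgue {x \<in> S. F D x \<noteq> g x}"
      by (simp add: measure_def)
  qed
  finally show ?thesis .
qed

lemma classifier_prediction_rule:
  assumes F: "F \<in> classifiers n" and D: "D \<in> space (\<Pi>\<^sub>M i\<in>{..<n}. observation_space)"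
  shows "F D \<in> prediction_rules"
proof -
  have "(\<lambda>x. (case (D, x) of (D, x) \<Rightarrow> F D x)) \<in> cube_lebesgue \<rightarrow>\<^sub>M label_space"
    using F D unfolding classifiers_def by (intro measurable_compose[OF measurable_Pair1']) auto
  then show ?thesis by (simp add: prediction_rules_def)
qed

definition cell_error :: "nat \<Rightarrow> real \<Rightarrow> nat \<Rightarrow> ((nat \<Rightarrow> (real ^ 'n::finite) \<times> real) \<Rightarrow> real ^ 'n \<Rightarrow> real) \<Rightarrow>
    ('n \<Rightarrow> nat) set \<Rightarrow> ('n \<Rightarrow> nat) \<Rightarrow> real" where
  "cell_error n h J F \<sigma> k =
    (\<integral>D. measure cube_lebesgue {x \<in> dyadic_cell J k. F D x \<noteq> sign_pattern J \<sigma> x} \<partial>sample_measure n h J \<sigma>)"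

text \<open>Restrict both errors to samples that miss cell \<open>k\<close>. These have the same law
  under \<open>\<sigma>\<close> and \<open>insert k \<sigma>\<close>, and for each of them the
  errors against the two signs add up to the volume of the cell. The power is the probability that
  \<open>n\<close> observations miss it.\<close>

lemma cell_error_pair:
  fixes k :: "'n::finite \<Rightarrow> nat"
  assumes h: "0 < h" "h < 1" and F: "F \<in> classifiers n" and k: "k \<in> dyadic_index J" and kn: "k \<notin> \<sigma>"
  shows "1 / 2 ^ (CARD('n) * J) * (1 - 1 / 2 ^ (CARD('n) * J)) ^ n
      \<le> cell_error n h J F \<sigma> k + cell_error n h J F (insert k \<sigma>) k"
proof -
  interpret L: prob_space "cube_lebesgue :: (real ^ 'n) measure" by (rule prob_space_cube_lebesgue)
  interpret product_sigma_finite "\<lambda>i::nat. pattern_measure h J \<sigma>"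
    using prob_space_imp_sigma_finite[OF prob_space_pattern_measure[OF h]] by (simp add: product_sigma_finite_def)
  define e where "e c D = measure cube_lebesgue {x \<in> dyadic_cell J k. F D x \<noteq> c}" for c D
  define U where "U D = (\<Prod>i<n. outside_cell J k (D i))" for D
  have cell: "dyadic_cell J k \<in> sets cube_lebesgue" using k by simp
  have em: "e c \<in> borel_measurable (\<Pi>\<^sub>M i\<in>{..<n}. observation_space)" for c
    unfolding e_def by (rule classifier_cell_measurable[OF F cell]) simp
  have em': "e c \<in> borel_measurable (sample_measure n h J \<tau>)" for c \<tau>
    using em by (simp cong: measurable_cong_sets[OF sets_sample_measure refl])
  have e01: "0 \<le> e c D" "e c D \<le> 1" for c D by (auto simp: e_def)
  have Um: "U \<in> borel_measurable (sample_measure n h J \<tau>)" for \<tau>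
    unfolding U_def by (rule outside_sample_measurable[OF k])
  have U01: "0 \<le> U D" "U D \<le> 1" for D
    by (auto simp: U_def outside_cell_def indicator_def intro!: prod_nonneg prod_le_1)
  have ie: "integrable (sample_measure n h J \<tau>) (e c)" for c \<tau>
  proof -
    interpret prob_space "sample_measure n h J \<tau>" by (rule prob_space_sample_measure[OF h])
    show ?thesis by (rule integrable_const_bound[of _ 1]) (use e01 em' in auto)
  qed
  have iUe: "integrable (sample_measure n h J \<tau>) (\<lambda>D. U D * e c D)" for c \<tau>
  proof -
    interpret prob_space "sample_measure n h J \<tau>" by (rule prob_space_sample_measure[OF h])
    show ?thesis
      by (rule integrable_const_bound[of _ 1]) (use e01 U01 em' Um in \<open>auto simp: abs_mult intro!: mult_le_one\<close>)
  qed
  have le: "(\<integral>D. U D * e c D \<partial>sample_measure n h J \<tau>) \<le> (\<integral>D. e c D \<partial>sample_measure n h J \<tau>)" for c \<tau>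
    by (rule integral_mono[OF iUe ie]) (use e01 U01 in \<open>auto intro: mult_left_le_one_le\<close>)
  have c1: "cell_error n h J F \<sigma> k = (\<integral>D. e 1 D \<partial>sample_measure n h J \<sigma>)"
  proof -
    have "{x \<in> dyadic_cell J k. F D x \<noteq> sign_pattern J \<sigma> x} = {x \<in> dyadic_cell J k. F D x \<noteq> 1}" for D
      using kn k by (auto simp: sign_pattern_def mem_dyadic_cell_iff)
    then show ?thesis by (simp add: cell_error_def e_def)
  qed
  have c2: "cell_error n h J F (insert k \<sigma>) k = (\<integral>D. e (-1) D \<partial>sample_measure n h J (insert k \<sigma>))"
  proof -
    have "{x \<in> dyadic_cell J k. F D x \<noteq> sign_pattern J (insert k \<sigma>) x} = {x \<in> dyadic_cell J k. F D x \<noteq> -1}" for D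
      using k by (auto simp: sign_pattern_def mem_dyadic_cell_iff)
    then show ?thesis by (simp add: cell_error_def e_def)
  qed
  have sum: "e 1 D + e (-1) D = 1 / 2 ^ (CARD('n) * J)" if D: "D \<in> space (sample_measure n h J \<sigma>)" for D
  proof -
    have D': "D \<in> space (\<Pi>\<^sub>M i\<in>{..<n}. observation_space)"
      using D sets_eq_imp_space_eq[OF sets_sample_measure] by blast
    have FD: "F D \<in> prediction_rules" by (rule classifier_prediction_rule[OF F D'])
    then have [measurable]: "F D \<in> borel_measurable cube_lebesgue"
      unfolding prediction_rules_def label_space_measurable_iff by blast
    note cell[measurable]
    have eqS: "{x \<in> dyadic_cell J k. F D x \<noteq> c} = {x \<in> space cube_lebesgue. x \<in> dyadic_cell J k \<and> F D x \<noteq> c}" for c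
      using dyadic_cell_subset_unit_cube[OF k] by auto
    have s: "{x \<in> dyadic_cell J k. F D x \<noteq> c} \<in> sets cube_lebesgue" for c
      unfolding eqS by measurable
    have "dyadic_cell J k = {x \<in> dyadic_cell J k. F D x \<noteq> 1} \<union> {x \<in> dyadic_cell J k. F D x \<noteq> -1}" 
      by auto
    moreover have "{x \<in> dyadic_cell J k. F D x \<noteq> 1} \<inter> {x \<in> dyadic_cell J k. F D x \<noteq> -1} = {}"
      using prediction_rules_range[OF FD] dyadic_cell_subset_unit_cube[OF k] by blast
    ultimately have "measure cube_lebesgue (dyadic_cell J k) = e 1 D + e (-1) D"
      unfolding e_def using L.finite_measure_Union[OF s s, of 1 "-1"] by presburger
    then show ?thesis using k by (simp add: measure_dyadic_cell)
  qed
  have "(\<integral>D. U D \<partial>sample_measure n h J \<sigma>) = (\<Prod>i<n. \<integral>z. outside_cell J k z \<partial>pattern_measure h J \<sigma>)"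
    unfolding U_def sample_measure_def
    by (rule product_integral_prod) (use integral_outside_cell[OF h k] in auto)
  also have "\<dots> = (1 - 1 / 2 ^ (CARD('n) * J)) ^ n" by (simp add: integral_outside_cell[OF h k])
  finally have "1 / 2 ^ (CARD('n) * J) * (1 - 1 / 2 ^ (CARD('n) * J)) ^ n
      = (\<integral>D. 1 / 2 ^ (CARD('n) * J) * U D \<partial>sample_measure n h J \<sigma>)"
    by simp
  also have "\<dots> = (\<integral>D. U D * e 1 D + U D * e (-1) D \<partial>sample_measure n h J \<sigma>)"
    by (rule Bochner_Integration.integral_cong) (simp_all add: distrib_left[symmetric] sum mult.commute)
  also have "\<dots> = (\<integral>D. U D * e 1 D \<partial>sample_measure n h J \<sigma>) + (\<integral>D. U D * e (-1) D \<partial>sample_measure n h J \<sigma>)"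
    by (rule Bochner_Integration.integral_add[OF iUe iUe])
  \<comment> \<open>The factor \<open>U\<close> removes the samples that see cell \<open>k\<close>,
    so the law may be exchanged for that of the flipped pattern.\<close>
  also have "(\<integral>D. U D * e (-1) D \<partial>sample_measure n h J \<sigma>) = (\<integral>D. U D * e (-1) D \<partial>sample_measure n h J (insert k \<sigma>))"
    unfolding U_def by (rule integral_outside_sample_cong[OF h k _ em]) (use kn in auto)
  finally show ?thesis using le[of \<sigma> 1] le[of "insert k \<sigma>" "-1"] c1 c2 by linarith
qed

text \<open>Assouad-type averaging: for each \<open>k\<close> in \<open>I\<close> the subsets of
  \<open>I\<close> split into 2^(card I - 1) pairs \<open>\<sigma>\<close>,
  \<open>insert k \<sigma>\<close> with \<open>k \<notin> \<sigma>\<close>, each contributing at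
  least \<tau>.\<close>

lemma sum_Pow_pairs:
  fixes X :: "'a set \<Rightarrow> 'a \<Rightarrow> real"
  assumes I: "finite I" and X: "\<And>k \<sigma>. k \<in> I \<Longrightarrow> \<sigma> \<subseteq> I - {k} \<Longrightarrow> \<tau> \<le> X \<sigma> k + X (insert k \<sigma>) k"
  shows "real (card I) * \<tau> * 2 ^ card I / 2 \<le> (\<Sum>\<sigma>\<in>Pow I. \<Sum>k\<in>I. X \<sigma> k)"
proof -
  have "\<tau> * 2 ^ card I / 2 \<le> (\<Sum>\<sigma>\<in>Pow I. X \<sigma> k)" if k: "k \<in> I" for k
  proof -
    let ?P = "Pow (I - {k})"
    have "Pow I = ?P \<union> insert k ` ?P" using Pow_insert[of k "I - {k}"] k by (simp add: insert_absorb)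
    then have "(\<Sum>\<sigma>\<in>Pow I. X \<sigma> k) = (\<Sum>\<sigma>\<in>?P. X \<sigma> k) + (\<Sum>\<sigma>\<in>insert k ` ?P. X \<sigma> k)"
      using I by (simp only:) (rule sum.union_disjoint, auto)
    also have "(\<Sum>\<sigma>\<in>insert k ` ?P. X \<sigma> k) = (\<Sum>\<sigma>\<in>?P. X (insert k \<sigma>) k)"
      by (subst sum.reindex) (auto simp: inj_on_def)
    also have "(\<Sum>\<sigma>\<in>?P. X \<sigma> k) + \<dots> = (\<Sum>\<sigma>\<in>?P. X \<sigma> k + X (insert k \<sigma>) k)"
      by (simp add: sum.distrib)
    also have "\<dots> \<ge> (\<Sum>\<sigma>\<in>?P. \<tau>)" using X[OF k] by (intro sum_mono) auto
    also have "(\<Sum>\<sigma>\<in>?P. \<tau>) = \<tau> * 2 ^ (card I - 1)"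
      using I k by (simp add: card_Pow)
    also have "\<dots> = \<tau> * 2 ^ card I / 2"
      using I k by (cases "card I") auto
    finally show ?thesis .
  qed
  then have "(\<Sum>k\<in>I. \<tau> * 2 ^ card I / 2) \<le> (\<Sum>k\<in>I. \<Sum>\<sigma>\<in>Pow I. X \<sigma> k)" by (rule sum_mono)
  then show ?thesis by (subst sum.swap) (simp add: mult.assoc)
qed

text \<open>The average over all patterns is reached or exceeded by one of them.\<close>

lemma ex_Pow_pairs:
  fixes X :: "'a set \<Rightarrow> 'a \<Rightarrow> real"
  assumes I: "finite I" and X: "\<And>k \<sigma>. k \<in> I \<Longrightarrow> \<sigma> \<subseteq> I - {k} \<Longrightarrow> \<tau> \<le> X \<sigma> k + X (insert k \<sigma>) k"
  shows "\<exists>\<sigma>\<subseteq>I. real (card I) * \<tau> / 2 \<le> (\<Sum>k\<in>I. X \<sigma> k)"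
proof (rule ccontr)
  assume "\<not> ?thesis"
  then have "(\<Sum>\<sigma>\<in>Pow I. \<Sum>k\<in>I. X \<sigma> k) < (\<Sum>\<sigma>\<in>Pow I. real (card I) * \<tau> / 2)"
    using I by (intro sum_strict_mono) auto
  also have "\<dots> = real (card I) * \<tau> * 2 ^ card I / 2" using I by (simp add: card_Pow)
  finally show False using sum_Pow_pairs[where X = X and \<tau> = \<tau>, OF I X] by simp
qed

text \<open>Disagreements on disjoint cells are part of the disagreement on the cube. Unlike in the
  upper bound, integrability has to be proved: the value 0 of a non-integrable function is of no
  help from below.\<close>

lemma excess_risk_ge_cell_error:
  fixes F :: "(nat \<Rightarrow> (real ^ 'n::finite) \<times> real) \<Rightarrow> real ^ 'n \<Rightarrow> real"
  assumes h: "0 < h" "h < 1" and F: "F \<in> classifiers n" and I: "I \<subseteq> dyadic_index J"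
  shows "h * (\<Sum>k\<in>I. cell_error n h J F \<sigma> k) \<le> excess_risk n (pattern_measure h J \<sigma>) F"
proof -
  interpret L: prob_space "cube_lebesgue :: (real ^ 'n) measure" by (rule prob_space_cube_lebesgue)
  interpret prob_space "sample_measure n h J \<sigma>" by (rule prob_space_sample_measure[OF h])
  let ?f = "sign_pattern J \<sigma>"
  have fin: "finite I" using I finite_dyadic_index finite_subset by blast
  have ms: "(\<lambda>D. measure cube_lebesgue {x \<in> S. F D x \<noteq> ?f x}) \<in> borel_measurable (sample_measure n h J \<sigma>)"
    if "S \<in> sets cube_lebesgue" for S
    using classifier_cell_measurable[OF F that sign_pattern_measurable]
    by (simp cong: measurable_cong_sets[OF sets_sample_measure refl])
  have int: "integrable (sample_measure n h J \<sigma>) (\<lambda>D. measure cube_lebesgue {x \<in> S. F D x \<noteq> ?f x})"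
    if "S \<in> sets cube_lebesgue" for S
    by (rule integrable_const_bound[of _ 1]) (use ms[OF that] in auto)
  have cube: "unit_cube \<in> sets (cube_lebesgue :: (real ^ 'n) measure)" by (simp add: sets_cube_lebesgue)
  have cell: "dyadic_cell J k \<in> sets cube_lebesgue" if "k \<in> I" for k using that I by auto
  have "h * (\<Sum>k\<in>I. cell_error n h J F \<sigma> k)
     = (\<integral>D. h * (\<Sum>k\<in>I. measure cube_lebesgue {x \<in> dyadic_cell J k. F D x \<noteq> ?f x}) \<partial>sample_measure n h J \<sigma>)"
    unfolding cell_error_def using int[OF cell]
    by (subst integral_mult_right_zero, subst Bochner_Integration.integral_sum) auto
  also have "\<dots> \<le> (\<integral>D. h * measure cube_lebesgue {x \<in> unit_cube. F D x \<noteq> ?f x} \<partial>sample_measure n h J \<sigma>)"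
  proof (rule integral_mono)
    show "integrable (sample_measure n h J \<sigma>) (\<lambda>D. h * (\<Sum>k\<in>I. measure cube_lebesgue {x \<in> dyadic_cell J k. F D x \<noteq> ?f x}))"
      using int[OF cell] by (intro integrable_mult_right Bochner_Integration.integrable_sum) auto
    show "integrable (sample_measure n h J \<sigma>) (\<lambda>D. h * measure cube_lebesgue {x \<in> unit_cube. F D x \<noteq> ?f x})"
      using int[OF cube] by (intro integrable_mult_right) auto
    fix D assume D: "D \<in> space (sample_measure n h J \<sigma>)"
    have D': "D \<in> space (\<Pi>\<^sub>M i\<in>{..<n}. observation_space)"
      using D sets_eq_imp_space_eq[OF sets_sample_measure] by blast
    have [measurable]: "F D \<in> borel_measurable cube_lebesgue"
      using classifier_prediction_rule[OF F D'] unfolding prediction_rules_def label_space_measurable_iff by blast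
    have s: "{x \<in> S. F D x \<noteq> ?f x} \<in> sets cube_lebesgue" if S[measurable]: "S \<in> sets cube_lebesgue" for S
    proof -
      have "{x \<in> S. F D x \<noteq> ?f x} = {x \<in> space cube_lebesgue. x \<in> S \<and> F D x \<noteq> ?f x}"
        using sets.sets_into_space[OF S] by auto
      also have "\<dots> \<in> sets cube_lebesgue" by measurable
      finally show ?thesis .
    qed
    have "(\<Sum>k\<in>I. measure cube_lebesgue {x \<in> dyadic_cell J k. F D x \<noteq> ?f x})
       = measure cube_lebesgue (\<Union>k\<in>I. {x \<in> dyadic_cell J k. F D x \<noteq> ?f x})"
    proof (rule L.finite_measure_finite_Union[symmetric, OF fin])
      show "disjoint_family_on (\<lambda>k. {x \<in> dyadic_cell J k. F D x \<noteq> ?f x}) I"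
        using I by (auto simp: disjoint_family_on_def mem_dyadic_cell_iff subset_iff)
    qed (use s cell in auto)
    also have "\<dots> \<le> measure cube_lebesgue {x \<in> unit_cube. F D x \<noteq> ?f x}"
      by (rule L.finite_measure_mono) (use s[OF cube] I dyadic_cell_subset_unit_cube in auto)
    finally show "h * (\<Sum>k\<in>I. measure cube_lebesgue {x \<in> dyadic_cell J k. F D x \<noteq> ?f x})
        \<le> h * measure cube_lebesgue {x \<in> unit_cube. F D x \<noteq> ?f x}"
      using h by simp
  qed
  also have "\<dots> = excess_risk n (pattern_measure h J \<sigma>) F"
    unfolding excess_risk_def sample_measure_def[symmetric]
  proof (rule Bochner_Integration.integral_cong[OF refl])
    fix D assume D: "D \<in> space (sample_measure n h J \<sigma>)"
    have D': "D \<in> space (\<Pi>\<^sub>M i\<in>{..<n}. observation_space)"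
      using D sets_eq_imp_space_eq[OF sets_sample_measure] by blast
    show "h * measure cube_lebesgue {x \<in> unit_cube. F D x \<noteq> ?f x}
       = risk (pattern_measure h J \<sigma>) (F D) - bayes_risk (pattern_measure h J \<sigma>)"
      using risk_pattern_measure[where J = J and \<sigma> = \<sigma>, OF h classifier_prediction_rule[OF F D']]
        bayes_risk_pattern_measure[where J = J and \<sigma> = \<sigma>, OF h]
      by simp
  qed
  finally show ?thesis .
qed

text \<open>\<open>m\<close> is left free: a smaller \<open>m\<close> gives a larger loss, of order
  2^(-d m), but more cells to be paid for by the weight. Of the factor 1/4, one half is the average
  over a pair of signs, the other a lower bound on the probability of missing a cell.\<close>

theorem classifier_lower_bound:
  fixes h a A :: real and n J m :: nat
  assumes h: "0 < h" "h < 1" and a: "a \<le> 1" "1 \<le> A" and mJ: "m \<le> J"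
    and nJ: "2 * real n \<le> 2 ^ (CARD('n) * J)" 
    and w0: "1 \<le> w 0" "\<And>j. 0 \<le> w j"
    and w1: "\<And>j. 1 \<le> j \<Longrightarrow> j < m \<Longrightarrow> 2 ^ CARD('n) - 1 \<le> w j"
    and w2: "1 \<le> m \<Longrightarrow> 2 ^ CARD('n) \<le> w m"
    and w3: "\<And>j. m < j \<Longrightarrow> j \<le> J \<Longrightarrow> 2 ^ (CARD('n) * (j - m)) \<le> w j"
  shows "ereal (h / (4 * 2 ^ (CARD('n) * m))) \<le>
    (INF F\<in>classifiers n. SUP \<pi>\<in>(model w h a A :: ((real ^ 'n::finite) \<times> real) measure set). ereal (excess_risk n \<pi> F))"
proof (rule INF_greatest)
  fix F :: "(nat \<Rightarrow> (real ^ 'n) \<times> real) \<Rightarrow> real ^ 'n \<Rightarrow> real" assume F: "F \<in> classifiers n"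
  define I :: "('n \<Rightarrow> nat) set" where "I = dyadic_index (J - m)"
  define M :: real where "M = 2 ^ (CARD('n) * J)"
  define \<tau> where "\<tau> = 1 / M * (1 - 1 / M) ^ n"
  have I: "I \<subseteq> dyadic_index J"
  proof -
    have "(2::nat) ^ (J - m) \<le> 2 ^ J" by (intro power_increasing) auto
    then show ?thesis by (auto simp: I_def dyadic_index_def intro: less_le_trans)
  qed
  have "\<exists>\<sigma>\<subseteq>I. real (card I) * \<tau> / 2 \<le> (\<Sum>k\<in>I. cell_error n h J F \<sigma> k)"
  proof (rule ex_Pow_pairs)
    fix k \<sigma> assume "k \<in> I" "\<sigma> \<subseteq> I - {k}"
    then show "\<tau> \<le> cell_error n h J F \<sigma> k + cell_error n h J F (insert k \<sigma>) k"
      unfolding \<tau>_def M_def using I by (intro cell_error_pair[OF h F]) auto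
  qed (simp add: I_def)
  then obtain \<sigma> where \<sigma>: "\<sigma> \<subseteq> I" and le: "real (card I) * \<tau> / 2 \<le> (\<Sum>k\<in>I. cell_error n h J F \<sigma> k)"
    by blast
  have M1: "1 \<le> M" by (simp add: M_def)
  \<comment> \<open>Bernoulli's inequality; this is where 2 n \<le> 2^(d J) enters.\<close>
  have "1 / 2 \<le> 1 - real n / M" using nJ M1 by (simp add: M_def field_simps)
  also have "\<dots> \<le> (1 - 1 / M) ^ n" using Bernoulli_inequality[of "- (1 / M)" n] M1 by simp
  finally have p: "1 / 2 \<le> (1 - 1 / M) ^ n" .
  \<comment> \<open>The free cells fill the corner cell of frequency \<open>m\<close>: their number
    divided by \<open>M\<close> is its volume.\<close>
  have "M = 2 ^ (CARD('n) * m) * real (card I)"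
    using mJ by (simp add: M_def I_def card_dyadic_index power_add[symmetric] distrib_left[symmetric])
  moreover from this have "real (card I) \<noteq> 0" using M1 by (cases "card I = 0") simp_all
  ultimately have cI: "real (card I) / M = 1 / 2 ^ (CARD('n) * m)" by (simp only:) simp
  have "h / (4 * 2 ^ (CARD('n) * m)) = h * (real (card I) / M * (1 / 2) / 2)" by (simp add: cI)
  also have "\<dots> \<le> h * (real (card I) / M * (1 - 1 / M) ^ n / 2)"
    using h M1 p by (intro mult_left_mono divide_right_mono) auto
  also have "\<dots> = h * (real (card I) * \<tau> / 2)" by (simp add: \<tau>_def)
  also have "\<dots> \<le> h * (\<Sum>k\<in>I. cell_error n h J F \<sigma> k)" using le h by simp
  also have "\<dots> \<le> excess_risk n (pattern_measure h J \<sigma>) F" by (rule excess_risk_ge_cell_error[OF h F I])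
  finally have "ereal (h / (4 * 2 ^ (CARD('n) * m))) \<le> ereal (excess_risk n (pattern_measure h J \<sigma>) F)" by simp
  moreover have "bayes_rule (pattern_measure h J \<sigma>) \<in> sparse_class w"
    by (rule pattern_sparse[OF bayes_pattern_measure[OF h] _ mJ bayes_pattern_prediction_rule[OF h]])
      (use \<sigma> w0 w1 w2 w3 in \<open>auto simp: I_def\<close>)
  then have "pattern_measure h J \<sigma> \<in> model w h a A" by (rule pattern_measure_in_model[OF h a])
  ultimately show "ereal (h / (4 * 2 ^ (CARD('n) * m))) \<le> (SUP \<pi>\<in>model w h a A. ereal (excess_risk n \<pi> F))"
    by (intro SUP_upper2)
qed

section \<open>Ranks and weights of the two regimes\<close>

text \<open>For the least \<open>l\<close> with 2^(d l) \<ge> 2 n the excess is at most a factor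
  2^d. Adding \<open>J0\<close> imposes a minimal rank for every \<open>n\<close>, at the price of
  the constant 2^(d J0).\<close>

lemma ex_rank_for_sample_size:
  assumes d: "0 < d" and n: "1 \<le> n"
  obtains J :: nat where "J0 \<le> J" "2 * real n \<le> 2 ^ (d * J)" "2 ^ (d * J) \<le> 2 ^ (d * J0 + d + 1) * real n"
proof -
  define P where "P j \<longleftrightarrow> 2 * real n \<le> 2 ^ (d * j)" for j
  define l where "l = (LEAST j. P j)"
  obtain j where j: "2 * real n < 2 ^ j" using real_arch_pow[of 2] by auto
  have "(2::real) ^ j \<le> 2 ^ (d * j)" using d by (intro power_increasing) auto
  then have "P j" unfolding P_def using j by linarith
  then have l: "P l" unfolding l_def by (rule LeastI)
  have up: "2 ^ (d * l) \<le> 2 ^ (d + 1) * real n"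
  proof (cases l)
    case 0
    have "(1::real) \<le> 2 ^ (d + 1)" by (rule one_le_power) simp
    then have "1 * 1 \<le> 2 ^ (d + 1) * real n" using n by (intro mult_mono) auto
    then show ?thesis by (simp add: 0)
  next
    case (Suc i)
    then have "\<not> P i" using not_less_Least[of i P] by (simp add: l_def)
    then have "(2::real) ^ (d * i) \<le> 2 * real n" by (simp add: P_def)
    then show ?thesis by (simp add: Suc power_add)
  qed
  show ?thesis
  proof (rule that[of "J0 + l"])
    have "2 * real n \<le> 2 ^ (d * l)" using l by (simp add: P_def)
    also have "\<dots> \<le> 2 ^ (d * (J0 + l))" by (intro power_increasing) auto
    finally show "2 * real n \<le> 2 ^ (d * (J0 + l))" .
    show "2 ^ (d * (J0 + l)) \<le> 2 ^ (d * J0 + d + 1) * real n"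
      using up by (simp add: distrib_left power_add mult.assoc)
  qed simp
qed

text \<open>Here \<beta> = 1: the last factor cancels 2^(d j), and what remains is that the weight
  never exceeds 2^(d K).\<close>

lemma saturating_weight_decay:
  "saturating_weight d K j \<le> 2 ^ (d * K) * 2 ^ (d * j) * (2 powr (- (real d * 1))) ^ j"
proof -
  have "(2::real) ^ (d * j) * (2 powr (- (real d * 1))) ^ j = 1"
    by (simp add: powr_minus powr_realpow power_mult power_inverse)
  moreover have "(2::real) ^ (d * j) \<le> 2 ^ (d * K)" if "j \<le> K" using that by (intro power_increasing) auto
  ultimately show ?thesis by (simp add: saturating_weight_def mult.assoc)
qed

text \<open>With m = J a single cell, of volume of order 1 / n, has a free sign. At most 2^d cells
  per positive frequency are needed, which \<open>1 \<le> K\<close> allows.\<close>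

lemma saturating_lower_bound:
  fixes h a A :: real
  assumes h: "0 < h" "h < 1" and a: "a \<le> 1" "1 \<le> A" and K: "1 \<le> K"
  shows "\<exists>C0>0. \<forall>n\<ge>1. (INF F\<in>classifiers n.
      SUP \<pi>\<in>(model (saturating_weight CARD('n) K) h a A :: ((real ^ 'n::finite) \<times> real) measure set).
        ereal (excess_risk n \<pi> F)) \<ge> ereal (C0 * (1 / real n))"
proof (intro exI conjI allI impI)
  define d where "d = CARD('n)"
  have d: "0 < d" by (simp add: d_def)
  show "0 < h / (4 * 2 ^ (d + 1))" using h by simp
  fix n :: nat assume n: "1 \<le> n"
  obtain J where J: "2 * real n \<le> 2 ^ (d * J)" "2 ^ (d * J) \<le> 2 ^ (d + 1) * real n"
    using ex_rank_for_sample_size[OF d n, of 0] by auto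
  have "h / (4 * 2 ^ (d + 1)) * (1 / real n) = h / (4 * (2 ^ (d + 1) * real n))" by simp
  also have "\<dots> \<le> h / (4 * 2 ^ (CARD('n) * J))"
    using h J n by (intro divide_left_mono) (auto simp: d_def mult_ac)
  finally have "ereal (h / (4 * 2 ^ (d + 1)) * (1 / real n)) \<le> ereal (h / (4 * 2 ^ (CARD('n) * J)))" by simp
  also have "\<dots> \<le> (INF F\<in>classifiers n.
      SUP \<pi>\<in>(model (saturating_weight CARD('n) K) h a A :: ((real ^ 'n) \<times> real) measure set).
        ereal (excess_risk n \<pi> F))"
  proof (rule classifier_lower_bound[OF h a order_refl])
    have w: "2 ^ d \<le> saturating_weight d K j" if "1 \<le> j" for j
      using that K unfolding saturating_weight_def by (auto intro!: power_increasing)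
    show "2 ^ CARD('n) - 1 \<le> saturating_weight CARD('n) K j" if "1 \<le> j" for j
      using w[OF that] by (simp add: d_def)
    show "2 ^ CARD('n) \<le> saturating_weight CARD('n) K J" if "1 \<le> J"
      using w[OF that] by (simp add: d_def)
  qed (use J in \<open>auto simp: saturating_weight_def d_def\<close>)
  finally show "ereal (h / (4 * 2 ^ (d + 1)) * (1 / real n)) \<le> (INF F\<in>classifiers n.
      SUP \<pi>\<in>(model (saturating_weight CARD('n) K) h a A :: ((real ^ 'n) \<times> real) measure set).
        ereal (excess_risk n \<pi> F))" .
qed

text \<open>Beyond the threshold the weight is exactly 2^(d j) times the geometric factor; the
  constant only accommodates the frequencies up to the threshold.\<close>

lemma exponential_weight_decay:
  assumes "0 < \<alpha>"
  shows "exponential_weight d \<alpha> j \<le> 2 ^ (d * exponential_threshold d \<alpha>) * 2 ^ (d * j)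
    * (2 powr (- (real d * (1 - \<alpha>)))) ^ j"
proof -
  define N where "N = exponential_threshold d \<alpha>"
  have "(2::real) ^ (d * j) * (2 powr (- (real d * (1 - \<alpha>)))) ^ j
      = 2 powr (real (d * j)) * 2 powr (- (real d * (1 - \<alpha>)) * real j)"
    by (simp add: powr_realpow[symmetric] powr_powr del: of_nat_mult)
  also have "\<dots> = 2 powr (real d * \<alpha> * real j)"
    by (simp add: powr_add[symmetric] algebra_simps)
  finally have e: "(2::real) ^ (d * j) * (2 powr (- (real d * (1 - \<alpha>)))) ^ j = 2 powr (real d * \<alpha> * real j)" .
  have ge1: "1 \<le> 2 powr (real d * \<alpha> * real j)" using assms by (intro ge_one_powr_ge_zero) auto
  have "exponential_weight d \<alpha> j \<le> 2 ^ (d * N) * 2 powr (real d * \<alpha> * real j)"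
  proof (cases "j \<le> N")
    case True
    then have "(2::real) ^ (d * j) \<le> 2 ^ (d * N)" by (intro power_increasing) auto
    also have "2 ^ (d * N) * 1 \<le> 2 ^ (d * N) * 2 powr (real d * \<alpha> * real j)"
      using ge1 by (intro mult_left_mono) auto
    finally show ?thesis using True by (simp add: exponential_weight_def N_def)
  next
    case False
    have "1 * 2 powr (real d * \<alpha> * real j) \<le> 2 ^ (d * N) * 2 powr (real d * \<alpha> * real j)"
      by (intro mult_right_mono) auto
    then show ?thesis using False by (simp add: exponential_weight_def N_def)
  qed
  then show ?thesis unfolding N_def mult.assoc e by (simp add: mult.assoc)
qed

text \<open>What the threshold is for: past it the exponential weight is already at least 2^d - 1,
  up to it the weight admits every cell.\<close>

lemma exponential_weight_ge:
  assumes d: "0 < d" and \<alpha>: "0 < \<alpha>" and j: "1 \<le> j"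
  shows "2 ^ d - 1 \<le> exponential_weight d \<alpha> j"
proof (cases "j \<le> exponential_threshold d \<alpha>")
  case True
  have "(2::real) ^ d \<le> 2 ^ (d * j)" using j by (intro power_increasing) auto
  then have "(2::real) ^ d - 1 \<le> 2 ^ (d * j)" by linarith
  then show ?thesis using True by (simp add: exponential_weight_def)
next
  case False
  let ?S = "{N. 2 powr (real d * \<alpha> * real N) \<ge> 2 ^ d - 1}"
  \<comment> \<open>The set must be nonempty for its infimum to belong to it; any N \<ge> 1 /
    \<alpha> works, since then 2^(d \<alpha> N) \<ge> 2^d.\<close>
  obtain N :: nat where N: "1 / \<alpha> \<le> real N" using real_arch_simple by blast
  have "(2::real) ^ d = 2 powr real d" by (simp add: powr_realpow)
  also have "\<dots> \<le> 2 powr (real d * \<alpha> * real N)"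
  proof (rule powr_mono)
    have "real d * 1 \<le> real d * (\<alpha> * real N)" using N \<alpha> by (intro mult_left_mono) (auto simp: field_simps)
    then show "real d \<le> real d * \<alpha> * real N" by (simp add: mult.assoc)
  qed simp
  finally have "N \<in> ?S" by simp
  then have "Inf ?S \<in> ?S" by (intro Inf_nat_def1) blast
  then have "2 ^ d - 1 \<le> 2 powr (real d * \<alpha> * real (exponential_threshold d \<alpha>))"
    by (simp add: exponential_threshold_def)
  also have "\<dots> \<le> 2 powr (real d * \<alpha> * real j)"
    using False \<alpha> by (intro powr_mono mult_left_mono) auto
  finally show ?thesis using False by (simp add: exponential_weight_def)
qed

lemma exponential_weight_ge_power:
  assumes j: "real k \<le> \<alpha> * real j" "k \<le> j"
  shows "2 ^ (d * k) \<le> exponential_weight d \<alpha> j"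
proof (cases "j \<le> exponential_threshold d \<alpha>")
  case True
  have "(2::real) ^ (d * k) \<le> 2 ^ (d * j)" using j by (intro power_increasing) auto
  then show ?thesis using True by (simp add: exponential_weight_def)
next
  case False
  have "(2::real) ^ (d * k) = 2 powr (real d * real k)" by (simp add: powr_realpow[symmetric])
  also have "\<dots> \<le> 2 powr (real d * (\<alpha> * real j))" using j by (intro powr_mono mult_left_mono) auto
  finally show ?thesis using False by (simp add: exponential_weight_def mult.assoc)
qed

text \<open>Fitting the 2^(d (J - m)) free cells into 2^(d \<alpha> J) requires m \<ge> (1 -
  \<alpha>) J. The smallest such m gives the largest loss, and 2^(-d m) is then of order n^(-(1 -
  \<alpha>)).\<close>

lemma exponential_lower_bound:
  fixes h a A \<alpha> :: real
  assumes h: "0 < h" "h < 1" and a: "a \<le> 1" "1 \<le> A" and \<alpha>: "0 < \<alpha>" "\<alpha> < 1"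
  shows "\<exists>C0>0. \<forall>n\<ge>1. (INF F\<in>classifiers n.
      SUP \<pi>\<in>(model (exponential_weight CARD('n) \<alpha>) h a A :: ((real ^ 'n::finite) \<times> real) measure set).
        ereal (excess_risk n \<pi> F)) \<ge> ereal (C0 * real n powr (-1 + \<alpha>))"
proof -
  define d where "d = CARD('n)"
  have d: "0 < d" by (simp add: d_def)
  \<comment> \<open>J \<ge> J0 gives \<alpha> m \<ge> 1, hence room for all 2^d children at
    frequency m.\<close>
  define J0 where "J0 = nat \<lceil>1 / (\<alpha> * (1 - \<alpha>))\<rceil>"
  define B :: real where "B = 2 ^ (d * J0 + d + 1)"
  have B: "0 < B" by (simp add: B_def)
  \<comment> \<open>The factor 2^d comes from rounding m up, and \<open>B\<close> bounds the ratio
    of 2^(d J) to n.\<close>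
  define C0 where "C0 = h / (4 * 2 ^ d * B powr (1 - \<alpha>))"
  have C0: "0 < C0" using h B by (simp add: C0_def)
  have "ereal (C0 * real n powr (-1 + \<alpha>)) \<le> (INF F\<in>classifiers n.
      SUP \<pi>\<in>(model (exponential_weight CARD('n) \<alpha>) h a A :: ((real ^ 'n) \<times> real) measure set).
        ereal (excess_risk n \<pi> F))" if n: "1 \<le> n" for n
  proof -
    obtain J where J: "J0 \<le> J" "2 * real n \<le> 2 ^ (d * J)" "2 ^ (d * J) \<le> B * real n"
      using ex_rank_for_sample_size[OF d n, of J0] unfolding B_def by metis
    define m where "m = nat \<lceil>(1 - \<alpha>) * real J\<rceil>"
    have nn: "0 \<le> (1 - \<alpha>) * real J" using \<alpha> by simp
    then have m: "(1 - \<alpha>) * real J \<le> real m" "real m \<le> (1 - \<alpha>) * real J + 1" unfolding m_def by linarith+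
    have mJ: "m \<le> J"
    proof -
      have "(1 - \<alpha>) * real J \<le> real J" using \<alpha> by (intro mult_left_le_one_le) auto
      then show ?thesis unfolding m_def by linarith
    qed
    have \<alpha>m: "1 \<le> \<alpha> * real m"
    proof -
      have "1 / (\<alpha> * (1 - \<alpha>)) \<le> real J0" unfolding J0_def by linarith
      also have "\<dots> \<le> real J" using J by simp
      finally have "1 \<le> \<alpha> * ((1 - \<alpha>) * real J)" using \<alpha> by (simp add: field_simps)
      also have "\<dots> \<le> \<alpha> * real m" using m \<alpha> by (intro mult_left_mono) auto
      finally show ?thesis .
    qed
    have p: "2 ^ (d * m) \<le> 2 ^ d * (B powr (1 - \<alpha>) * real n powr (1 - \<alpha>))"
    proof -
      have "(2::real) ^ (d * m) = 2 powr (real d * real m)" by (simp add: powr_realpow[symmetric])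
      also have "\<dots> \<le> 2 powr (real d * ((1 - \<alpha>) * real J + 1))"
        using m by (intro powr_mono mult_left_mono) auto
      also have "\<dots> = 2 ^ d * (2 powr (real (d * J))) powr (1 - \<alpha>)"
        by (simp add: powr_powr distrib_left powr_add powr_realpow mult_ac)
      also have "\<dots> = 2 ^ d * (2 ^ (d * J)) powr (1 - \<alpha>)"
        by (subst powr_realpow) auto
      also have "\<dots> \<le> 2 ^ d * (B * real n) powr (1 - \<alpha>)"
        using J(3) \<alpha> by (intro mult_left_mono powr_mono2) auto
      also have "(B * real n) powr (1 - \<alpha>) = B powr (1 - \<alpha>) * real n powr (1 - \<alpha>)"
        using B by (simp add: powr_mult)
      finally show ?thesis .
    qed
    have "real n powr (-1 + \<alpha>) = 1 / real n powr (1 - \<alpha>)"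
      using powr_minus_divide[of "real n" "1 - \<alpha>"] by simp
    then have "C0 * real n powr (-1 + \<alpha>) = h / (4 * (2 ^ d * (B powr (1 - \<alpha>) * real n powr (1 - \<alpha>))))"
      by (simp add: C0_def mult.assoc)
    also have "\<dots> \<le> h / (4 * 2 ^ (CARD('n) * m))"
      using p h n B by (intro divide_left_mono mult_left_mono) (auto simp: d_def)
    finally have "ereal (C0 * real n powr (-1 + \<alpha>)) \<le> ereal (h / (4 * 2 ^ (CARD('n) * m)))" by simp
    also have "\<dots> \<le> (INF F\<in>classifiers n.
      SUP \<pi>\<in>(model (exponential_weight CARD('n) \<alpha>) h a A :: ((real ^ 'n) \<times> real) measure set).
        ereal (excess_risk n \<pi> F))"
    proof (rule classifier_lower_bound[OF h a mJ])
      show "2 ^ CARD('n) - 1 \<le> exponential_weight CARD('n) \<alpha> j" if "1 \<le> j" for j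
        using exponential_weight_ge[OF d \<alpha>(1) that] by (simp add: d_def)
      show "2 ^ CARD('n) \<le> exponential_weight CARD('n) \<alpha> m" if "1 \<le> m"
        using exponential_weight_ge_power[of 1 \<alpha> m d] that \<alpha>m by (simp add: d_def)
      show "2 ^ (CARD('n) * (j - m)) \<le> exponential_weight CARD('n) \<alpha> j" if "m < j" "j \<le> J" for j
      proof (rule exponential_weight_ge_power)
        \<comment> \<open>Frequencies between m and J fit as well: j - m \<le> j - (1 - \<alpha>) J
          \<le> \<alpha> j because j \<le> J.\<close>
        have "(1 - \<alpha>) * real j \<le> (1 - \<alpha>) * real J" using that \<alpha> by (intro mult_left_mono) auto
        then have "real j - real m \<le> \<alpha> * real j" using m by (simp add: algebra_simps)
        then show "real (j - m) \<le> \<alpha> * real j" using that by (simp add: of_nat_diff)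
      qed simp
    qed (use J in \<open>auto simp: exponential_weight_def d_def\<close>)
    finally show ?thesis .
  qed
  then show ?thesis using C0 by blast
qed

section \<open>The two regimes together\<close>

theorem theorem5:
  fixes h a A :: real
  assumes "0 < h" and "h < 1" and "0 < a" and "a \<le> 1" and "1 \<le> A"
  shows
    "(\<forall>K::nat. 1 \<le> K \<longrightarrow>
       (let P = (model (saturating_weight CARD('n) K) h a A :: ((real ^ 'n) \<times> real) measure set) in
        (\<exists>C>0. \<exists>J :: nat \<Rightarrow> nat. of_reference_order CARD('n) a J \<and>
           (\<forall>n\<ge>2. (SUP \<pi>\<in>P. ereal (excess_risk n \<pi> (dyadic_estimator n (J n))))
                    \<le> ereal (C * (ln (real n) / real n)))) \<and>
        (\<exists>C0>0. \<forall>n\<ge>1. (INF F\<in>classifiers n. SUP \<pi>\<in>P. ereal (excess_risk n \<pi> F))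
                    \<ge> ereal (C0 * (1 / real n))))) \<and>
     (\<forall>\<alpha>::real. 0 < \<alpha> \<and> \<alpha> < 1 \<longrightarrow>
       (let P = (model (exponential_weight CARD('n) \<alpha>) h a A :: ((real ^ 'n) \<times> real) measure set) in
        (\<exists>C>0. \<exists>J :: nat \<Rightarrow> nat. of_reference_order CARD('n) a J \<and>
           (\<forall>n\<ge>2. (SUP \<pi>\<in>P. ereal (excess_risk n \<pi> (dyadic_estimator n (J n))))
                    \<le> ereal (C * (ln (real n) / real n) powr (1 - \<alpha>)))) \<and>
        (\<exists>C0>0. \<forall>n\<ge>1. (INF F\<in>classifiers n. SUP \<pi>\<in>P. ereal (excess_risk n \<pi> F))
                    \<ge> ereal (C0 * real n powr (-1 + \<alpha>)))))"
proof (intro conjI allI impI)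
  fix K :: nat assume K: "1 \<le> K"
  \<comment> \<open>The decay lemma selects \<beta> = 1; \<open>powr 1\<close> disappears afterwards
    because ln n / n is nonnegative.\<close>
  have "\<exists>C>0. \<exists>J. of_reference_order CARD('n) a J \<and>
     (\<forall>n\<ge>2. \<forall>\<pi>\<in>(model (saturating_weight CARD('n) K) h a A :: ((real ^ 'n) \<times> real) measure set).
        excess_risk n \<pi> (dyadic_estimator n (J n)) \<le> C * (ln (real n) / real n) powr 1)"
    by (rule estimator_upper_bound[OF assms(1,2,3) _ _ _ _ saturating_weight_decay]) (use assms(5) in auto)
  then obtain C J where C: "0 < C" and J: "of_reference_order CARD('n) a J"
    and le: "\<forall>n\<ge>2. \<forall>\<pi>\<in>(model (saturating_weight CARD('n) K) h a A :: ((real ^ 'n) \<times> real) measure set).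
        excess_risk n \<pi> (dyadic_estimator n (J n)) \<le> C * (ln (real n) / real n) powr 1"
    by blast
  have "(SUP \<pi>\<in>(model (saturating_weight CARD('n) K) h a A :: ((real ^ 'n) \<times> real) measure set).
      ereal (excess_risk n \<pi> (dyadic_estimator n (J n)))) \<le> ereal (C * (ln (real n) / real n))" if "2 \<le> n" for n
    using le that by (intro SUP_least) simp
  then show "let P = (model (saturating_weight CARD('n) K) h a A :: ((real ^ 'n) \<times> real) measure set) in
        (\<exists>C>0. \<exists>J :: nat \<Rightarrow> nat. of_reference_order CARD('n) a J \<and>
           (\<forall>n\<ge>2. (SUP \<pi>\<in>P. ereal (excess_risk n \<pi> (dyadic_estimator n (J n))))
                    \<le> ereal (C * (ln (real n) / real n)))) \<and>
        (\<exists>C0>0. \<forall>n\<ge>1. (INF F\<in>classifiers n. SUP \<pi>\<in>P. ereal (excess_risk n \<pi> F))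
                    \<ge> ereal (C0 * (1 / real n)))"
    unfolding Let_def using C J saturating_lower_bound[OF assms(1,2,4,5) K] by blast
next
  fix \<alpha> :: real assume \<alpha>: "0 < \<alpha> \<and> \<alpha> < 1"
  have "\<exists>C>0. \<exists>J. of_reference_order CARD('n) a J \<and>
     (\<forall>n\<ge>2. \<forall>\<pi>\<in>(model (exponential_weight CARD('n) \<alpha>) h a A :: ((real ^ 'n) \<times> real) measure set).
        excess_risk n \<pi> (dyadic_estimator n (J n)) \<le> C * (ln (real n) / real n) powr (1 - \<alpha>))"
    by (rule estimator_upper_bound[OF assms(1,2,3) _ _ _ _ exponential_weight_decay]) (use assms(5) \<alpha> in auto)
  then obtain C J where C: "0 < C" and J: "of_reference_order CARD('n) a J"
    and le: "\<forall>n\<ge>2. \<forall>\<pi>\<in>(model (exponential_weight CARD('n) \<alpha>) h a A :: ((real ^ 'n) \<times> real) measure set).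
        excess_risk n \<pi> (dyadic_estimator n (J n)) \<le> C * (ln (real n) / real n) powr (1 - \<alpha>)"
    by blast
  have "(SUP \<pi>\<in>(model (exponential_weight CARD('n) \<alpha>) h a A :: ((real ^ 'n) \<times> real) measure set).
      ereal (excess_risk n \<pi> (dyadic_estimator n (J n)))) \<le> ereal (C * (ln (real n) / real n) powr (1 - \<alpha>))" if "2 \<le> n" for n
    using le that by (intro SUP_least) simp
  then show "let P = (model (exponential_weight CARD('n) \<alpha>) h a A :: ((real ^ 'n) \<times> real) measure set) in
        (\<exists>C>0. \<exists>J :: nat \<Rightarrow> nat. of_reference_order CARD('n) a J \<and>
           (\<forall>n\<ge>2. (SUP \<pi>\<in>P. ereal (excess_risk n \<pi> (dyadic_estimator n (J n))))
                    \<le> ereal (C * (ln (real n) / real n) powr (1 - \<alpha>)))) \<and>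
        (\<exists>C0>0. \<forall>n\<ge>1. (INF F\<in>classifiers n. SUP \<pi>\<in>P. ereal (excess_risk n \<pi> F))
                    \<ge> ereal (C0 * real n powr (-1 + \<alpha>)))"
    unfolding Let_def using C J exponential_lower_bound[OF assms(1,2,4,5), of \<alpha>] \<alpha> by blast
qed

end
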